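(* Let $L$ be a countable continuous relational signature in which each $n$-ary relation symbol has an inverse continuity modulus $\le n\cdot id$. Then the family $\mathcal{B}_0$ of graded subsets $M\mapsto\phi^M(\bar s)$ of $\mathbb{U}_L$, where $\phi(\bar s)$ ranges over continuous $L$-sentences with parameters $\bar s$ from $\mathbb{QU}$, is a nice basis of the $Iso(\mathbb{U})$-space $\mathbb{U}_L$ with respect to $\mathcal{R}^U$.
   Context: $\mathbb{U}$ is the Urysohn space of diameter 1 (the unique Polish metric space of diameter $\le1$ that is universal and ultrahomogeneous); $\mathbb{QU}$ is the rational Urysohn space of diameter 1, embedded in $\mathbb{U}$ as a dense subset so that every isometry of $\mathbb{QU}$ extends to an isometry of $\mathbb{U}$ and $Iso(\mathbb{QU})$ is dense in $Iso(\mathbb{U})$. $G_0$ is a fixed dense countable subgroup of $Iso(\mathbb{QU})$, viewed inside $Iso(\mathbb{U})$. For a finite tuple $\bar s$ from $\mathbb{QU}$ and $q\in\mathbb{Q}^+$, $H_{q,\bar s}(g)=\min(q\cdot d(g(\bar s),\bar s),1)$ with $d$ on tuples being the max of coordinatewise distances; $\mathcal{R}_0$ is the family of these. $\mathcal{R}^U$ is the family of all graded cosets $g\mapsto H(gg_0^{-1})$, $g_0\in G_0$, of graded subgroups $H=\max(H_1,\dots,H_k)$ with $H_i\in\mathcal{R}_0$. An inverse continuity modulus of $F:\mathbf{X}^n\to[0,1]$ is a continuous monotone $\delta:[0,1]\to[0,1]$, $\delta(0)=0$, with $|F(\bar a)-F(\bar b)|\le\delta(\max_i d(a_i,b_i))$.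 Continuous formulas are built from atomic formulas and $0,1$ by $x/2$, $\dot-$, $\min$, $\max$, $|x-y|$, $1-x$, $\dot+$, dotted multiplication by positive rationals, $\sup_x$, $\inf_x$. $\mathbb{U}_L$ is the Polish space of all metric $L$-structures on $(\mathbb{U},d)$, with metric $\delta(M,N)=\sum_i2^{-i}|R^M_j(\bar s)-R^N_j(\bar s)|$ over an enumeration of pairs $(R_j,\bar s)$, $\bar s$ tuples from $\mathbb{QU}$; $Iso(\mathbb{U})$ acts by transport of structure. Graded-set notions: a graded subset is a function to $[0,1]$, $\phi_{<r}=\{\phi<r\}$; open = upper semicontinuous; graded subgroup $H$: $H(1)=0$, $H(g)=H(g^{-1})$, $H(gg')\le H(g)+H(g')$; $\phi$ is $H$-invariant if $\phi(gx)\le\phi(x)\dot+H(g)$; Vaught transforms for open graded $J\sqsubseteq G$: $\phi^{\Delta J}(x)=\inf\{r\dot+s:\{h:\phi(hx)<r\}$ not meagre in $J_{<s}\}$, $\phi^{*J}(x)=\sup\{r\dot-s:\{h:\phi(hx)\le r\}$ not comeagre in $J_{<s}\}$. A nice basis with respect to $\mathcal{R}$ of a Polish $G$-space $(\mathbf{X},\tau)$ is a family $\mathcal{B}$ of Borel graded subsets such that: (i) $\mathcal{B}$ is countable and the sets $\phi_{<r}$ ($\phi\in\mathcal{B}$) generate a topology finer than $\tau$; (ii) $\mathcal{B}$ is closed under $1-\phi$, $\min$, $\max$, $|\phi_1-\phi_2|$, $\dot-$, $\dot+$; (iii) closed under dotted multiplication by positive rationals; (iv) $\phi^{*\rho},\phi^{\Delta\rho}\in\mathcal{B}$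 for $\phi\in\mathcal{B}$, $\rho\in\mathcal{R}$; (v) each $\phi\in\mathcal{B}$ is $H$-invariant for some open graded subgroup $H\in\mathcal{R}$. *)

theory Defs
  imports "HOL-Analysis.Analysis" "HOL-Algebra.Group_Action"
begin

section \<open>Truncated arithmetic on the unit interval\<close>

definition dminus :: "real \<Rightarrow> real \<Rightarrow> real"
  where "dminus x y = max (x - y) 0"

definition dplus :: "real \<Rightarrow> real \<Rightarrow> real"
  where "dplus x y = min (x + y) 1"

definition dscale :: "rat \<Rightarrow> real \<Rightarrow> real"
  where "dscale q x = min (of_rat q * x) 1"


section \<open>Polish spaces, Polish groups and Polish G-spaces\<close>

definition polish_topology :: "'a topology \<Rightarrow> bool"
  where "polish_topology X \<longleftrightarrow> completely_metrizable_space X \<and> second_countable X"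

definition polish_group :: "('g, 'm) monoid_scheme \<Rightarrow> 'g topology \<Rightarrow> bool"
  where "polish_group G T \<longleftrightarrow>
     group G \<and> topspace T = carrier G \<and> polish_topology T \<and>
     continuous_map (prod_topology T T) T (\<lambda>(g, h). g \<otimes>\<^bsub>G\<^esub> h) \<and>
     continuous_map T T (\<lambda>g. inv\<^bsub>G\<^esub> g)"

definition polish_gspace ::
  "('g, 'm) monoid_scheme \<Rightarrow> 'g topology \<Rightarrow> 'x topology \<Rightarrow> ('g \<Rightarrow> 'x \<Rightarrow> 'x) \<Rightarrow> bool"
  where "polish_gspace G T X act \<longleftrightarrow>
     polish_group G T \<and> polish_topology X \<and> group_action G (topspace X) act \<and>
     continuous_map (prod_topology T X) X (\<lambda>(g, x). act g x)"

definition nowhere_dense_in :: "'a topology \<Rightarrow> 'a set \<Rightarrow> bool"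
  where "nowhere_dense_in X A \<longleftrightarrow>
     A \<subseteq> topspace X \<and> X interior_of (Abstract_Topology.closure_of X A) = {}"

definition meagre_space :: "'a topology \<Rightarrow> 'a set \<Rightarrow> bool"
  where "meagre_space X A \<longleftrightarrow>
     (\<exists>\<F>. countable \<F> \<and> (\<forall>S\<in>\<F>. nowhere_dense_in X S) \<and> A \<subseteq> \<Union>\<F>)"

text \<open>Meagreness of (the trace of) \<open>A\<close> in the subspace \<open>B\<close>.\<close>

definition meagre_in :: "'a topology \<Rightarrow> 'a set \<Rightarrow> 'a set \<Rightarrow> bool"
  where "meagre_in X B A \<longleftrightarrow> meagre_space (subtopology X B) (A \<inter> B)"

definition comeagre_in :: "'a topology \<Rightarrow> 'a set \<Rightarrow> 'a set \<Rightarrow> bool"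
  where "comeagre_in X B A \<longleftrightarrow> meagre_space (subtopology X B) (B - A)"


section \<open>Graded subsets\<close>

text \<open>Graded subsets of \<open>S\<close> are extensional functions, so that equality of graded subsets
  (and hence membership in a family of them) only depends on their values on \<open>S\<close>.\<close>

definition graded_subsets :: "'a set \<Rightarrow> ('a \<Rightarrow> real) set"
  where "graded_subsets S = (S \<rightarrow>\<^sub>E {0..1})"

definition graded_lt :: "'a set \<Rightarrow> ('a \<Rightarrow> real) \<Rightarrow> real \<Rightarrow> 'a set"
  where "graded_lt S \<phi> r = {x \<in> S. \<phi> x < r}"

definition open_graded :: "'a topology \<Rightarrow> ('a \<Rightarrow> real) \<Rightarrow> bool"
  where "open_graded X \<phi> \<longleftrightarrow>
     \<phi> \<in> graded_subsets (topspace X) \<and> (\<forall>r. openin X (graded_lt (topspace X) \<phi> r))"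

definition borel_graded :: "'a topology \<Rightarrow> ('a \<Rightarrow> real) \<Rightarrow> bool"
  where "borel_graded X \<phi> \<longleftrightarrow>
     \<phi> \<in> graded_subsets (topspace X) \<and>
     \<phi> \<in> borel_measurable (sigma (topspace X) {U. openin X U})"

definition graded_subgroup :: "('g, 'm) monoid_scheme \<Rightarrow> ('g \<Rightarrow> real) \<Rightarrow> bool"
  where "graded_subgroup G H \<longleftrightarrow>
     H \<in> graded_subsets (carrier G) \<and> H \<one>\<^bsub>G\<^esub> = 0 \<and>
     (\<forall>g\<in>carrier G. H (inv\<^bsub>G\<^esub> g) = H g) \<and>
     (\<forall>g\<in>carrier G. \<forall>g'\<in>carrier G. H (g \<otimes>\<^bsub>G\<^esub> g') \<le> H g + H g')"

definition graded_coset :: "('g, 'm) monoid_scheme \<Rightarrow> ('g \<Rightarrow> real) \<Rightarrow> 'g \<Rightarrow> 'g \<Rightarrow> real"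
  where "graded_coset G H g\<^sub>0 = (\<lambda>g\<in>carrier G. H (g \<otimes>\<^bsub>G\<^esub> inv\<^bsub>G\<^esub> g\<^sub>0))"

definition graded_invariant ::
  "('g, 'm) monoid_scheme \<Rightarrow> 'x set \<Rightarrow> ('g \<Rightarrow> 'x \<Rightarrow> 'x) \<Rightarrow> ('g \<Rightarrow> real) \<Rightarrow> ('x \<Rightarrow> real) \<Rightarrow> bool"
  where "graded_invariant G S act H \<phi> \<longleftrightarrow>
     (\<forall>g\<in>carrier G. \<forall>x\<in>S. \<phi> (act g x) \<le> dplus (\<phi> x) (H g))"

text \<open>Infima and suprema are taken in the lattice \<open>[0,1]\<close>; inserting \<open>1\<close> (respectively \<open>0\<close>)
  only matters for the empty set, e.g. for the transforms of a constant graded subset.\<close>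

definition vaught_delta ::
  "'g topology \<Rightarrow> 'x topology \<Rightarrow> ('g \<Rightarrow> 'x \<Rightarrow> 'x) \<Rightarrow> ('g \<Rightarrow> real) \<Rightarrow> ('x \<Rightarrow> real) \<Rightarrow> 'x \<Rightarrow> real"
  where "vaught_delta T X act J \<phi> = (\<lambda>x\<in>topspace X.
     Inf (insert 1 {dplus r s | r s. r \<in> {0..1} \<and> s \<in> {0..1} \<and>
       \<not> meagre_in T (graded_lt (topspace T) J s) {h \<in> topspace T. \<phi> (act h x) < r}}))"

definition vaught_star ::
  "'g topology \<Rightarrow> 'x topology \<Rightarrow> ('g \<Rightarrow> 'x \<Rightarrow> 'x) \<Rightarrow> ('g \<Rightarrow> real) \<Rightarrow> ('x \<Rightarrow> real) \<Rightarrow> 'x \<Rightarrow> real"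
  where "vaught_star T X act J \<phi> = (\<lambda>x\<in>topspace X.
     Sup (insert 0 {dminus r s | r s. r \<in> {0..1} \<and> s \<in> {0..1} \<and>
       \<not> comeagre_in T (graded_lt (topspace T) J s) {h \<in> topspace T. \<phi> (act h x) \<le> r}}))"


section \<open>Nice bases\<close>

text \<open>The first two conjuncts are the presuppositions of the notion: the space is a Polish
  \<open>G\<close>-space, and the Vaught transforms are only formed with respect to open graded subsets.\<close>

definition nice_basis ::
  "('g, 'm) monoid_scheme \<Rightarrow> 'g topology \<Rightarrow> 'x topology \<Rightarrow> ('g \<Rightarrow> 'x \<Rightarrow> 'x) \<Rightarrow>
   ('g \<Rightarrow> real) set \<Rightarrow> ('x \<Rightarrow> real) set \<Rightarrow> bool"
  where "nice_basis G T X act \<R> \<B> \<longleftrightarrow>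
     polish_gspace G T X act \<and> (\<forall>\<rho>\<in>\<R>. open_graded T \<rho>) \<and>
     (\<forall>\<phi>\<in>\<B>. borel_graded X \<phi>) \<and>
     countable \<B> \<and>
     (\<forall>U. openin X U \<longrightarrow>
        openin (topology_generated_by {graded_lt (topspace X) \<phi> r | \<phi> r. \<phi> \<in> \<B>}) U) \<and>
     (\<forall>\<phi>\<in>\<B>. (\<lambda>x\<in>topspace X. 1 - \<phi> x) \<in> \<B>) \<and>
     (\<forall>\<phi>\<in>\<B>. \<forall>\<psi>\<in>\<B>.
        (\<lambda>x\<in>topspace X. min (\<phi> x) (\<psi> x)) \<in> \<B> \<and>
        (\<lambda>x\<in>topspace X. max (\<phi> x) (\<psi> x)) \<in> \<B> \<and>
        (\<lambda>x\<in>topspace X. \<bar>\<phi> x - \<psi> x\<bar>) \<in> \<B> \<and>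
        (\<lambda>x\<in>topspace X. dminus (\<phi> x) (\<psi> x)) \<in> \<B> \<and>
        (\<lambda>x\<in>topspace X. dplus (\<phi> x) (\<psi> x)) \<in> \<B>) \<and>
     (\<forall>\<phi>\<in>\<B>. \<forall>q>0. (\<lambda>x\<in>topspace X. dscale q (\<phi> x)) \<in> \<B>) \<and>
     (\<forall>\<phi>\<in>\<B>. \<forall>\<rho>\<in>\<R>. vaught_star T X act \<rho> \<phi> \<in> \<B> \<and> vaught_delta T X act \<rho> \<phi> \<in> \<B>) \<and>
     (\<forall>\<phi>\<in>\<B>. \<exists>H\<in>\<R>. open_graded T H \<and> graded_subgroup G H \<and>
        graded_invariant G (topspace X) act H \<phi>)"


section \<open>The Urysohn space of diameter 1 and its rational counterpart\<close>

definition isometric_on :: "'a::metric_space set \<Rightarrow> ('a \<Rightarrow> 'a) \<Rightarrow> bool"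
  where "isometric_on S f \<longleftrightarrow> (\<forall>x\<in>S. \<forall>y\<in>S. dist (f x) (f y) = dist x y)"

definition isom_group :: "('u::metric_space \<Rightarrow> 'u) monoid"
  where "isom_group =
     \<lparr>carrier = {g. bij g \<and> isometric_on UNIV g}, monoid.mult = (\<circ>), one = id\<rparr>"

text \<open>The topology of the function type is the product topology, so this is the topology of
  pointwise convergence.\<close>

definition isom_topology :: "('u::metric_space \<Rightarrow> 'u) topology"
  where "isom_topology = top_of_set (carrier isom_group)"

text \<open>A Polish metric space has at most continuum many points, hence is isometric to one whose
  carrier is a set of reals; so quantifying over metrics on subsets of \<^typ>\<open>real\<close> expresses
  universality for all Polish metric spaces of diameter at most \<open>1\<close>. In the same way
  metrics on subsets of \<^typ>\<open>nat\<close> represent all countable metric spaces.\<close>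

definition urysohn_space :: "'u::polish_space itself \<Rightarrow> bool"
  where "urysohn_space _ \<longleftrightarrow>
     (\<forall>x y :: 'u. dist x y \<le> 1) \<and>
     (\<forall>m :: real metric.
        mcomplete_of m \<and> separable_space (mtopology_of m) \<and>
        (\<forall>x\<in>mspace m. \<forall>y\<in>mspace m. mdist m x y \<le> 1) \<longrightarrow>
        (\<exists>f :: real \<Rightarrow> 'u. \<forall>x\<in>mspace m. \<forall>y\<in>mspace m. dist (f x) (f y) = mdist m x y)) \<and>
     (\<forall>A (f :: 'u \<Rightarrow> 'u). finite A \<and> isometric_on A f \<longrightarrow>
        (\<exists>g\<in>carrier isom_group. \<forall>x\<in>A. g x = f x))"

definition rational_urysohn_space :: "'u::metric_space set \<Rightarrow> bool"
  where "rational_urysohn_space Q \<longleftrightarrow>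
     countable Q \<and>
     (\<forall>x\<in>Q. \<forall>y\<in>Q. dist x y \<in> \<rat> \<and> dist x y \<le> 1) \<and>
     (\<forall>m :: nat metric.
        (\<forall>x\<in>mspace m. \<forall>y\<in>mspace m. mdist m x y \<in> \<rat> \<and> mdist m x y \<le> 1) \<longrightarrow>
        (\<exists>f. f ` mspace m \<subseteq> Q \<and>
          (\<forall>x\<in>mspace m. \<forall>y\<in>mspace m. dist (f x) (f y) = mdist m x y))) \<and>
     (\<forall>A f. finite A \<and> A \<subseteq> Q \<and> f ` A \<subseteq> Q \<and> isometric_on A f \<longrightarrow>
        (\<exists>g. bij_betw g Q Q \<and> isometric_on Q g \<and> (\<forall>x\<in>A. g x = f x)))"

text \<open>For dense \<open>Q\<close> an isometry of \<open>Q\<close> has at most one extension to an isometry of the whole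
  space; this set is the image of \<open>Iso(Q)\<close> under the extension map.\<close>

definition isom_preserving :: "'u::metric_space set \<Rightarrow> ('u \<Rightarrow> 'u) set"
  where "isom_preserving Q = {g \<in> carrier isom_group. g ` Q = Q}"

definition well_embedded :: "'u::metric_space set \<Rightarrow> bool"
  where "well_embedded Q \<longleftrightarrow>
     closure Q = UNIV \<and>
     (\<forall>g. bij_betw g Q Q \<and> isometric_on Q g \<longrightarrow>
        (\<exists>h\<in>carrier isom_group. \<forall>x\<in>Q. h x = g x)) \<and>
     Abstract_Topology.closure_of isom_topology (isom_preserving Q) = carrier isom_group"

definition dense_countable_subgroup :: "'u::metric_space set \<Rightarrow> ('u \<Rightarrow> 'u) set \<Rightarrow> bool"
  where "dense_countable_subgroup Q G\<^sub>0 \<longleftrightarrow>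
     subgroup G\<^sub>0 isom_group \<and> countable G\<^sub>0 \<and> G\<^sub>0 \<subseteq> isom_preserving Q \<and>
     Abstract_Topology.closure_of (subtopology isom_topology (isom_preserving Q)) G\<^sub>0
       = isom_preserving Q"


section \<open>The family of graded cosets\<close>

text \<open>For tuples of equal length: the maximum of the coordinatewise distances, \<open>0\<close> for empty
  tuples.\<close>

definition tuple_dist :: "'u::metric_space list \<Rightarrow> 'u list \<Rightarrow> real"
  where "tuple_dist xs ys = Max (insert 0 (set (map2 dist xs ys)))"

definition basic_graded_subgroup :: "rat \<Rightarrow> 'u::metric_space list \<Rightarrow> ('u \<Rightarrow> 'u) \<Rightarrow> real"
  where "basic_graded_subgroup q s =
     (\<lambda>g\<in>carrier isom_group. min (of_rat q * tuple_dist (map g s) s) 1)"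

definition basic_graded_subgroups :: "'u::metric_space set \<Rightarrow> (('u \<Rightarrow> 'u) \<Rightarrow> real) set"
  where "basic_graded_subgroups Q = {basic_graded_subgroup q s | q s. q > 0 \<and> set s \<subseteq> Q}"

definition max_graded_subgroups :: "'u::metric_space set \<Rightarrow> (('u \<Rightarrow> 'u) \<Rightarrow> real) set"
  where "max_graded_subgroups Q =
     {(\<lambda>g\<in>carrier isom_group. Max ((\<lambda>H. H g) ` F)) | F.
        finite F \<and> F \<noteq> {} \<and> F \<subseteq> basic_graded_subgroups Q}"

definition urysohn_graded_cosets ::
  "'u::metric_space set \<Rightarrow> ('u \<Rightarrow> 'u) set \<Rightarrow> (('u \<Rightarrow> 'u) \<Rightarrow> real) set"
  where "urysohn_graded_cosets Q G\<^sub>0 =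
     {graded_coset isom_group H g\<^sub>0 | H g\<^sub>0. H \<in> max_graded_subgroups Q \<and> g\<^sub>0 \<in> G\<^sub>0}"


section \<open>Continuous signatures and formulas\<close>

record 'r signature =
  symbols :: "'r set"
  arity :: "'r \<Rightarrow> nat"
  modulus :: "'r \<Rightarrow> real \<Rightarrow> real"

definition continuity_modulus :: "(real \<Rightarrow> real) \<Rightarrow> bool"
  where "continuity_modulus \<delta> \<longleftrightarrow>
     \<delta> \<in> {0..1} \<rightarrow> {0..1} \<and> continuous_on {0..1} \<delta> \<and> mono_on {0..1} \<delta> \<and> \<delta> 0 = 0"

definition continuous_signature :: "'r signature \<Rightarrow> bool"
  where "continuous_signature L \<longleftrightarrow> (\<forall>R\<in>symbols L. continuity_modulus (modulus L R))"

datatype 'r cformula =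
    FDist nat nat
  | FRel 'r "nat list"
  | FZero
  | FOne
  | FHalf "'r cformula"
  | FMinus "'r cformula" "'r cformula"
  | FMin "'r cformula" "'r cformula"
  | FMax "'r cformula" "'r cformula"
  | FAbsDiff "'r cformula" "'r cformula"
  | FCompl "'r cformula"
  | FPlus "'r cformula" "'r cformula"
  | FScale rat "'r cformula"
  | FSup nat "'r cformula"
  | FInf nat "'r cformula"

primrec is_formula :: "'r signature \<Rightarrow> 'r cformula \<Rightarrow> bool" where
  "is_formula L (FDist x y) \<longleftrightarrow> True"
| "is_formula L (FRel R xs) \<longleftrightarrow> R \<in> symbols L \<and> length xs = arity L R"
| "is_formula L FZero \<longleftrightarrow> True"
| "is_formula L FOne \<longleftrightarrow> True"
| "is_formula L (FHalf \<phi>) \<longleftrightarrow> is_formula L \<phi>"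
| "is_formula L (FMinus \<phi> \<psi>) \<longleftrightarrow> is_formula L \<phi> \<and> is_formula L \<psi>"
| "is_formula L (FMin \<phi> \<psi>) \<longleftrightarrow> is_formula L \<phi> \<and> is_formula L \<psi>"
| "is_formula L (FMax \<phi> \<psi>) \<longleftrightarrow> is_formula L \<phi> \<and> is_formula L \<psi>"
| "is_formula L (FAbsDiff \<phi> \<psi>) \<longleftrightarrow> is_formula L \<phi> \<and> is_formula L \<psi>"
| "is_formula L (FCompl \<phi>) \<longleftrightarrow> is_formula L \<phi>"
| "is_formula L (FPlus \<phi> \<psi>) \<longleftrightarrow> is_formula L \<phi> \<and> is_formula L \<psi>"
| "is_formula L (FScale q \<phi>) \<longleftrightarrow> q > 0 \<and> is_formula L \<phi>"
| "is_formula L (FSup x \<phi>) \<longleftrightarrow> is_formula L \<phi>"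
| "is_formula L (FInf x \<phi>) \<longleftrightarrow> is_formula L \<phi>"

primrec free_vars :: "'r cformula \<Rightarrow> nat set" where
  "free_vars (FDist x y) = {x, y}"
| "free_vars (FRel R xs) = set xs"
| "free_vars FZero = {}"
| "free_vars FOne = {}"
| "free_vars (FHalf \<phi>) = free_vars \<phi>"
| "free_vars (FMinus \<phi> \<psi>) = free_vars \<phi> \<union> free_vars \<psi>"
| "free_vars (FMin \<phi> \<psi>) = free_vars \<phi> \<union> free_vars \<psi>"
| "free_vars (FMax \<phi> \<psi>) = free_vars \<phi> \<union> free_vars \<psi>"
| "free_vars (FAbsDiff \<phi> \<psi>) = free_vars \<phi> \<union> free_vars \<psi>"
| "free_vars (FCompl \<phi>) = free_vars \<phi>"
| "free_vars (FPlus \<phi> \<psi>) = free_vars \<phi> \<union> free_vars \<psi>"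
| "free_vars (FScale q \<phi>) = free_vars \<phi>"
| "free_vars (FSup x \<phi>) = free_vars \<phi> - {x}"
| "free_vars (FInf x \<phi>) = free_vars \<phi> - {x}"

type_synonym ('r, 'u) structure_on = "'r \<Rightarrow> 'u list \<Rightarrow> real"

primrec formula_value ::
  "('r, 'u::metric_space) structure_on \<Rightarrow> (nat \<Rightarrow> 'u) \<Rightarrow> 'r cformula \<Rightarrow> real" where
  "formula_value M v (FDist x y) = dist (v x) (v y)"
| "formula_value M v (FRel R xs) = M R (map v xs)"
| "formula_value M v FZero = 0"
| "formula_value M v FOne = 1"
| "formula_value M v (FHalf \<phi>) = formula_value M v \<phi> / 2"
| "formula_value M v (FMinus \<phi> \<psi>) = dminus (formula_value M v \<phi>) (formula_value M v \<psi>)"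
| "formula_value M v (FMin \<phi> \<psi>) = min (formula_value M v \<phi>) (formula_value M v \<psi>)"
| "formula_value M v (FMax \<phi> \<psi>) = max (formula_value M v \<phi>) (formula_value M v \<psi>)"
| "formula_value M v (FAbsDiff \<phi> \<psi>) = \<bar>formula_value M v \<phi> - formula_value M v \<psi>\<bar>"
| "formula_value M v (FCompl \<phi>) = 1 - formula_value M v \<phi>"
| "formula_value M v (FPlus \<phi> \<psi>) = dplus (formula_value M v \<phi>) (formula_value M v \<psi>)"
| "formula_value M v (FScale q \<phi>) = dscale q (formula_value M v \<phi>)"
| "formula_value M v (FSup x \<phi>) = (SUP a. formula_value M (v(x := a)) \<phi>)"
| "formula_value M v (FInf x \<phi>) = (INF a. formula_value M (v(x := a)) \<phi>)"


section \<open>The space of metric structures\<close>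

text \<open>Interpretations are normalised to \<open>0\<close> outside the signature and on tuples of the wrong
  length, so that distinct elements are distinct structures.\<close>

definition structures :: "'r signature \<Rightarrow> ('r, 'u::metric_space) structure_on set"
  where "structures L = {M.
     (\<forall>R s. R \<in> symbols L \<and> length s = arity L R \<longrightarrow> M R s \<in> {0..1}) \<and>
     (\<forall>R s t. R \<in> symbols L \<and> length s = arity L R \<and> length t = arity L R \<longrightarrow>
        \<bar>M R s - M R t\<bar> \<le> modulus L R (tuple_dist s t)) \<and>
     (\<forall>R s. \<not> (R \<in> symbols L \<and> length s = arity L R) \<longrightarrow> M R s = 0)}"

definition index_pairs :: "'r signature \<Rightarrow> 'u set \<Rightarrow> ('r \<times> 'u list) set"
  where "index_pairs L Q = {(R, s). R \<in> symbols L \<and> length s = arity L R \<and> set s \<subseteq> Q}"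

text \<open>\<open>\<nu>\<close> assigns to each pair its position in the enumeration; the set of pairs may be finite
  or even empty.\<close>

definition structure_dist ::
  "'r signature \<Rightarrow> 'u set \<Rightarrow> ('r \<times> 'u list \<Rightarrow> nat) \<Rightarrow>
   ('r, 'u) structure_on \<Rightarrow> ('r, 'u) structure_on \<Rightarrow> real"
  where "structure_dist L Q \<nu> M N =
     (\<Sum>\<^sub>\<infinity>(R, s)\<in>index_pairs L Q. (1/2) ^ \<nu> (R, s) * \<bar>M R s - N R s\<bar>)"

definition structure_topology ::
  "'r signature \<Rightarrow> 'u::metric_space set \<Rightarrow> ('r \<times> 'u list \<Rightarrow> nat) \<Rightarrow>
   ('r, 'u) structure_on topology"
  where "structure_topology L Q \<nu> =
     Metric_space.mtopology (structures L) (structure_dist L Q \<nu>)"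

definition transport ::
  "'r signature \<Rightarrow> ('u::metric_space \<Rightarrow> 'u) \<Rightarrow>
   ('r, 'u) structure_on \<Rightarrow> ('r, 'u) structure_on"
  where "transport L g = (\<lambda>M\<in>structures L. \<lambda>R s. M R (map (inv\<^bsub>isom_group\<^esub> g) s))"

text \<open>A sentence \<open>\<phi>(s)\<close> with parameters is a formula \<open>\<phi>\<close> together with an assignment of elements
  of \<open>Q\<close> to its free variables.\<close>

definition sentence_graded_subsets ::
  "'r signature \<Rightarrow> 'u::metric_space set \<Rightarrow> (('r, 'u) structure_on \<Rightarrow> real) set"
  where "sentence_graded_subsets L Q =
     {(\<lambda>M\<in>structures L. formula_value M v \<phi>) | \<phi> v.
        is_formula L \<phi> \<and> v ` free_vars \<phi> \<subseteq> Q}"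

end

theory Submission
  imports Defs
begin

text \<open>Since every symbol is \<open>n\<close>-Lipschitz, every formula is Lipschitz in its parameters. Hence
  \<open>h \<mapsto> \<phi>(h\<^sup>-\<^sup>1 s)\<close> is continuous, and by the Baire category theorem the transform \<open>\<phi>\<^sup>\<Delta>\<^sup>\<rho>\<close> is the
  infimum over all isometries \<open>k = h\<^sup>-\<^sup>1\<close> of \<open>\<phi>(k s)\<close> plus the value of \<open>\<rho>\<close>, which is a maximum of scaled distances
  between \<open>k a\<close> and points of \<open>QU\<close>. By ultrahomogeneity this is an infimum over all isometric copies
  of a finite tuple of parameters. It is a formula, because a tuple whose distances deviate by at most
  \<open>\<epsilon>\<close> from those of the parameters lies within \<open>\<epsilon>\<close> of such a copy, so that the restriction to copies
  can be replaced by a penalty proportional to the deviation. The star transform is dual.\<close>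

section \<open>The isometry group\<close>

text \<open>The obstacle is that formulas quantify over all points of the space, while the transform
  ranges over a group: that a tuple is an isometric copy of another can enter a formula only through
  a numerical value. The bound n * id on the moduli resolves this. It makes every formula Lipschitz
  with a constant uniform in the structure, so that a linear penalty is exact, and a rational
  multiple of a distortion is again a formula. Exactness matters, because the family must contain
  the transform itself and not only approximations of it. With h = k^-1, a condition from the coset
  of \<open>g\<^sub>0\<close> reads d(h g_0^-1 a, a) = d(g_0^-1 a, k a). The point a moves together
  with the parameters of the formula, while g_0^-1 a stays fixed and has to be a legitimate
  parameter; it is one because the elements of \<open>G\<^sub>0\<close> map QU onto itself.\<close>

lemma tendsto_fun_iff:
  fixes f :: "'a \<Rightarrow> 'i \<Rightarrow> 'b::topological_space"
  shows "(f \<longlongrightarrow> l) F \<longleftrightarrow> (\<forall>i. ((\<lambda>a. f a i) \<longlongrightarrow> l i) F)"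
  using limitin_componentwise[of "\<lambda>_. euclidean" UNIV f l F]
  by (simp add: euclidean_product_topology)

lemma second_countable_euclidean:
  "second_countable (euclidean :: 'a::second_countable_topology topology)"
proof -
  obtain B :: "'a set set" where B: "countable B" "topological_basis B"
    using ex_countable_basis by blast
  show ?thesis
    unfolding second_countable_def
  proof (intro exI conjI ballI allI impI)
    show "countable B" by fact
    show "openin euclidean V" if "V \<in> B" for V
      using that B(2) topological_basis_open by auto
    show "\<exists>V\<in>B. x \<in> V \<and> V \<subseteq> U" if "openin euclidean U \<and> x \<in> U" for U and x :: 'a
      using that topological_basisE[OF B(2), of U x] by (metis open_openin)
  qed
qed

lemma dense_closed_UNIV:
  assumes "closure D = UNIV" "closed S" "D \<subseteq> S"
  shows "x \<in> S"
  using closure_minimal[OF assms(3,2)] assms(1) by auto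

lemma dense_approx:
  fixes D :: "'a::metric_space set"
  assumes "closure D = UNIV" "e > 0"
  obtains y where "y \<in> D" "dist x y < e"
  using assms closure_approachable[of x D] by (metis UNIV_I dist_commute)

section \<open>Algebra of the isometry group\<close>

lemma mem_isom_group:
  "g \<in> carrier isom_group \<longleftrightarrow> bij g \<and> (\<forall>x y. dist (g x) (g y) = dist x y)"
  by (simp add: isom_group_def isometric_on_def)

lemma isom_group_mult [simp]: "g \<otimes>\<^bsub>isom_group\<^esub> h = g \<circ> h"
  and isom_group_one [simp]: "\<one>\<^bsub>isom_group\<^esub> = id"
  by (simp_all add: isom_group_def)

lemma isom_dist: "g \<in> carrier isom_group \<Longrightarrow> dist (g x) (g y) = dist x y"
  by (simp add: mem_isom_group)

lemma id_isom: "id \<in> carrier isom_group"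
  by (simp add: mem_isom_group)

lemma comp_isom: "g \<in> carrier isom_group \<Longrightarrow> h \<in> carrier isom_group \<Longrightarrow> g \<circ> h \<in> carrier isom_group"
  by (simp add: mem_isom_group bij_comp)

lemma inv_into_isom:
  assumes "g \<in> carrier isom_group"
  shows "inv_into UNIV g \<in> carrier isom_group"
  using assms unfolding mem_isom_group
  by (metis bij_imp_bij_inv bij_is_surj surj_f_inv_f)

lemma group_isom_group: "group isom_group"
proof (rule groupI)
  fix g :: "'a \<Rightarrow> 'a" assume g: "g \<in> carrier isom_group"
  show "\<exists>y\<in>carrier isom_group. y \<otimes>\<^bsub>isom_group\<^esub> g = \<one>\<^bsub>isom_group\<^esub>"
    using g by (intro bexI[OF _ inv_into_isom[OF g]]) (simp add: mem_isom_group bij_is_inj)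
qed (auto simp: id_isom comp_isom o_assoc)

lemma inv_isom_eq:
  assumes "g \<in> carrier isom_group"
  shows "inv\<^bsub>isom_group\<^esub> g = inv_into UNIV g"
  by (rule group.inv_equality[OF group_isom_group])
     (use assms inv_into_isom[OF assms] in \<open>auto simp: mem_isom_group bij_is_inj\<close>)

lemma inv_isom:
  "g \<in> carrier isom_group \<Longrightarrow> inv\<^bsub>isom_group\<^esub> g \<in> carrier isom_group"
  by (simp add: inv_isom_eq inv_into_isom)

lemma isom_apply_inv [simp]: "g \<in> carrier isom_group \<Longrightarrow> g ((inv\<^bsub>isom_group\<^esub> g) x) = x"
  by (simp add: inv_isom_eq mem_isom_group bij_is_surj surj_f_inv_f)

lemma isom_inv_apply [simp]: "g \<in> carrier isom_group \<Longrightarrow> (inv\<^bsub>isom_group\<^esub> g) (g x) = x"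
  by (simp add: inv_isom_eq mem_isom_group bij_is_inj)

lemma inv_isom_id [simp]: "inv\<^bsub>isom_group\<^esub> id = id"
  using monoid.inv_one[OF group.is_monoid[OF group_isom_group]] by simp

lemma isom_inv_inv [simp]:
  "g \<in> carrier isom_group \<Longrightarrow> inv\<^bsub>isom_group\<^esub> (inv\<^bsub>isom_group\<^esub> g) = g"
  by (simp add: group.inv_inv[OF group_isom_group])

lemma dist_inv_isom:
  assumes "g \<in> carrier isom_group"
  shows "dist ((inv\<^bsub>isom_group\<^esub> g) x) y = dist x (g y)"
  using isom_dist[OF assms, of "(inv\<^bsub>isom_group\<^esub> g) x" y] assms by simp

section \<open>Convergence in the isometry group\<close>

lemma topspace_isom_topology [simp]: "topspace isom_topology = carrier isom_group"
  by (simp add: isom_topology_def)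

text \<open>Turns continuity statements about the group into estimates on distances along an
  arbitrary filter.\<close>

lemma limitin_isom_topology:
  "limitin isom_topology f l F \<longleftrightarrow>
     l \<in> carrier isom_group \<and> (\<forall>\<^sub>F a in F. f a \<in> carrier isom_group) \<and>
     (\<forall>x. ((\<lambda>a. f a x) \<longlongrightarrow> l x) F)"
  by (auto simp: isom_topology_def limitin_subtopology tendsto_fun_iff)

text \<open>Isometries are equicontinuous: \<open>x\<close> can be exchanged for a nearby point of
  \<open>D\<close> at the same cost under \<open>f a\<close> and under \<open>l\<close>. For this
  \<open>l\<close> must be known to be an isometry beforehand.\<close>

lemma limitin_isom_topology_dense:
  fixes f :: "'a \<Rightarrow> 'u::metric_space \<Rightarrow> 'u"
  assumes l: "l \<in> carrier isom_group" and f: "\<forall>\<^sub>F a in F. f a \<in> carrier isom_group"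
    and D: "closure D = UNIV" and lim: "\<And>x. x \<in> D \<Longrightarrow> ((\<lambda>a. f a x) \<longlongrightarrow> l x) F"
  shows "limitin isom_topology f l F"
  unfolding limitin_isom_topology
proof (intro conjI allI l f)
  fix x
  show "((\<lambda>a. f a x) \<longlongrightarrow> l x) F"
  proof (rule tendstoI)
    fix e :: real assume "e > 0"
    then obtain y where y: "y \<in> D" "dist x y < e / 3"
      using dense_approx[OF D, of "e / 3" x] by auto
    have "\<forall>\<^sub>F a in F. dist (f a y) (l y) < e / 3"
      using \<open>e > 0\<close> by (intro tendstoD[OF lim[OF y(1)]]) simp
    with f show "\<forall>\<^sub>F a in F. dist (f a x) (l x) < e"
    proof eventually_elim
      case (elim a)
      have "dist (f a x) (l x) \<le> dist (f a x) (f a y) + dist (f a y) (l y) + dist (l y) (l x)"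
        by metric
      with elim y show ?case
        by (simp add: isom_dist l dist_commute)
    qed
  qed
qed

text \<open>Since \<open>f a\<close> preserves distances, replacing \<open>f' a x\<close> by
  \<open>l' x\<close> under it costs exactly their distance; what remains is the convergence of
  \<open>f\<close> at the single point \<open>l' x\<close>.\<close>

lemma limitin_isom_comp:
  assumes "limitin isom_topology f l F" "limitin isom_topology f' l' F"
  shows "limitin isom_topology (\<lambda>a. f a \<circ> f' a) (l \<circ> l') F"
  unfolding limitin_isom_topology
proof (intro conjI allI)
  have l: "l \<in> carrier isom_group" "l' \<in> carrier isom_group"
    and f: "\<forall>\<^sub>F a in F. f a \<in> carrier isom_group" "\<forall>\<^sub>F a in F. f' a \<in> carrier isom_group"
    and lim: "\<And>x. ((\<lambda>a. f a x) \<longlongrightarrow> l x) F" "\<And>x. ((\<lambda>a. f' a x) \<longlongrightarrow> l' x) F"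
    using assms by (auto simp: limitin_isom_topology)
  show "l \<circ> l' \<in> carrier isom_group"
    using l by (rule comp_isom)
  show "\<forall>\<^sub>F a in F. f a \<circ> f' a \<in> carrier isom_group"
    using f by eventually_elim (rule comp_isom)
  fix x
  show "((\<lambda>a. (f a \<circ> f' a) x) \<longlongrightarrow> (l \<circ> l') x) F"
  proof (rule tendstoI)
    fix e :: real assume "e > 0"
    then have "\<forall>\<^sub>F a in F. dist (f' a x) (l' x) < e / 2"
      and "\<forall>\<^sub>F a in F. dist (f a (l' x)) (l (l' x)) < e / 2"
      by (intro tendstoD[OF lim(2)] tendstoD[OF lim(1)]; simp)+
    with f show "\<forall>\<^sub>F a in F. dist ((f a \<circ> f' a) x) ((l \<circ> l') x) < e"
    proof eventually_elim
      case (elim a)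
      have "dist (f a (f' a x)) (l (l' x))
          \<le> dist (f a (f' a x)) (f a (l' x)) + dist (f a (l' x)) (l (l' x))"
        by (rule dist_triangle)
      with elim show ?case
        by (simp add: isom_dist)
    qed
  qed
qed

text \<open>Applying \<open>f a\<close> turns the distance of the two inverses at \<open>x\<close>
  into the distance of \<open>f a\<close> and \<open>l\<close> at the fixed point y = l^-1 x,
  because x = l y.\<close>

lemma limitin_isom_inv:
  assumes "limitin isom_topology f l F"
  shows "limitin isom_topology (\<lambda>a. inv\<^bsub>isom_group\<^esub> (f a)) (inv\<^bsub>isom_group\<^esub> l) F"
  unfolding limitin_isom_topology
proof (intro conjI allI)
  have l: "l \<in> carrier isom_group" and f: "\<forall>\<^sub>F a in F. f a \<in> carrier isom_group"
    and lim: "\<And>x. ((\<lambda>a. f a x) \<longlongrightarrow> l x) F"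
    using assms by (auto simp: limitin_isom_topology)
  show "inv\<^bsub>isom_group\<^esub> l \<in> carrier isom_group"
    using l by (rule inv_isom)
  show "\<forall>\<^sub>F a in F. inv\<^bsub>isom_group\<^esub> (f a) \<in> carrier isom_group"
    using f by eventually_elim (rule inv_isom)
  fix x
  show "((\<lambda>a. (inv\<^bsub>isom_group\<^esub> (f a)) x) \<longlongrightarrow> (inv\<^bsub>isom_group\<^esub> l) x) F"
  proof (rule tendstoI)
    fix e :: real assume "e > 0"
    then have "\<forall>\<^sub>F a in F. dist (f a ((inv\<^bsub>isom_group\<^esub> l) x)) (l ((inv\<^bsub>isom_group\<^esub> l) x)) < e"
      by (rule tendstoD[OF lim])
    with f show "\<forall>\<^sub>F a in F. dist ((inv\<^bsub>isom_group\<^esub> (f a)) x) ((inv\<^bsub>isom_group\<^esub> l) x) < e"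
    proof eventually_elim
      case (elim a)
      then show ?case
        using l dist_inv_isom[of "f a" x "(inv\<^bsub>isom_group\<^esub> l) x"] by (simp add: dist_commute)
    qed
  qed
qed

section \<open>Polishness of the isometry group\<close>

lemma isometric_extension:
  fixes q a :: "nat \<Rightarrow> 'u::polish_space"
  assumes q: "closure (range q) = UNIV" and a: "\<And>m n. dist (a m) (a n) = dist (q m) (q n)"
  obtains g where "\<And>x y. dist (g x) (g y) = dist x y" "\<And>n. g (q n) = a n"
proof -
  \<comment> \<open>The sequence \<open>q\<close> may repeat values; equal distances force
    \<open>a\<close> to repeat with it, so every choice of index gives the same value.\<close>
  define h where "h x = a (SOME n. q n = x)" for x
  have h: "h (q n) = a n" for n
  proof -
    have "q (SOME k. q k = q n) = q n"
      by (rule someI) (rule refl)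
    then show ?thesis
      using a[of "SOME k. q k = q n" n] by (simp add: h_def)
  qed
  \<comment> \<open>Completeness of the target extends \<open>h\<close> to the closure. The distance
    identity is then transferred by density, one variable at a time.\<close>
  have "uniformly_continuous_on (range q) h"
    unfolding uniformly_continuous_on_def using a h by auto
  then obtain g where g: "uniformly_continuous_on (closure (range q)) g"
      "\<And>x. x \<in> range q \<Longrightarrow> h x = g x"
    using uniformly_continuous_on_extension_on_closure[of "range q" h] by metis
  have cont: "continuous_on UNIV g"
    using uniformly_continuous_imp_continuous[OF g(1)] q by simp
  have gq: "g (q n) = a n" for n
    using g(2)[of "q n"] h by simp
  have 1: "dist (g x) (g (q n)) = dist x (q n)" for x n
  proof -
    have "x \<in> {x. dist (g x) (g (q n)) = dist x (q n)}"
    proof (rule dense_closed_UNIV[OF q])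
      show "closed {x. dist (g x) (g (q n)) = dist x (q n)}"
        using cont by (intro closed_Collect_eq continuous_intros)
    qed (auto simp: gq a)
    then show ?thesis by simp
  qed
  have "dist (g x) (g y) = dist x y" for x y
  proof -
    have "y \<in> {y. dist (g x) (g y) = dist x y}"
    proof (rule dense_closed_UNIV[OF q])
      show "closed {y. dist (g x) (g y) = dist x y}"
        using cont by (intro closed_Collect_eq continuous_intros)
    qed (auto simp: 1)
    then show ?thesis by simp
  qed
  with gq show thesis using that by blast
qed

text \<open>Recording an isometry together with its inverse makes the image closed, since surjectivity
  of a limit of isometries is not automatic: the mixed equations \<open>dist (c (Inl m)) (q n) = dist (q m) (c (Inr n))\<close>
  force the two limits to be inverse to each other.\<close>

lemma isom_topology_homeomorphic_closed:
  obtains C :: "(nat + nat \<Rightarrow> 'u::polish_space) set"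
  where "closed C" "(isom_topology :: ('u \<Rightarrow> 'u) topology) homeomorphic_space top_of_set C"
proof -
  obtain D :: "'u set" where D: "countable D" and "\<And>U. open U \<Longrightarrow> U \<noteq> {} \<Longrightarrow> \<exists>d\<in>D. d \<in> U"
    using countable_dense_exists[where 'a='u] by blast
  from this(2)[of "- closure D"] have "closure D = UNIV"
    using closure_subset[of D] by auto
  define q where "q = from_nat_into D"
  have "D \<noteq> {}" using \<open>closure D = UNIV\<close> by auto
  then have q: "closure (range q) = UNIV"
    using D \<open>closure D = UNIV\<close> by (simp add: q_def)
  define \<Phi> :: "('u \<Rightarrow> 'u) \<Rightarrow> nat + nat \<Rightarrow> 'u"
    where "\<Phi> g = case_sum (\<lambda>n. g (q n)) (\<lambda>n. (inv\<^bsub>isom_group\<^esub> g) (q n))" for g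
  define C where "C = {c. (\<forall>m n. dist (c (Inl m)) (c (Inl n)) = dist (q m) (q n)) \<and>
    (\<forall>m n. dist (c (Inr m)) (c (Inr n)) = dist (q m) (q n)) \<and>
    (\<forall>m n. dist (c (Inl m)) (q n) = dist (q m) (c (Inr n)))}"
  have coord: "continuous_on UNIV (\<lambda>c :: nat + nat \<Rightarrow> 'u. c i)" for i
    by (rule continuous_on_product_coordinates)
  have "closed C"
    unfolding C_def
    by (intro closed_Collect_conj closed_Collect_all closed_Collect_eq continuous_on_dist
        continuous_on_const coord)
  have \<Phi>C: "\<Phi> g \<in> C" if "g \<in> carrier isom_group" for g
    using isom_dist[OF that] isom_dist[OF inv_isom[OF that]]
      dist_inv_isom[OF inv_isom[OF that]] that
    by (simp add: C_def \<Phi>_def)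
  have inj: "inj_on \<Phi> (carrier isom_group)"
  proof (rule inj_onI)
    fix g h assume gh: "g \<in> carrier isom_group" "h \<in> carrier isom_group" "\<Phi> g = \<Phi> h"
    have "continuous_on UNIV f" if "f \<in> carrier isom_group" for f :: "'u \<Rightarrow> 'u"
      using that by (auto simp: continuous_on_iff isom_dist)
    then have cl: "closed {x. g x = h x}"
      using gh by (intro closed_Collect_eq)
    have "g (q n) = h (q n)" for n
      using fun_cong[OF gh(3), of "Inl n"] by (simp add: \<Phi>_def)
    then show "g = h"
      using dense_closed_UNIV[OF q cl] by auto
  qed
  have surj: "C \<subseteq> \<Phi> ` carrier isom_group"
  proof
    fix c assume c: "c \<in> C"
    obtain g where g: "\<And>x y. dist (g x) (g y) = dist x y" "\<And>n. g (q n) = c (Inl n)"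
      using isometric_extension[OF q, of "\<lambda>n. c (Inl n)"] c by (auto simp: C_def)
    obtain h where h: "\<And>x y. dist (h x) (h y) = dist x y" "\<And>n. h (q n) = c (Inr n)"
      using isometric_extension[OF q, of "\<lambda>n. c (Inr n)"] c by (auto simp: C_def)
    have gc: "continuous_on UNIV g" and hc: "continuous_on UNIV h"
      by (auto simp: continuous_on_iff g h)
    have 1: "dist (g x) (q n) = dist x (h (q n))" for x n
    proof -
      have "x \<in> {x. dist (g x) (q n) = dist x (h (q n))}"
      proof (rule dense_closed_UNIV[OF q])
        show "closed {x. dist (g x) (q n) = dist x (h (q n))}"
          using gc by (intro closed_Collect_eq continuous_intros)
      qed (use c in \<open>auto simp: C_def g h\<close>)
      then show ?thesis by simp
    qed
    \<comment> \<open>Putting \<open>x = h y\<close> or \<open>y = g x\<close> makes one side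
      vanish, so this identity says that \<open>g\<close> and \<open>h\<close> are inverse to each
      other.\<close>
    have 2: "dist (g x) y = dist x (h y)" for x y
    proof -
      have "y \<in> {y. dist (g x) y = dist x (h y)}"
      proof (rule dense_closed_UNIV[OF q])
        show "closed {y. dist (g x) y = dist x (h y)}"
          using hc by (intro closed_Collect_eq continuous_intros)
      qed (auto simp: 1)
      then show ?thesis by simp
    qed
    have gh: "g (h y) = y" for y
      using 2[of "h y" y] by simp
    have hg: "h (g x) = x" for x
      using 2[of x "g x"] by simp
    have gI: "g \<in> carrier isom_group"
      unfolding mem_isom_group using g(1) gh hg by (metis bij_iff)
    have "(inv\<^bsub>isom_group\<^esub> g) y = h y" for y
      using isom_inv_apply[OF gI, of "h y"] gh by simp
    then have "\<Phi> g = c"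
      by (auto simp: \<Phi>_def fun_eq_iff g h split: sum.split)
    then show "c \<in> \<Phi> ` carrier isom_group"
      using gI by blast
  qed
  define \<Psi> where "\<Psi> = the_inv_into (carrier isom_group) \<Phi>"
  have \<Psi>\<Phi>: "\<Psi> (\<Phi> g) = g" if "g \<in> carrier isom_group" for g
    using the_inv_into_f_f[OF inj that] by (simp add: \<Psi>_def)
  have \<Psi>: "\<Psi> c \<in> carrier isom_group" "\<Phi> (\<Psi> c) = c" if "c \<in> C" for c
    using surj that \<Psi>\<Phi> by auto
  have "homeomorphic_maps isom_topology (top_of_set C) \<Phi> \<Psi>"
    unfolding homeomorphic_maps_def
  proof (intro conjI ballI)
    show "continuous_map isom_topology (top_of_set C) \<Phi>"
      unfolding continuous_map_atin
    proof
      fix g :: "'u \<Rightarrow> 'u" assume "g \<in> topspace isom_topology"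
      then have lim: "limitin isom_topology (\<lambda>h. h) g (atin isom_topology g)"
        using limitin_continuous_map[OF continuous_map_id, of g isom_topology] by (simp add: id_def)
      from lim limitin_isom_inv[OF lim]
      have "((\<lambda>h. \<Phi> h i) \<longlongrightarrow> \<Phi> g i) (atin isom_topology g)" for i
        by (cases i) (auto simp: \<Phi>_def limitin_isom_topology)
      moreover have "\<forall>\<^sub>F h in atin isom_topology g. \<Phi> h \<in> C"
        using lim by (auto simp: limitin_isom_topology elim: eventually_mono intro: \<Phi>C)
      ultimately show "limitin (top_of_set C) \<Phi> (\<Phi> g) (atin isom_topology g)"
        using \<open>g \<in> topspace isom_topology\<close> \<Phi>C by (auto simp: limitin_subtopology tendsto_fun_iff)
    qed
    show "continuous_map (top_of_set C) isom_topology \<Psi>"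
      unfolding continuous_map_atin
    proof
      fix c assume "c \<in> topspace (top_of_set C)"
      then have "c \<in> C" by simp
      have lim: "limitin (top_of_set C) (\<lambda>h. h) c (atin (top_of_set C) c)"
        using limitin_continuous_map[OF continuous_map_id, of c "top_of_set C"] \<open>c \<in> C\<close>
        by (simp add: id_def)
      then have ev: "\<forall>\<^sub>F b in atin (top_of_set C) c. b \<in> C"
        by (simp add: limitin_subtopology)
      \<comment> \<open>The coordinates \<open>Inl n\<close> give values only on the dense sequence,
        which is enough for convergence of isometries to an isometry.\<close>
      show "limitin isom_topology \<Psi> (\<Psi> c) (atin (top_of_set C) c)"
      proof (rule limitin_isom_topology_dense[OF _ _ q])
        show "\<forall>\<^sub>F b in atin (top_of_set C) c. \<Psi> b \<in> carrier isom_group"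
          using ev by (rule eventually_mono) (rule \<Psi>)
        fix x assume "x \<in> range q"
        then obtain n where n: "x = q n" by auto
        have val: "\<Psi> b x = b (Inl n)" if "b \<in> C" for b
          using fun_cong[OF \<Psi>(2)[OF that], of "Inl n"] by (simp add: \<Phi>_def n)
        have "((\<lambda>b. b (Inl n)) \<longlongrightarrow> c (Inl n)) (atin (top_of_set C) c)"
          using lim by (simp add: limitin_subtopology tendsto_fun_iff)
        then show "((\<lambda>b. \<Psi> b x) \<longlongrightarrow> \<Psi> c x) (atin (top_of_set C) c)"
          unfolding val[OF \<open>c \<in> C\<close>]
          by (rule Lim_transform_eventually) (use ev val in \<open>auto elim: eventually_mono\<close>)
      qed (use \<Psi> \<open>c \<in> C\<close> in auto)
    qed
  qed (use \<Psi>\<Phi> \<Psi> in auto)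
  then show thesis
    using that \<open>closed C\<close> homeomorphic_space_def by blast
qed

lemma polish_isom_topology:
  "polish_topology (isom_topology :: ('u::polish_space \<Rightarrow> 'u) topology)"
proof -
  obtain C :: "(nat + nat \<Rightarrow> 'u) set"
    where C: "closed C" "(isom_topology :: ('u \<Rightarrow> 'u) topology) homeomorphic_space top_of_set C"
    by (rule isom_topology_homeomorphic_closed)
  have "completely_metrizable_space (top_of_set C)"
    using C(1) by (intro completely_metrizable_space_closedin completely_metrizable_space_euclidean) simp
  moreover have "second_countable (top_of_set C)"
    by (intro second_countable_subtopology second_countable_euclidean)
  ultimately show ?thesis
    using homeomorphic_completely_metrizable_space[OF C(2)] homeomorphic_space_second_countability[OF C(2)]
    by (simp add: polish_topology_def)
qed

lemma polish_group_isom_group: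
  "polish_group isom_group (isom_topology :: ('u::polish_space \<Rightarrow> 'u) topology)"
  unfolding polish_group_def
proof (intro conjI group_isom_group polish_isom_topology)
  let ?T = "isom_topology :: ('u \<Rightarrow> 'u) topology"
  show "continuous_map (prod_topology ?T ?T) ?T (\<lambda>(g, h). g \<otimes>\<^bsub>isom_group\<^esub> h)"
    unfolding continuous_map_atin
  proof
    fix p assume p: "p \<in> topspace (prod_topology ?T ?T)"
    show "limitin ?T (\<lambda>(g, h). g \<otimes>\<^bsub>isom_group\<^esub> h) (case p of (g, h) \<Rightarrow> g \<otimes>\<^bsub>isom_group\<^esub> h)
        (atin (prod_topology ?T ?T) p)"
      using limitin_isom_comp[OF limitin_continuous_map[OF continuous_map_fst p refl]
          limitin_continuous_map[OF continuous_map_snd p refl]]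
      by (simp add: case_prod_unfold)
  qed
  show "continuous_map ?T ?T (\<lambda>g. inv\<^bsub>isom_group\<^esub> g)"
    unfolding continuous_map_atin
  proof
    fix g assume "g \<in> topspace ?T"
    from limitin_isom_inv[OF limitin_continuous_map[OF continuous_map_id this refl]]
    show "limitin ?T (\<lambda>g. inv\<^bsub>isom_group\<^esub> g) (inv\<^bsub>isom_group\<^esub> g) (atin ?T g)"
      by simp
  qed
qed simp

section \<open>The space of structures\<close>

text \<open>Maxima are handled through their upper bounds. The \<open>0\<close> inserted into the
  maximum covers empty tuples and is the reason for restricting to nonnegative
  \<open>e\<close>.\<close>

lemma tuple_dist_le_iff:
  assumes "length s = length t" "0 \<le> e"
  shows "tuple_dist s t \<le> e \<longleftrightarrow> (\<forall>i<length s. dist (s ! i) (t ! i) \<le> e)"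
proof -
  have "set (map2 dist s t) = {dist (s ! i) (t ! i) | i. i < length s}"
    using assms by (auto simp: set_zip)
  then show ?thesis
    using assms by (auto simp: tuple_dist_def)
qed

lemma tuple_dist_nonneg: "0 \<le> tuple_dist s t"
  by (simp add: tuple_dist_def)

lemma tuple_dist_map_le_iff:
  "0 \<le> e \<Longrightarrow> tuple_dist (map f s) (map g s) \<le> e \<longleftrightarrow> (\<forall>x\<in>set s. dist (f x) (g x) \<le> e)"
  by (simp add: tuple_dist_le_iff all_set_conv_all_nth)

lemma summable_on_half_power:
  assumes "inj_on \<nu> I"
  shows "(\<lambda>p. (1/2::real) ^ \<nu> p) summable_on I"
proof -
  have "(\<lambda>n. (1/2::real) ^ n) summable_on (UNIV :: nat set)"
    by (rule norm_summable_imp_summable_on) (simp add: summable_geometric)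
  then have "(\<lambda>n. (1/2::real) ^ n) summable_on \<nu> ` I"
    by (rule summable_on_subset) simp
  then show ?thesis
    using summable_on_reindex[OF assms, of "\<lambda>n. (1/2::real) ^ n"] by (simp add: o_def)
qed

locale lipschitz_structures =
  fixes Q :: "'u::metric_space set" and L :: "'r signature" and \<nu> :: "'r \<times> 'u list \<Rightarrow> nat"
  assumes diameter: "\<And>x y :: 'u. dist x y \<le> 1"
    and dense: "closure Q = UNIV"
    and countable_Q: "countable Q"
    and countable_symbols: "countable (symbols L)"
    and modulus_le: "\<And>R t. R \<in> symbols L \<Longrightarrow> t \<in> {0..1} \<Longrightarrow> modulus L R t \<le> real (arity L R) * t"
    and inj_\<nu>: "inj_on \<nu> (index_pairs L Q)"
begin

abbreviation "\<S> \<equiv> structures L :: ('r, 'u) structure_on set"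
abbreviation "X \<equiv> structure_topology L Q \<nu>"

lemma structure_range: "M \<in> \<S> \<Longrightarrow> 0 \<le> M R s \<and> M R s \<le> 1"
  unfolding structures_def by (cases "R \<in> symbols L \<and> length s = arity L R") auto

lemma tuple_dist_le_1: "length s = length t \<Longrightarrow> tuple_dist s (t :: 'u list) \<le> 1"
  by (simp add: tuple_dist_le_iff diameter)

text \<open>The normalisation to 0 outside the signature frees the bound from conditions on
  \<open>R\<close>, and the diameter bound keeps the distance of tuples in the interval where the
  modulus is controlled.\<close>

lemma structure_lipschitz:
  assumes M: "M \<in> \<S>" and len: "length s = length t"
  shows "\<bar>M R s - M R t\<bar> \<le> real (arity L R) * tuple_dist s t"
proof (cases "R \<in> symbols L \<and> length s = arity L R")
  case True
  then have "\<bar>M R s - M R t\<bar> \<le> modulus L R (tuple_dist s t)"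
    using M len by (simp add: structures_def)
  also have "\<dots> \<le> real (arity L R) * tuple_dist s t"
    using True len by (intro modulus_le) (auto simp: tuple_dist_nonneg tuple_dist_le_1)
  finally show ?thesis .
next
  case False
  then show ?thesis
    using M len by (simp add: structures_def tuple_dist_nonneg)
qed

lemma tuple_approx:
  assumes "e > 0"
  obtains t where "set t \<subseteq> Q" "length t = length s" "tuple_dist s t \<le> e"
proof -
  have "\<exists>y\<in>Q. dist x y < e" for x
    using dense_approx[OF dense assms] by metis
  then obtain f where f: "\<And>x. f x \<in> Q" "\<And>x. dist x (f x) < e"
    by metis
  then have "tuple_dist s (map f s) \<le> e"
    using assms by (auto simp: tuple_dist_le_iff less_imp_le)
  then show thesis
    using f(1) by (intro that[of "map f s"]) auto
qed

text \<open>The tuple \<open>t\<close> is chosen before \<open>M\<close>, as the Lipschitz constant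
  is the same for all structures. This uniformity is what carries equality, convergence and the
  Cauchy property from tuples of \<open>Q\<close> to all tuples.\<close>

lemma structure_tuple_approx:
  assumes R: "R \<in> symbols L" "length s = arity L R" and "e > 0"
  obtains t where "(R, t) \<in> index_pairs L Q" "\<And>M. M \<in> \<S> \<Longrightarrow> \<bar>M R s - M R t\<bar> < e"
proof -
  \<comment> \<open>The summand 1 covers symbols of arity 0.\<close>
  have pos: "e / (arity L R + 1) > 0"
    using \<open>e > 0\<close> by simp
  obtain t where t: "set t \<subseteq> Q" "length t = length s" "tuple_dist s t \<le> e / (arity L R + 1)"
    using tuple_approx[OF pos] by blast
  have "\<bar>M R s - M R t\<bar> < e" if "M \<in> \<S>" for M
  proof -
    have "\<bar>M R s - M R t\<bar> \<le> real (arity L R) * tuple_dist s t"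
      using that t by (intro structure_lipschitz) auto
    also have "\<dots> \<le> real (arity L R) * (e / (arity L R + 1))"
      using t by (intro mult_left_mono) auto
    also have "\<dots> < e"
      using \<open>e > 0\<close> by (simp add: field_simps)
    finally show ?thesis .
  qed
  then show thesis
    using that[of t] t R by (auto simp: index_pairs_def)
qed

lemma structure_zero: "M \<in> \<S> \<Longrightarrow> \<not> (R \<in> symbols L \<and> length s = arity L R) \<Longrightarrow> M R s = 0"
  unfolding structures_def by blast

lemma structure_eqI:
  assumes M: "M \<in> \<S>" and N: "N \<in> \<S>" and eq: "\<And>R s. (R, s) \<in> index_pairs L Q \<Longrightarrow> M R s = N R s"
  shows "M = N"
proof (intro ext)
  fix R s
  show "M R s = N R s"
  proof (cases "R \<in> symbols L \<and> length s = arity L R")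
    case True
    have "\<bar>M R s - N R s\<bar> \<le> e" if pos: "e > 0" for e
    proof -
      obtain t where t: "(R, t) \<in> index_pairs L Q" "\<And>M. M \<in> \<S> \<Longrightarrow> \<bar>M R s - M R t\<bar> < e / 2"
        using structure_tuple_approx[of R s "e / 2"] True half_gt_zero[OF pos] by blast
      show ?thesis
        using t(2)[OF M] t(2)[OF N] eq[OF t(1)] by linarith
    qed
    then show ?thesis
      by (metis abs_ge_zero dense_ge dual_order.antisym abs_eq_0 right_minus_eq)
  next
    case False
    then show ?thesis
      using structure_zero M N by metis
  qed
qed

lemma tendsto_eval:
  assumes l: "l \<in> \<S>" and f: "\<forall>\<^sub>F a in F. f a \<in> \<S>"
    and lim: "\<And>R s. (R, s) \<in> index_pairs L Q \<Longrightarrow> ((\<lambda>a. f a R s) \<longlongrightarrow> l R s) F"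
  shows "((\<lambda>a. f a R s) \<longlongrightarrow> l R s) F"
proof (cases "R \<in> symbols L \<and> length s = arity L R")
  case True
  show ?thesis
  proof (rule tendstoI)
    fix e :: real assume "e > 0"
    then have pos: "e / 3 > 0" by simp
    obtain t where t: "(R, t) \<in> index_pairs L Q" "\<And>M. M \<in> \<S> \<Longrightarrow> \<bar>M R s - M R t\<bar> < e / 3"
      using structure_tuple_approx[of R s, OF _ _ pos] True by blast
    have "\<forall>\<^sub>F a in F. dist (f a R t) (l R t) < e / 3"
      using \<open>e > 0\<close> by (intro tendstoD[OF lim[OF t(1)]]) simp
    with f show "\<forall>\<^sub>F a in F. dist (f a R s) (l R s) < e"
    proof eventually_elim
      case (elim a)
      with t(2)[OF l] t(2)[OF elim(1)] show ?case
        unfolding dist_real_def by linarith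
    qed
  qed
next
  case False
  have "\<forall>\<^sub>F a in F. f a R s = l R s"
    using f by eventually_elim (metis False structure_zero l)
  then show ?thesis
    by (rule tendsto_eventually)
qed

text \<open>Evaluation is jointly continuous in the structure and the tuple, thanks to the common
  Lipschitz constant. The action needs this form: there the structure varies together with the
  inverse isometry that moves the tuple.\<close>

lemma tendsto_eval_moving:
  assumes f: "\<forall>\<^sub>F a in F. f a \<in> \<S>"
    and lim: "((\<lambda>a. f a R (map k s)) \<longlongrightarrow> c) F"
    and h: "\<And>x. x \<in> set s \<Longrightarrow> ((\<lambda>a. h a x) \<longlongrightarrow> k x) F"
  shows "((\<lambda>a. f a R (map (h a) s)) \<longlongrightarrow> c) F"
proof (rule tendstoI)
  fix e :: real assume "e > 0"
  define e' where "e' = e / (2 * (real (arity L R) + 1))"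
  have e': "e' > 0" "real (arity L R) * e' < e / 2"
    using \<open>e > 0\<close> by (simp_all add: e'_def field_simps)
  have "\<forall>\<^sub>F a in F. \<forall>x\<in>set s. dist (h a x) (k x) < e'"
    using tendstoD[OF h e'(1)] by (simp add: eventually_ball_finite)
  moreover have "\<forall>\<^sub>F a in F. dist (f a R (map k s)) c < e / 2"
    using \<open>e > 0\<close> by (intro tendstoD[OF lim]) simp
  ultimately show "\<forall>\<^sub>F a in F. dist (f a R (map (h a) s)) c < e"
    using f
  proof eventually_elim
    case (elim a)
    have "\<bar>f a R (map (h a) s) - f a R (map k s)\<bar>
        \<le> real (arity L R) * tuple_dist (map (h a) s) (map k s)"
      using elim by (intro structure_lipschitz) auto
    also have "\<dots> \<le> real (arity L R) * e'"
      using elim e' by (intro mult_left_mono) (auto simp: tuple_dist_map_le_iff less_imp_le)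
    finally show ?case
      using elim e' unfolding dist_real_def by linarith
  qed
qed

section \<open>The metric on structures and its topology\<close>

abbreviation (input) weight :: "'r \<times> 'u list \<Rightarrow> real" where "weight p \<equiv> (1/2) ^ \<nu> p"

lemma summable_weight: "S \<subseteq> index_pairs L Q \<Longrightarrow> weight summable_on S"
  by (rule summable_on_half_power) (rule inj_on_subset[OF inj_\<nu>])

lemma structure_dist_eq:
  "structure_dist L Q \<nu> M N = (\<Sum>\<^sub>\<infinity>p\<in>index_pairs L Q. weight p * \<bar>M (fst p) (snd p) - N (fst p) (snd p)\<bar>)"
  by (simp add: structure_dist_def case_prod_unfold)

lemma weighted_diff_le:
  assumes "M \<in> \<S>" "N \<in> \<S>"
  shows "weight p * \<bar>M R s - N R s\<bar> \<le> weight p"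
proof -
  have "\<bar>M R s - N R s\<bar> \<le> 1"
    using structure_range[OF assms(1), of R s] structure_range[OF assms(2), of R s] by linarith
  then show ?thesis
    by (simp add: mult_left_le)
qed

lemma summable_weighted_diff:
  assumes "M \<in> \<S>" "N \<in> \<S>" "S \<subseteq> index_pairs L Q"
  shows "(\<lambda>p. weight p * \<bar>M (fst p) (snd p) - N (fst p) (snd p)\<bar>) summable_on S"
  by (rule summable_on_comparison_test[OF summable_weight[OF assms(3)]])
     (use assms weighted_diff_le in auto)

lemma weighted_diff_le_structure_dist:
  assumes "M \<in> \<S>" "N \<in> \<S>" "(R, s) \<in> index_pairs L Q"
  shows "\<bar>M R s - N R s\<bar> \<le> 2 ^ \<nu> (R, s) * structure_dist L Q \<nu> M N"
proof -
  have "(\<Sum>p\<in>{(R, s)}. weight p * \<bar>M (fst p) (snd p) - N (fst p) (snd p)\<bar>) \<le> structure_dist L Q \<nu> M N"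
    unfolding structure_dist_eq
    using assms by (intro finite_sum_le_infsum summable_weighted_diff) auto
  then show ?thesis
    by (simp add: field_simps power_divide)
qed

lemma metric_space_structures: "Metric_space \<S> (structure_dist L Q \<nu>)"
proof
  fix M N :: "('r, 'u) structure_on"
  show "0 \<le> structure_dist L Q \<nu> M N"
    unfolding structure_dist_eq by (rule infsum_nonneg) simp
  show "structure_dist L Q \<nu> M N = structure_dist L Q \<nu> N M"
    by (simp add: structure_dist_eq abs_minus_commute)
next
  fix M N :: "('r, 'u) structure_on" assume MN: "M \<in> \<S>" "N \<in> \<S>"
  show "structure_dist L Q \<nu> M N = 0 \<longleftrightarrow> M = N"
  proof
    assume 0: "structure_dist L Q \<nu> M N = 0"
    show "M = N"
      using MN
    proof (rule structure_eqI)
      fix R s assume "(R, s) \<in> index_pairs L Q"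
      from weighted_diff_le_structure_dist[OF MN this] show "M R s = N R s"
        by (simp add: 0)
    qed
  qed (simp add: structure_dist_eq)
next
  fix M N P assume S: "M \<in> \<S>" "N \<in> \<S>" "P \<in> \<S>"
  have "structure_dist L Q \<nu> M P \<le> (\<Sum>\<^sub>\<infinity>p\<in>index_pairs L Q.
      weight p * \<bar>M (fst p) (snd p) - N (fst p) (snd p)\<bar> + weight p * \<bar>N (fst p) (snd p) - P (fst p) (snd p)\<bar>)"
    unfolding structure_dist_eq
    using S by (intro infsum_mono summable_weighted_diff summable_on_add)
      (auto simp flip: distrib_left intro!: mult_left_mono)
  also have "\<dots> = structure_dist L Q \<nu> M N + structure_dist L Q \<nu> N P"
    unfolding structure_dist_eq using S by (intro infsum_add summable_weighted_diff) auto
  finally show "structure_dist L Q \<nu> M P \<le> structure_dist L Q \<nu> M N + structure_dist L Q \<nu> N P" .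
qed

sublocale structures: Metric_space \<S> "structure_dist L Q \<nu>"
  by (rule metric_space_structures)

lemma topspace_structure_topology [simp]: "topspace X = \<S>"
  by (simp add: structure_topology_def)

text \<open>The weights are summable and all differences are at most 1, so a finite set
  \<open>S\<close> of pairs can be chosen outside of which every pair of structures contributes less
  than \<open>e / 2\<close>; on \<open>S\<close> only finitely many coordinates have to
  converge.\<close>

lemma eventually_structure_dist_less:
  assumes l: "l \<in> \<S>" and f: "\<forall>\<^sub>F a in F. f a \<in> \<S>"
    and lim: "\<And>R s. (R, s) \<in> index_pairs L Q \<Longrightarrow> ((\<lambda>a. f a R s) \<longlongrightarrow> l R s) F"
    and "e > 0"
  shows "\<forall>\<^sub>F a in F. structure_dist L Q \<nu> (f a) l < e"
proof -
  let ?I = "index_pairs L Q"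
  let ?t = "\<lambda>M p. weight p * \<bar>M (fst p) (snd p) - l (fst p) (snd p)\<bar>"
  have "(sum weight \<longlongrightarrow> infsum weight ?I) (finite_subsets_at_top ?I)"
    using has_sum_infsum[OF summable_weight[OF order_refl]] by (simp add: has_sum_def)
  from tendstoD[OF this half_gt_zero[OF \<open>e > 0\<close>]]
  obtain S where S: "finite S" "S \<subseteq> ?I" "dist (sum weight S) (infsum weight ?I) < e / 2"
    unfolding eventually_finite_subsets_at_top by blast
  have "infsum weight (?I - S) = infsum weight ?I - infsum weight S"
    using S by (intro infsum_Diff summable_weight) auto
  then have tail: "infsum weight (?I - S) < e / 2"
    using S by (simp add: dist_real_def abs_if split: if_splits)
  have "((\<lambda>a. \<Sum>p\<in>S. ?t (f a) p) \<longlongrightarrow> (\<Sum>p\<in>S. weight p * \<bar>l (fst p) (snd p) - l (fst p) (snd p)\<bar>)) F"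
    using S by (intro tendsto_sum tendsto_mult tendsto_const tendsto_rabs tendsto_diff lim) auto
  then have "((\<lambda>a. \<Sum>p\<in>S. ?t (f a) p) \<longlongrightarrow> 0) F"
    by simp
  from order_tendstoD(2)[OF this half_gt_zero[OF \<open>e > 0\<close>]]
  have "\<forall>\<^sub>F a in F. (\<Sum>p\<in>S. ?t (f a) p) < e / 2" .
  with f show ?thesis
  proof eventually_elim
    case (elim a)
    have "structure_dist L Q \<nu> (f a) l = infsum (?t (f a)) (S \<union> (?I - S))"
      using S by (simp add: structure_dist_eq Un_absorb1)
    also have "\<dots> = infsum (?t (f a)) S + infsum (?t (f a)) (?I - S)"
      using S l elim by (intro infsum_Un_disjoint summable_weighted_diff) auto
    also have "infsum (?t (f a)) (?I - S) \<le> infsum weight (?I - S)"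
      using S l elim
      by (intro infsum_mono summable_weighted_diff summable_weight weighted_diff_le) auto
    finally show ?case
      using elim tail S by simp
  qed
qed

text \<open>Later topological arguments use this description by pointwise convergence in place of
  the weighted sum.\<close>

lemma limitin_structure_topology:
  "limitin X f l F \<longleftrightarrow> l \<in> \<S> \<and> (\<forall>\<^sub>F a in F. f a \<in> \<S>) \<and>
     (\<forall>(R, s)\<in>index_pairs L Q. ((\<lambda>a. f a R s) \<longlongrightarrow> l R s) F)"
  (is "?lhs \<longleftrightarrow> ?rhs")
proof
  assume ?lhs
  then have l: "l \<in> \<S>"
    and ev: "\<And>e. e > 0 \<Longrightarrow> \<forall>\<^sub>F a in F. f a \<in> \<S> \<and> structure_dist L Q \<nu> (f a) l < e"
    by (auto simp: structure_topology_def structures.limitin_metric)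
  show ?rhs
  proof (intro conjI l ballI)
    show "\<forall>\<^sub>F a in F. f a \<in> \<S>"
      using ev[of 1] by (auto elim: eventually_mono)
    fix p assume p: "p \<in> index_pairs L Q"
    obtain R s where Rs: "p = (R, s)" by fastforce
    have "((\<lambda>a. f a R s) \<longlongrightarrow> l R s) F"
    proof (rule tendstoI)
      fix e :: real assume "e > 0"
      then have "e / 2 ^ \<nu> (R, s) > 0" by simp
      from ev[OF this] show "\<forall>\<^sub>F a in F. dist (f a R s) (l R s) < e"
      proof eventually_elim
        case (elim a)
        have "\<bar>f a R s - l R s\<bar> \<le> 2 ^ \<nu> (R, s) * structure_dist L Q \<nu> (f a) l"
          using elim l p Rs by (intro weighted_diff_le_structure_dist) auto
        also have "\<dots> < e"
          using elim by (simp add: field_simps)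
        finally show ?case
          by (simp add: dist_real_def)
      qed
    qed
    then show "case p of (R, s) \<Rightarrow> ((\<lambda>a. f a R s) \<longlongrightarrow> l R s) F"
      by (simp add: Rs)
  qed
next
  assume ?rhs
  then show ?lhs
    unfolding structure_topology_def structures.limitin_metric
    by (auto intro!: eventually_conj eventually_structure_dist_less)
qed

lemma limitin_structure_topology_eval:
  assumes "limitin X f l F"
  shows "((\<lambda>a. f a R s) \<longlongrightarrow> l R s) F"
  using assms unfolding limitin_structure_topology by - (rule tendsto_eval[of l f F], auto)

lemma continuous_map_into_structures:
  assumes "\<And>y. y \<in> topspace Y \<Longrightarrow> f y \<in> \<S>"
    and "\<And>R s. (R, s) \<in> index_pairs L Q \<Longrightarrow> continuous_map Y euclideanreal (\<lambda>y. f y R s)"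
  shows "continuous_map Y X f"
  unfolding continuous_map_atin limitin_structure_topology
proof (intro ballI conjI)
  fix y assume y: "y \<in> topspace Y"
  show "f y \<in> \<S>"
    using y by (rule assms)
  show "\<forall>\<^sub>F a in atin Y y. f a \<in> \<S>"
    unfolding eventually_atin using assms(1) y openin_topspace by blast
  show "case p of (R, s) \<Rightarrow> ((\<lambda>a. f a R s) \<longlongrightarrow> f y R s) (atin Y y)"
    if "p \<in> index_pairs L Q" for p
    using that assms(2) y unfolding continuous_map_atin by (cases p) simp
qed

lemma continuous_map_eval: "continuous_map X euclideanreal (\<lambda>M. M R s)"
  unfolding continuous_map_atin
  using limitin_structure_topology_eval[OF limitin_continuous_map[OF continuous_map_id _ refl]]
  by (simp add: id_def)

text \<open>The metric controls only tuples of \<open>Q\<close>; uniform approximation makes the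
  values at every tuple Cauchy. The pointwise limit is a structure because its defining conditions
  are closed.\<close>

lemma mcomplete_structures: "structures.mcomplete"
  unfolding structures.mcomplete_def
proof (intro allI impI)
  fix \<sigma> assume "structures.MCauchy \<sigma>"
  then have \<sigma>: "\<And>n. \<sigma> n \<in> \<S>"
    and C: "\<And>e. e > 0 \<Longrightarrow> \<exists>N. \<forall>m\<ge>N. \<forall>n\<ge>N. structure_dist L Q \<nu> (\<sigma> m) (\<sigma> n) < e"
    by (auto simp: structures.MCauchy_def image_subset_iff)
  have C0: "Cauchy (\<lambda>n. \<sigma> n R s)" if Rs: "(R, s) \<in> index_pairs L Q" for R s
  proof (rule metric_CauchyI)
    fix e :: real assume "e > 0"
    then obtain N where N: "\<And>m n. m \<ge> N \<Longrightarrow> n \<ge> N \<Longrightarrow>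
        structure_dist L Q \<nu> (\<sigma> m) (\<sigma> n) < e / 2 ^ \<nu> (R, s)"
      using C[of "e / 2 ^ \<nu> (R, s)"] by auto
    show "\<exists>N. \<forall>m\<ge>N. \<forall>n\<ge>N. dist (\<sigma> m R s) (\<sigma> n R s) < e"
    proof (intro exI allI impI)
      fix m n assume "m \<ge> N" "n \<ge> N"
      have "\<bar>\<sigma> m R s - \<sigma> n R s\<bar> \<le> 2 ^ \<nu> (R, s) * structure_dist L Q \<nu> (\<sigma> m) (\<sigma> n)"
        using \<sigma> Rs by (intro weighted_diff_le_structure_dist)
      also have "\<dots> < e"
        using N[OF \<open>m \<ge> N\<close> \<open>n \<ge> N\<close>] by (simp add: field_simps)
      finally show "dist (\<sigma> m R s) (\<sigma> n R s) < e"
        by (simp add: dist_real_def)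
    qed
  qed
  have C1: "Cauchy (\<lambda>n. \<sigma> n R s)" for R s
  proof (cases "R \<in> symbols L \<and> length s = arity L R")
    case True
    show ?thesis
    proof (rule metric_CauchyI)
      fix e :: real assume "e > 0"
      then have pos: "e / 3 > 0" by simp
      obtain t where t: "(R, t) \<in> index_pairs L Q" "\<And>M. M \<in> \<S> \<Longrightarrow> \<bar>M R s - M R t\<bar> < e / 3"
        using structure_tuple_approx[of R s, OF _ _ pos] True by blast
      from metric_CauchyD[OF C0[OF t(1)] pos] obtain N
        where N: "\<And>m n. m \<ge> N \<Longrightarrow> n \<ge> N \<Longrightarrow> dist (\<sigma> m R t) (\<sigma> n R t) < e / 3"
        by blast
      have "dist (\<sigma> m R s) (\<sigma> n R s) < e" if "m \<ge> N" "n \<ge> N" for m n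
        using N[OF that] t(2)[OF \<sigma>[of m]] t(2)[OF \<sigma>[of n]] unfolding dist_real_def by linarith
      then show "\<exists>N. \<forall>m\<ge>N. \<forall>n\<ge>N. dist (\<sigma> m R s) (\<sigma> n R s) < e"
        by blast
    qed
  next
    case False
    then have "\<sigma> n R s = 0" for n
      using structure_zero[OF \<sigma>] by blast
    then show ?thesis
      by (simp add: Cauchy_def)
  qed
  define M where "M R s = lim (\<lambda>n. \<sigma> n R s)" for R s
  have lim: "(\<lambda>n. \<sigma> n R s) \<longlonglongrightarrow> M R s" for R s
    using C1[of R s] unfolding M_def by (simp add: Cauchy_convergent_iff convergent_LIMSEQ_iff)
  have "M \<in> \<S>"
    unfolding structures_def
  proof (intro CollectI conjI allI impI)
    fix R and s :: "'u list"
    show "M R s \<in> {0..1}"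
      using \<sigma> structure_range lim closed_sequentially[of "{0..1::real}" "\<lambda>n. \<sigma> n R s"] by auto
  next
    fix R and s t :: "'u list" assume *: "R \<in> symbols L \<and> length s = arity L R \<and> length t = arity L R"
    have "(\<lambda>n. \<bar>\<sigma> n R s - \<sigma> n R t\<bar>) \<longlonglongrightarrow> \<bar>M R s - M R t\<bar>"
      by (intro tendsto_intros lim)
    then show "\<bar>M R s - M R t\<bar> \<le> modulus L R (tuple_dist s t)"
      using \<sigma> * by (intro LIMSEQ_le_const2[of _ "\<bar>M R s - M R t\<bar>"]) (auto simp: structures_def)
  next
    fix R and s :: "'u list" assume "\<not> (R \<in> symbols L \<and> length s = arity L R)"
    then have "\<sigma> n R s = 0" for n
      using structure_zero[OF \<sigma>] by blast
    then show "M R s = 0"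
      using lim[of R s] by (simp add: LIMSEQ_const_iff)
  qed
  then have "limitin X \<sigma> M sequentially"
    using \<sigma> lim by (auto simp: limitin_structure_topology)
  then show "\<exists>M. limitin structures.mtopology \<sigma> M sequentially"
    by (auto simp: structure_topology_def)
qed

text \<open>The values at countably many index pairs embed the space into the product of countably
  many real lines, and second countability passes to subspaces.\<close>

lemma second_countable_structure_topology: "second_countable X"
proof -
  \<comment> \<open>If the index set is empty, \<open>from_nat_into\<close> returns an arbitrary
    pair. This does no harm, because evaluation is continuous at every pair.\<close>
  define \<Phi> :: "('r, 'u) structure_on \<Rightarrow> nat \<Rightarrow> real"
    where "\<Phi> M n = M (fst (from_nat_into (index_pairs L Q) n)) (snd (from_nat_into (index_pairs L Q) n))" for M n
  have "countable (symbols L \<times> lists Q)"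
    by (intro countable_SIGMA countable_lists countable_symbols countable_Q)
  then have ci: "countable (index_pairs L Q)"
    by (rule countable_subset[rotated]) (auto simp: index_pairs_def)
  have \<Phi>: "\<exists>n. \<forall>M. \<Phi> M n = M R s" if "(R, s) \<in> index_pairs L Q" for R s
  proof -
    from from_nat_into_surj[OF ci that]
    obtain n where "from_nat_into (index_pairs L Q) n = (R, s)" by blast
    then have "\<forall>M. \<Phi> M n = M R s" by (simp add: \<Phi>_def)
    then show ?thesis by blast
  qed
  have inj: "inj_on \<Phi> \<S>"
  proof (rule inj_onI, rule structure_eqI)
    fix M N R s assume "\<Phi> M = \<Phi> N" "(R, s) \<in> index_pairs L Q"
    with \<Phi>[of R s] show "M R s = N R s" by metis
  qed
  define \<Psi> where "\<Psi> = the_inv_into \<S> \<Phi>"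
  have \<Psi>: "\<Psi> (\<Phi> M) = M" if "M \<in> \<S>" for M
    using the_inv_into_f_f[OF inj that] by (simp add: \<Psi>_def)
  have "homeomorphic_maps X (top_of_set (\<Phi> ` \<S>)) \<Phi> \<Psi>"
    unfolding homeomorphic_maps_def
  proof (intro conjI ballI)
    show "continuous_map X (top_of_set (\<Phi> ` \<S>)) \<Phi>"
      unfolding continuous_map_in_subtopology
      using continuous_map_componentwise_UNIV[of X "\<lambda>_. euclideanreal" \<Phi>] continuous_map_eval
      by (auto simp: euclidean_product_topology \<Phi>_def)
    show "continuous_map (top_of_set (\<Phi> ` \<S>)) X \<Psi>"
    proof (rule continuous_map_into_structures)
      fix R s assume "(R, s) \<in> index_pairs L Q"
      then obtain n where n: "\<And>M. \<Phi> M n = M R s"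
        using \<Phi> by blast
      have "continuous_map (top_of_set (\<Phi> ` \<S>)) euclideanreal (\<lambda>c. c n)"
        using continuous_on_subset[OF continuous_on_product_coordinates subset_UNIV] by simp
      then show "continuous_map (top_of_set (\<Phi> ` \<S>)) euclideanreal (\<lambda>c. \<Psi> c R s)"
        by (rule continuous_map_eq) (auto simp: \<Psi> n)
    qed (auto simp: \<Psi>)
  qed (auto simp: \<Psi>)
  then have "X homeomorphic_space top_of_set (\<Phi> ` \<S>)"
    unfolding homeomorphic_space_def by blast
  from homeomorphic_space_second_countability[OF this] show ?thesis
    using second_countable_subtopology[OF second_countable_euclidean] by blast
qed

lemma polish_structure_topology: "polish_topology X"
  unfolding polish_topology_def
  using second_countable_structure_topology
    structures.completely_metrizable_space_mtopology[OF mcomplete_structures]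
  by (simp add: structure_topology_def)

section \<open>Transport of structure as a continuous group action\<close>

lemma transport_apply:
  "M \<in> \<S> \<Longrightarrow> transport L g M R s = M R (map (inv\<^bsub>isom_group\<^esub> g) s)"
  by (simp add: transport_def)

lemma transport_in:
  assumes g: "g \<in> carrier isom_group" and M: "M \<in> \<S>"
  shows "transport L g M \<in> \<S>"
proof -
  have "tuple_dist (map (inv\<^bsub>isom_group\<^esub> g) s) (map (inv\<^bsub>isom_group\<^esub> g) t) = tuple_dist s t"
    if "length s = length t" for s t
    using that inv_isom[OF g] by (simp add: tuple_dist_def zip_map_map split_beta isom_dist o_def)
  moreover have "\<bar>M R (map (inv\<^bsub>isom_group\<^esub> g) s) - M R (map (inv\<^bsub>isom_group\<^esub> g) t)\<bar>
      \<le> modulus L R (tuple_dist (map (inv\<^bsub>isom_group\<^esub> g) s) (map (inv\<^bsub>isom_group\<^esub> g) t))"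
    if "R \<in> symbols L" "length s = arity L R" "length t = arity L R" for R s t
    using M that by (simp add: structures_def)
  ultimately show ?thesis
    using M structure_range[OF M] structure_zero[OF M]
    unfolding structures_def[of L] mem_Collect_eq transport_apply[OF M] by simp
qed

lemma transport_comp:
  assumes "g \<in> carrier isom_group" "h \<in> carrier isom_group" "M \<in> \<S>"
  shows "transport L (g \<circ> h) M = transport L g (transport L h M)"
proof -
  have "inv\<^bsub>isom_group\<^esub> (g \<circ> h) = inv\<^bsub>isom_group\<^esub> h \<circ> inv\<^bsub>isom_group\<^esub> g"
    using group.inv_mult_group[OF group_isom_group assms(1,2)] by simp
  then show ?thesis
    using assms by (intro ext) (simp add: transport_apply transport_in)
qed

lemma transport_id: "M \<in> \<S> \<Longrightarrow> transport L id M = M"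
  by (intro ext) (simp add: transport_apply)

lemma group_action_transport: "group_action isom_group \<S> (transport L)"
  unfolding group_action_def group_hom_def group_hom_axioms_def
proof (intro conjI group_isom_group group_BijGroup homI)
  have bij: "transport L g \<in> Bij \<S>" if g: "g \<in> carrier isom_group" for g
  proof -
    have "bij_betw (transport L g) \<S> \<S>"
    proof (rule bij_betw_byWitness[of _ "transport L (inv\<^bsub>isom_group\<^esub> g)"])
      have "inv\<^bsub>isom_group\<^esub> g \<circ> g = id" "g \<circ> inv\<^bsub>isom_group\<^esub> g = id"
        using g by auto
      then show "\<forall>M\<in>\<S>. transport L (inv\<^bsub>isom_group\<^esub> g) (transport L g M) = M"
        and "\<forall>M\<in>\<S>. transport L g (transport L (inv\<^bsub>isom_group\<^esub> g) M) = M"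
        using g inv_isom[OF g] by (simp_all add: transport_id flip: transport_comp)
    qed (use g inv_isom[OF g] transport_in in auto)
    then show ?thesis
      by (simp add: Bij_def transport_def)
  qed
  then show "transport L g \<in> carrier (BijGroup \<S>)" if "g \<in> carrier isom_group" for g
    using that by (simp add: BijGroup_def)
  show "transport L (g \<otimes>\<^bsub>isom_group\<^esub> h) = transport L g \<otimes>\<^bsub>BijGroup \<S>\<^esub> transport L h"
    if gh: "g \<in> carrier isom_group" "h \<in> carrier isom_group" for g h
  proof (rule extensionalityI[of _ \<S>])
    show "transport L (g \<otimes>\<^bsub>isom_group\<^esub> h) \<in> extensional \<S>"
      by (simp add: transport_def)
    show "transport L g \<otimes>\<^bsub>BijGroup \<S>\<^esub> transport L h \<in> extensional \<S>"
      using gh bij by (simp add: BijGroup_def)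
    show "transport L (g \<otimes>\<^bsub>isom_group\<^esub> h) M = (transport L g \<otimes>\<^bsub>BijGroup \<S>\<^esub> transport L h) M"
      if "M \<in> \<S>" for M
      using gh bij that by (simp add: BijGroup_def compose_def transport_comp)
  qed
qed

lemma continuous_map_transport:
  "continuous_map (prod_topology (isom_topology :: ('u \<Rightarrow> 'u) topology) X) X (\<lambda>(g, M). transport L g M)"
  unfolding continuous_map_atin
proof
  let ?P = "prod_topology (isom_topology :: ('u \<Rightarrow> 'u) topology) X"
  fix p assume p: "p \<in> topspace ?P"
  then obtain g M where gM: "p = (g, M)" "g \<in> carrier isom_group" "M \<in> \<S>"
    by auto
  have 1: "limitin isom_topology fst g (atin ?P p)"
    using limitin_continuous_map[OF continuous_map_fst p refl] gM by simp
  have 2: "limitin X snd M (atin ?P p)"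
    using limitin_continuous_map[OF continuous_map_snd p refl] gM by simp
  have ev: "\<forall>\<^sub>F a in atin ?P p. fst a \<in> carrier isom_group" "\<forall>\<^sub>F a in atin ?P p. snd a \<in> \<S>"
    using 1 2 by (auto simp: limitin_isom_topology limitin_structure_topology)
  have "((\<lambda>a. transport L (fst a) (snd a) R s) \<longlongrightarrow> transport L g M R s) (atin ?P p)" for R s
  proof -
    have "((\<lambda>a. snd a R (map (inv\<^bsub>isom_group\<^esub> (fst a)) s)) \<longlongrightarrow> M R (map (inv\<^bsub>isom_group\<^esub> g) s)) (atin ?P p)"
    proof (rule tendsto_eval_moving[where f = snd and k = "inv\<^bsub>isom_group\<^esub> g"])
      show "((\<lambda>a. (inv\<^bsub>isom_group\<^esub> (fst a)) x) \<longlongrightarrow> (inv\<^bsub>isom_group\<^esub> g) x) (atin ?P p)" for x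
        using limitin_isom_inv[OF 1] unfolding limitin_isom_topology by blast
    qed (use ev(2) limitin_structure_topology_eval[OF 2] in auto)
    moreover have "\<forall>\<^sub>F a in atin ?P p. snd a R (map (inv\<^bsub>isom_group\<^esub> (fst a)) s) = transport L (fst a) (snd a) R s"
      using ev(2) by eventually_elim (simp add: transport_apply)
    ultimately have "((\<lambda>a. transport L (fst a) (snd a) R s) \<longlongrightarrow> M R (map (inv\<^bsub>isom_group\<^esub> g) s)) (atin ?P p)"
      by (rule Lim_transform_eventually)
    then show ?thesis
      using gM by (simp add: transport_apply)
  qed
  moreover have "\<forall>\<^sub>F a in atin ?P p. transport L (fst a) (snd a) \<in> \<S>"
    using ev by eventually_elim (rule transport_in)
  ultimately show "limitin X (\<lambda>(g, M). transport L g M) (case p of (g, M) \<Rightarrow> transport L g M) (atin ?P p)"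
    using gM by (auto simp: limitin_structure_topology transport_in case_prod_unfold)
qed

end

section \<open>Continuous formulas\<close>

lemma SUP_unit:
  fixes f :: "'a \<Rightarrow> real"
  assumes "\<And>a. 0 \<le> f a \<and> f a \<le> 1"
  shows "bdd_above (range f)" "0 \<le> (SUP a. f a) \<and> (SUP a. f a) \<le> 1"
proof -
  show bdd: "bdd_above (range f)"
    using assms by (intro bdd_aboveI[of _ 1]) auto
  have "0 \<le> f undefined" using assms by blast
  also have "\<dots> \<le> (SUP a. f a)" by (rule cSUP_upper[OF UNIV_I bdd])
  finally show "0 \<le> (SUP a. f a) \<and> (SUP a. f a) \<le> 1"
    using assms by (auto intro: cSUP_least)
qed

lemma INF_unit:
  fixes f :: "'a \<Rightarrow> real"
  assumes "\<And>a. 0 \<le> f a \<and> f a \<le> 1"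
  shows "bdd_below (range f)" "0 \<le> (INF a. f a) \<and> (INF a. f a) \<le> 1"
proof -
  show bdd: "bdd_below (range f)"
    using assms by (intro bdd_belowI[of _ 0]) auto
  have "(INF a. f a) \<le> f undefined" by (rule cINF_lower[OF bdd UNIV_I])
  also have "\<dots> \<le> 1" using assms by blast
  finally show "0 \<le> (INF a. f a) \<and> (INF a. f a) \<le> 1"
    using assms by (auto intro: cINF_greatest)
qed

text \<open>For measurability: a quantifier over an uncountable space becomes a countable supremum,
  to which measurability of the single functions extends. The same holds for infima below.\<close>

lemma SUP_dense:
  fixes f :: "'a::topological_space \<Rightarrow> real"
  assumes "closure D = UNIV" "continuous_on UNIV f" "bdd_above (range f)"
  shows "(SUP a. f a) = (SUP a\<in>D. f a)"
proof (rule antisym)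
  have bdd: "bdd_above (f ` D)"
    using assms(3) by (rule bdd_above_mono) auto
  have "D \<noteq> {}" using assms(1) by auto
  show "(SUP a. f a) \<le> (SUP a\<in>D. f a)"
  proof (rule cSUP_least)
    fix a
    have "a \<in> {a. f a \<le> (SUP a\<in>D. f a)}"
    proof (rule dense_closed_UNIV[OF assms(1)])
      show "closed {a. f a \<le> (SUP a\<in>D. f a)}"
        by (intro closed_Collect_le assms continuous_on_const)
    qed (auto intro: cSUP_upper bdd)
    then show "f a \<le> (SUP a\<in>D. f a)" by simp
  qed simp
  show "(SUP a\<in>D. f a) \<le> (SUP a. f a)"
    using \<open>D \<noteq> {}\<close> assms(3) by (intro cSUP_subset_mono) auto
qed

lemma INF_dense:
  fixes f :: "'a::topological_space \<Rightarrow> real"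
  assumes "closure D = UNIV" "continuous_on UNIV f" "bdd_below (range f)"
  shows "(INF a. f a) = (INF a\<in>D. f a)"
proof (rule antisym)
  have bdd: "bdd_below (f ` D)"
    using assms(3) by (rule bdd_below_mono) auto
  have "D \<noteq> {}" using assms(1) by auto
  show "(INF a\<in>D. f a) \<le> (INF a. f a)"
  proof (rule cINF_greatest)
    fix a
    have "a \<in> {a. (INF a\<in>D. f a) \<le> f a}"
    proof (rule dense_closed_UNIV[OF assms(1)])
      show "closed {a. (INF a\<in>D. f a) \<le> f a}"
        by (intro closed_Collect_le assms continuous_on_const)
    qed (auto intro: cINF_lower bdd)
    then show "(INF a\<in>D. f a) \<le> f a" by simp
  qed simp
  show "(INF a. f a) \<le> (INF a\<in>D. f a)"
    using \<open>D \<noteq> {}\<close> assms(3) by (intro cINF_superset_mono) auto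
qed

lemma SUP_diff_le:
  fixes f g :: "'a \<Rightarrow> real"
  assumes "bdd_above (range f)" "bdd_above (range g)" "\<And>a. \<bar>f a - g a\<bar> \<le> c"
  shows "\<bar>(SUP a. f a) - (SUP a. g a)\<bar> \<le> c"
proof -
  have "(SUP a. f a) \<le> (SUP a. g a) + c" if "bdd_above (range g)" "\<And>a. \<bar>f a - g a\<bar> \<le> c"
    for f g :: "'a \<Rightarrow> real"
  proof (rule cSUP_least)
    fix a
    have "f a \<le> g a + c" using that(2)[of a] by linarith
    also have "g a \<le> (SUP a. g a)" by (rule cSUP_upper[OF UNIV_I that(1)])
    finally show "f a \<le> (SUP a. g a) + c" by simp
  qed simp
  from this[OF assms(2,3)] this[OF assms(1), of g] assms(3) show ?thesis
    by (simp add: abs_le_iff abs_minus_commute)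
qed

lemma INF_diff_le:
  fixes f g :: "'a \<Rightarrow> real"
  assumes "bdd_below (range f)" "bdd_below (range g)" "\<And>a. \<bar>f a - g a\<bar> \<le> c"
  shows "\<bar>(INF a. f a) - (INF a. g a)\<bar> \<le> c"
proof -
  have "(INF a. f a) - c \<le> (INF a. g a)" if "bdd_below (range f)" "\<And>a. \<bar>f a - g a\<bar> \<le> c"
    for f g :: "'a \<Rightarrow> real"
  proof (rule cINF_greatest)
    fix a
    have "(INF a. f a) \<le> f a" by (rule cINF_lower[OF that(1) UNIV_I])
    also have "f a \<le> g a + c" using that(2)[of a] by linarith
    finally show "(INF a. f a) - c \<le> g a" by simp
  qed simp
  from this[OF assms(1,3)] this[OF assms(2), of f] assms(3) show ?thesis
    by (simp add: abs_le_iff abs_minus_commute)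
qed

text \<open>Bound variables are renamed along with the free ones, so an injective \<sigma> causes no
  capture.\<close>

primrec rename_vars :: "(nat \<Rightarrow> nat) \<Rightarrow> 'r cformula \<Rightarrow> 'r cformula" where
  "rename_vars \<sigma> (FDist x y) = FDist (\<sigma> x) (\<sigma> y)"
| "rename_vars \<sigma> (FRel R xs) = FRel R (map \<sigma> xs)"
| "rename_vars \<sigma> FZero = FZero"
| "rename_vars \<sigma> FOne = FOne"
| "rename_vars \<sigma> (FHalf \<phi>) = FHalf (rename_vars \<sigma> \<phi>)"
| "rename_vars \<sigma> (FMinus \<phi> \<psi>) = FMinus (rename_vars \<sigma> \<phi>) (rename_vars \<sigma> \<psi>)"
| "rename_vars \<sigma> (FMin \<phi> \<psi>) = FMin (rename_vars \<sigma> \<phi>) (rename_vars \<sigma> \<psi>)"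
| "rename_vars \<sigma> (FMax \<phi> \<psi>) = FMax (rename_vars \<sigma> \<phi>) (rename_vars \<sigma> \<psi>)"
| "rename_vars \<sigma> (FAbsDiff \<phi> \<psi>) = FAbsDiff (rename_vars \<sigma> \<phi>) (rename_vars \<sigma> \<psi>)"
| "rename_vars \<sigma> (FCompl \<phi>) = FCompl (rename_vars \<sigma> \<phi>)"
| "rename_vars \<sigma> (FPlus \<phi> \<psi>) = FPlus (rename_vars \<sigma> \<phi>) (rename_vars \<sigma> \<psi>)"
| "rename_vars \<sigma> (FScale q \<phi>) = FScale q (rename_vars \<sigma> \<phi>)"
| "rename_vars \<sigma> (FSup x \<phi>) = FSup (\<sigma> x) (rename_vars \<sigma> \<phi>)"
| "rename_vars \<sigma> (FInf x \<phi>) = FInf (\<sigma> x) (rename_vars \<sigma> \<phi>)"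

lemma is_formula_rename_vars: "is_formula L (rename_vars \<sigma> \<phi>) \<longleftrightarrow> is_formula L \<phi>"
  by (induction \<phi>) auto

lemma free_vars_rename_vars: "inj \<sigma> \<Longrightarrow> free_vars (rename_vars \<sigma> \<phi>) = \<sigma> ` free_vars \<phi>"
  by (induction \<phi>) (auto simp: inj_def)

lemma formula_value_rename_vars:
  assumes "inj \<sigma>"
  shows "formula_value M v (rename_vars \<sigma> \<phi>) = formula_value M (v \<circ> \<sigma>) \<phi>"
proof -
  have upd: "v(\<sigma> x := a) \<circ> \<sigma> = (v \<circ> \<sigma>)(x := a)" for v :: "nat \<Rightarrow> 'b" and x a
    using assms by (auto simp: fun_eq_iff inj_def)
  show ?thesis
    by (induction \<phi> arbitrary: v) (simp_all add: upd)
qed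

lemma finite_free_vars: "finite (free_vars \<phi>)"
  by (induction \<phi>) auto

lemma set_cformula_subset_symbols: "is_formula L \<phi> \<Longrightarrow> set_cformula \<phi> \<subseteq> symbols L"
  by (induction \<phi>) auto

instance cformula :: (countable) countable
  by countable_datatype

text \<open>Only the symbols of the signature are assumed to be countable, not their type. Coding
  them by natural numbers is injective on formulas over the signature, and formulas over numbers
  form a countable type.\<close>

lemma countable_formulas:
  assumes "countable (symbols L)"
  shows "countable {\<phi>. is_formula L \<phi>}"
proof -
  let ?F = "{\<phi>. is_formula L \<phi>}"
  have "inj_on (map_cformula (to_nat_on (symbols L))) ?F"
  proof (rule inj_onI)
    fix \<phi> \<psi> assume "\<phi> \<in> ?F" "\<psi> \<in> ?F"
      and eq: "map_cformula (to_nat_on (symbols L)) \<phi> = map_cformula (to_nat_on (symbols L)) \<psi>"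
    then have sub: "set_cformula \<phi> \<subseteq> symbols L" "set_cformula \<psi> \<subseteq> symbols L"
      by (simp_all add: set_cformula_subset_symbols)
    show "\<phi> = \<psi>"
    proof (rule cformula.inj_map_strong[OF _ eq])
      fix R R' assume "R \<in> set_cformula \<phi>" "R' \<in> set_cformula \<psi>"
        and "to_nat_on (symbols L) R = to_nat_on (symbols L) R'"
      then show "R = R'"
        using sub assms by (metis inj_onD inj_on_to_nat_on subsetD)
    qed
  qed
  then show ?thesis
    by (rule countableI') 
qed

context lipschitz_structures
begin

section \<open>Range and Lipschitz continuity of formulas\<close>

lemma formula_value_range:
  assumes "M \<in> \<S>" "is_formula L \<phi>"
  shows "0 \<le> formula_value M v \<phi> \<and> formula_value M v \<phi> \<le> 1"
  using assms(2)
proof (induction \<phi> arbitrary: v)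
  case (FRel R xs)
  then show ?case using structure_range[OF assms(1)] by simp
next
  case (FSup x \<phi>)
  then show ?case by (simp add: SUP_unit)
next
  case (FInf x \<phi>)
  then show ?case by (simp add: INF_unit)
next
  case (FHalf \<phi>)
  from FHalf.IH[of v] FHalf.prems show ?case by simp
next
  case (FMinus \<phi> \<psi>)
  from FMinus.IH(1)[of v] FMinus.IH(2)[of v] FMinus.prems show ?case by (simp add: dminus_def)
next
  case (FMin \<phi> \<psi>)
  from FMin.IH(1)[of v] FMin.IH(2)[of v] FMin.prems show ?case by (simp add: min_def)
next
  case (FMax \<phi> \<psi>)
  from FMax.IH(1)[of v] FMax.IH(2)[of v] FMax.prems show ?case by (simp add: max_def)
next
  case (FAbsDiff \<phi> \<psi>)
  from FAbsDiff.IH(1)[of v] FAbsDiff.IH(2)[of v] FAbsDiff.prems show ?case by (simp add: abs_if)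
next
  case (FPlus \<phi> \<psi>)
  from FPlus.IH(1)[of v] FPlus.IH(2)[of v] FPlus.prems show ?case by (simp add: dplus_def)
next
  case (FScale q \<phi>)
  from FScale.IH[of v] FScale.prems show ?case by (simp add: dscale_def)
qed (auto simp: diameter)

lemma formula_value_SUP_bdd:
  "M \<in> \<S> \<Longrightarrow> is_formula L \<phi> \<Longrightarrow> bdd_above (range (\<lambda>a. formula_value M (v(x := a)) \<phi>))"
  by (rule SUP_unit) (rule formula_value_range)

lemma formula_value_INF_bdd:
  "M \<in> \<S> \<Longrightarrow> is_formula L \<phi> \<Longrightarrow> bdd_below (range (\<lambda>a. formula_value M (v(x := a)) \<phi>))"
  by (rule INF_unit) (rule formula_value_range)

text \<open>One constant serves all structures and assignments. Comparing free variables only, and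
  allowing \<open>e = 0\<close>, makes the notion strong enough to contain the coincidence
  lemma.\<close>

definition formula_lipschitz :: "real \<Rightarrow> 'r cformula \<Rightarrow> bool"
  where "formula_lipschitz K \<phi> \<longleftrightarrow> (\<forall>M\<in>\<S>. \<forall>v w. \<forall>e\<ge>0.
     (\<forall>x\<in>free_vars \<phi>. dist (v x) (w x) \<le> e) \<longrightarrow>
     \<bar>formula_value M v \<phi> - formula_value M w \<phi>\<bar> \<le> K * e)"

lemma formula_lipschitzD:
  "formula_lipschitz K \<phi> \<Longrightarrow> M \<in> \<S> \<Longrightarrow> 0 \<le> e \<Longrightarrow> (\<And>x. x \<in> free_vars \<phi> \<Longrightarrow> dist (v x) (w x) \<le> e)
    \<Longrightarrow> \<bar>formula_value M v \<phi> - formula_value M w \<phi>\<bar> \<le> K * e"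
  by (simp add: formula_lipschitz_def)

text \<open>Every binary connective changes by at most the sum of the changes of its arguments, so
  constants add up.\<close>

lemma formula_lipschitz_binary:
  assumes "formula_lipschitz K \<phi>" "formula_lipschitz K' \<psi>"
    and "\<And>(M :: ('r, 'u) structure_on) v. formula_value M v \<theta> = \<omega> (formula_value M v \<phi>) (formula_value M v \<psi>)"
    and "free_vars \<theta> = free_vars \<phi> \<union> free_vars \<psi>"
    and \<omega>: "\<And>a b a' b'. \<bar>\<omega> a b - \<omega> a' b'\<bar> \<le> \<bar>a - a'\<bar> + \<bar>b - b'\<bar>"
  shows "formula_lipschitz (K + K') \<theta>"
  unfolding formula_lipschitz_def
proof (intro ballI allI impI)
  fix M and v w :: "nat \<Rightarrow> 'u" and e :: real
  assume *: "M \<in> \<S>" "0 \<le> e" "\<forall>x\<in>free_vars \<theta>. dist (v x) (w x) \<le> e"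
  show "\<bar>formula_value M v \<theta> - formula_value M w \<theta>\<bar> \<le> (K + K') * e"
    using formula_lipschitzD[OF assms(1) *(1,2), of v w] formula_lipschitzD[OF assms(2) *(1,2), of v w]
      \<omega>[of "formula_value M v \<phi>" "formula_value M v \<psi>" "formula_value M w \<phi>" "formula_value M w \<psi>"]
      *(3) assms(3,4)
    by (simp add: distrib_right)
qed

lemma formula_lipschitz_unary:
  assumes "formula_lipschitz K \<phi>"
    and "\<And>(M :: ('r, 'u) structure_on) v. formula_value M v \<theta> = \<omega> (formula_value M v \<phi>)"
    and "free_vars \<theta> = free_vars \<phi>"
    and \<omega>: "\<And>a a'. \<bar>\<omega> a - \<omega> a'\<bar> \<le> c * \<bar>a - a'\<bar>" and "0 \<le> c"
  shows "formula_lipschitz (c * K) \<theta>"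
  unfolding formula_lipschitz_def
proof (intro ballI allI impI)
  fix M and v w :: "nat \<Rightarrow> 'u" and e :: real
  assume *: "M \<in> \<S>" "0 \<le> e" "\<forall>x\<in>free_vars \<theta>. dist (v x) (w x) \<le> e"
  have "\<bar>formula_value M v \<theta> - formula_value M w \<theta>\<bar> \<le> c * \<bar>formula_value M v \<phi> - formula_value M w \<phi>\<bar>"
    unfolding assms(2) by (rule \<omega>)
  also have "\<dots> \<le> c * (K * e)"
    using formula_lipschitzD[OF assms(1) *(1,2), of v w] *(3) assms(3,5) by (intro mult_left_mono) auto
  finally show "\<bar>formula_value M v \<theta> - formula_value M w \<theta>\<bar> \<le> c * K * e"
    by simp
qed

lemma formula_lipschitz_quantifier:
  assumes "formula_lipschitz K \<phi>" "M \<in> \<S>" "0 \<le> e" "\<forall>y\<in>free_vars \<phi> - {x}. dist (v y) (w y) \<le> e"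
  shows "\<bar>formula_value M (v(x := a)) \<phi> - formula_value M (w(x := a)) \<phi>\<bar> \<le> K * e"
  using assms by (intro formula_lipschitzD) auto

text \<open>The bound on the moduli enters here, through the relational atoms. Quantifiers keep the
  constant, since the estimate for the matrix is uniform in the quantified point.\<close>

lemma ex_formula_lipschitz:
  "is_formula L \<phi> \<Longrightarrow> \<exists>K\<ge>0. formula_lipschitz K \<phi>"
proof (induction \<phi>)
  case (FDist x y)
  have "\<bar>dist (v x) (v y) - dist (w x) (w y)\<bar> \<le> dist (v x) (w x) + dist (v y) (w y)" for v w :: "nat \<Rightarrow> 'u"
    by metric
  then have "formula_lipschitz 2 (FDist x y)"
    unfolding formula_lipschitz_def by (smt (verit) formula_value.simps(1) free_vars.simps(1) insertCI)
  then show ?case by (intro exI[of _ 2]) simp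
next
  case (FRel R xs)
  have "formula_lipschitz (real (arity L R)) (FRel R xs)"
    unfolding formula_lipschitz_def
  proof (intro ballI allI impI)
    fix M and v w :: "nat \<Rightarrow> 'u" and e :: real
    assume *: "M \<in> \<S>" "0 \<le> e" "\<forall>x\<in>free_vars (FRel R xs :: 'r cformula). dist (v x) (w x) \<le> e"
    have "\<bar>M R (map v xs) - M R (map w xs)\<bar> \<le> real (arity L R) * tuple_dist (map v xs) (map w xs)"
      using *(1) by (intro structure_lipschitz) auto
    also have "\<dots> \<le> real (arity L R) * e"
      using * by (intro mult_left_mono) (auto simp: tuple_dist_map_le_iff)
    finally show "\<bar>formula_value M v (FRel R xs) - formula_value M w (FRel R xs)\<bar> \<le> real (arity L R) * e"
      by simp
  qed
  then show ?case by (intro exI[of _ "real (arity L R)"]) simp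
next
  case FZero
  show ?case by (intro exI[of _ 0]) (simp add: formula_lipschitz_def)
next
  case FOne
  show ?case by (intro exI[of _ 0]) (simp add: formula_lipschitz_def)
next
  case (FHalf \<phi>)
  then obtain K where K: "0 \<le> K" "formula_lipschitz K \<phi>" by auto
  have "formula_lipschitz (1 * K) (FHalf \<phi>)"
    by (rule formula_lipschitz_unary[OF K(2), of _ "\<lambda>a. a / 2"]) auto
  with K show ?case by auto
next
  case (FMinus \<phi> \<psi>)
  then obtain K K' where K: "0 \<le> K" "formula_lipschitz K \<phi>" "0 \<le> K'" "formula_lipschitz K' \<psi>" by auto
  have "formula_lipschitz (K + K') (FMinus \<phi> \<psi>)"
    by (rule formula_lipschitz_binary[OF K(2,4), of _ dminus]) (auto simp: dminus_def)
  with K show ?case by (intro exI[of _ "K + K'"]) auto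
next
  case (FMin \<phi> \<psi>)
  then obtain K K' where K: "0 \<le> K" "formula_lipschitz K \<phi>" "0 \<le> K'" "formula_lipschitz K' \<psi>" by auto
  have "formula_lipschitz (K + K') (FMin \<phi> \<psi>)"
    by (rule formula_lipschitz_binary[OF K(2,4), of _ min]) auto
  with K show ?case by (intro exI[of _ "K + K'"]) auto
next
  case (FMax \<phi> \<psi>)
  then obtain K K' where K: "0 \<le> K" "formula_lipschitz K \<phi>" "0 \<le> K'" "formula_lipschitz K' \<psi>" by auto
  have "formula_lipschitz (K + K') (FMax \<phi> \<psi>)"
    by (rule formula_lipschitz_binary[OF K(2,4), of _ max]) auto
  with K show ?case by (intro exI[of _ "K + K'"]) auto
next
  case (FAbsDiff \<phi> \<psi>)
  then obtain K K' where K: "0 \<le> K" "formula_lipschitz K \<phi>" "0 \<le> K'" "formula_lipschitz K' \<psi>" by auto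
  have "formula_lipschitz (K + K') (FAbsDiff \<phi> \<psi>)"
    by (rule formula_lipschitz_binary[OF K(2,4), of _ "\<lambda>a b. \<bar>a - b\<bar>"]) auto
  with K show ?case by (intro exI[of _ "K + K'"]) auto
next
  case (FCompl \<phi>)
  then obtain K where K: "0 \<le> K" "formula_lipschitz K \<phi>" by auto
  have "formula_lipschitz (1 * K) (FCompl \<phi>)"
    by (rule formula_lipschitz_unary[OF K(2), of _ "\<lambda>a. 1 - a"]) auto
  with K show ?case by auto
next
  case (FPlus \<phi> \<psi>)
  then obtain K K' where K: "0 \<le> K" "formula_lipschitz K \<phi>" "0 \<le> K'" "formula_lipschitz K' \<psi>" by auto
  have "formula_lipschitz (K + K') (FPlus \<phi> \<psi>)"
    by (rule formula_lipschitz_binary[OF K(2,4), of _ dplus]) (auto simp: dplus_def)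
  with K show ?case by (intro exI[of _ "K + K'"]) auto
next
  case (FScale q \<phi>)
  then obtain K where K: "0 \<le> K" "formula_lipschitz K \<phi>" and q: "0 \<le> q" by auto
  have "formula_lipschitz (of_rat q * K) (FScale q \<phi>)"
  proof (rule formula_lipschitz_unary[OF K(2), of _ "dscale q"])
    fix a a' :: real
    have "\<bar>dscale q a - dscale q a'\<bar> \<le> \<bar>of_rat q * a - of_rat q * a'\<bar>"
      by (auto simp: dscale_def)
    also have "\<dots> = of_rat q * \<bar>a - a'\<bar>"
      using q by (simp add: abs_mult flip: right_diff_distrib)
    finally show "\<bar>dscale q a - dscale q a'\<bar> \<le> of_rat q * \<bar>a - a'\<bar>" .
  qed (use q in auto)
  with K q show ?case by (intro exI[of _ "of_rat q * K"]) auto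
next
  case (FSup x \<phi>)
  then obtain K where K: "0 \<le> K" "formula_lipschitz K \<phi>" by auto
  have "formula_lipschitz K (FSup x \<phi>)"
    unfolding formula_lipschitz_def formula_value.simps free_vars.simps
    using FSup.prems K(2)
    by (intro ballI allI impI SUP_diff_le formula_value_SUP_bdd formula_lipschitz_quantifier) auto
  with K show ?case by auto
next
  case (FInf x \<phi>)
  then obtain K where K: "0 \<le> K" "formula_lipschitz K \<phi>" by auto
  have "formula_lipschitz K (FInf x \<phi>)"
    unfolding formula_lipschitz_def formula_value.simps free_vars.simps
    using FInf.prems K(2)
    by (intro ballI allI impI INF_diff_le formula_value_INF_bdd formula_lipschitz_quantifier) auto
  with K show ?case by auto
qed

text \<open>The case of distance 0 in the Lipschitz estimate.\<close>

lemma formula_value_cong: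
  assumes "M \<in> \<S>" "is_formula L \<phi>" "\<And>x. x \<in> free_vars \<phi> \<Longrightarrow> v x = w x"
  shows "formula_value M v \<phi> = formula_value M w \<phi>"
proof -
  obtain K where "formula_lipschitz K \<phi>"
    using ex_formula_lipschitz[OF assms(2)] by blast
  from formula_lipschitzD[OF this assms(1), of 0 v w] assms(3) show ?thesis
    by simp
qed

lemma continuous_on_formula_value:
  assumes "M \<in> \<S>" "is_formula L \<phi>"
  shows "continuous_on UNIV (\<lambda>a. formula_value M (v(x := a)) \<phi>)"
proof -
  obtain K where K: "0 \<le> K" "formula_lipschitz K \<phi>"
    using ex_formula_lipschitz[OF assms(2)] by blast
  have "K-lipschitz_on UNIV (\<lambda>a. formula_value M (v(x := a)) \<phi>)"
    using formula_lipschitzD[OF K(2) assms(1)] K(1) by (intro lipschitz_onI) (auto simp: dist_real_def)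
  then show ?thesis
    by (rule lipschitz_on_continuous_on)
qed

section \<open>Borel measurability and transport of formulas\<close>

abbreviation "borel_X \<equiv> sigma (topspace X) {U. openin X U}"

lemma space_borel_X: "space borel_X = \<S>"
  by (simp add: space_measure_of_conv)

lemma borel_measurable_eval: "(\<lambda>M. M R s) \<in> borel_measurable borel_X"
proof (rule borel_measurableI)
  fix S :: "real set" assume "open S"
  then have "openin X {M \<in> topspace X. M R s \<in> S}"
    by (intro openin_continuous_map_preimage[OF continuous_map_eval]) simp
  moreover have "{U. openin X U} \<subseteq> Pow (topspace X)"
    using openin_subset by blast
  ultimately have "{M \<in> topspace X. M R s \<in> S} \<in> sets borel_X"
    by (simp add: sets_measure_of)
  then show "(\<lambda>M. M R s) -` S \<inter> space borel_X \<in> sets borel_X"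
    unfolding space_borel_X by (simp add: vimage_def Int_def conj_commute)
qed

text \<open>Only the quantifiers are delicate: the value depends continuously on the quantified
  point, so the countable dense set \<open>Q\<close> may replace the whole space.\<close>

lemma borel_measurable_formula_value:
  "is_formula L \<phi> \<Longrightarrow> (\<lambda>M. formula_value M v \<phi>) \<in> borel_measurable borel_X"
proof (induction \<phi> arbitrary: v)
  case (FSup x \<phi>)
  have eq: "(SUP a. formula_value M (v(x := a)) \<phi>) = (SUP a\<in>Q. formula_value M (v(x := a)) \<phi>)"
    if "M \<in> space borel_X" for M
    using that FSup.prems unfolding space_borel_X
    by (intro SUP_dense[OF dense] continuous_on_formula_value formula_value_SUP_bdd) auto
  have "(\<lambda>M. SUP a\<in>Q. formula_value M (v(x := a)) \<phi>) \<in> borel_measurable borel_X"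
  proof (rule borel_measurable_cSUP[OF countable_Q])
    fix M assume "M \<in> space borel_X"
    then have "bdd_above (range (\<lambda>a. formula_value M (v(x := a)) \<phi>))"
      using FSup.prems by (intro formula_value_SUP_bdd) (simp_all only: space_borel_X is_formula.simps)
    then show "bdd_above ((\<lambda>a. formula_value M (v(x := a)) \<phi>) ` Q)"
      by (rule bdd_above_mono) auto
  qed (use FSup in auto)
  then show ?case
    unfolding formula_value.simps by (subst measurable_cong[OF eq])
next
  case (FInf x \<phi>)
  have eq: "(INF a. formula_value M (v(x := a)) \<phi>) = (INF a\<in>Q. formula_value M (v(x := a)) \<phi>)"
    if "M \<in> space borel_X" for M
    using that FInf.prems unfolding space_borel_X
    by (intro INF_dense[OF dense] continuous_on_formula_value formula_value_INF_bdd) auto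
  have "(\<lambda>M. INF a\<in>Q. formula_value M (v(x := a)) \<phi>) \<in> borel_measurable borel_X"
  proof (rule borel_measurable_cINF[OF countable_Q])
    fix M assume "M \<in> space borel_X"
    then have "bdd_below (range (\<lambda>a. formula_value M (v(x := a)) \<phi>))"
      using FInf.prems by (intro formula_value_INF_bdd) (simp_all only: space_borel_X is_formula.simps)
    then show "bdd_below ((\<lambda>a. formula_value M (v(x := a)) \<phi>) ` Q)"
      by (rule bdd_below_mono) auto
  qed (use FInf in auto)
  then show ?case
    unfolding formula_value.simps by (subst measurable_cong[OF eq])
qed (auto simp: dminus_def dplus_def dscale_def borel_measurable_eval simp del: topspace_structure_topology
    intro!: borel_measurable_max borel_measurable_min borel_measurable_add borel_measurable_diff
      borel_measurable_times borel_measurable_abs borel_measurable_divide)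

text \<open>Moves the group element from the structure to the parameters. Quantifiers are unaffected
  because \<open>?k\<close> is surjective: the same values are met in a different order.\<close>

lemma formula_value_transport:
  assumes g: "g \<in> carrier isom_group" and M: "M \<in> \<S>"
  shows "formula_value (transport L g M) v \<phi> = formula_value M (inv\<^bsub>isom_group\<^esub> g \<circ> v) \<phi>"
proof -
  let ?k = "inv\<^bsub>isom_group\<^esub> g"
  have upd: "?k \<circ> v(x := a) = (?k \<circ> v)(x := ?k a)" for v :: "nat \<Rightarrow> 'u" and x a
    by auto
  have range: "range (\<lambda>a. F (?k a)) = range F" for F :: "'u \<Rightarrow> real"
  proof -
    have "range ?k = UNIV"
      using inv_isom[OF g] by (simp add: mem_isom_group bij_is_surj)
    then show ?thesis
      by (metis image_image)
  qed
  show ?thesis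
  proof (induction \<phi> arbitrary: v)
    case (FDist x y)
    show ?case using isom_dist[OF inv_isom[OF g]] by simp
  next
    case (FSup x \<phi>)
    show ?case
      unfolding formula_value.simps FSup upd using range[of "\<lambda>a. formula_value M ((?k \<circ> v)(x := a)) \<phi>"] by simp
  next
    case (FInf x \<phi>)
    show ?case
      unfolding formula_value.simps FInf upd using range[of "\<lambda>a. formula_value M ((?k \<circ> v)(x := a)) \<phi>"] by simp
  qed (simp_all add: transport_apply[OF M])
qed

section \<open>The family of sentences: connectives, countability, topology\<close>

abbreviation "\<B> \<equiv> sentence_graded_subsets L Q"

lemma sentenceI:
  assumes "is_formula L \<phi>" "v ` free_vars \<phi> \<subseteq> Q" "\<And>M. M \<in> \<S> \<Longrightarrow> f M = formula_value M v \<phi>"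
  shows "(\<lambda>M\<in>\<S>. f M) \<in> \<B>"
proof -
  have "(\<lambda>M\<in>\<S>. f M) = (\<lambda>M\<in>\<S>. formula_value M v \<phi>)"
    using assms(3) by (rule restrict_ext)
  then show ?thesis
    using assms(1,2) unfolding sentence_graded_subsets_def by blast
qed

lemma sentenceE:
  assumes "f \<in> \<B>"
  obtains \<phi> v where "is_formula L \<phi>" "v ` free_vars \<phi> \<subseteq> Q" "f = (\<lambda>M\<in>\<S>. formula_value M v \<phi>)"
  using assms unfolding sentence_graded_subsets_def by blast

text \<open>Two sentences may use the same variable for different parameters. Moving one to even and
  the other to odd variables lets a single assignment serve both, after which connectives act on
  formulas alone.\<close>

lemma sentence_pairE:
  assumes "f \<in> \<B>" "g \<in> \<B>"
  obtains \<phi> \<psi> v where "is_formula L \<phi>" "is_formula L \<psi>" "v ` (free_vars \<phi> \<union> free_vars \<psi>) \<subseteq> Q"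
    "f = (\<lambda>M\<in>\<S>. formula_value M v \<phi>)" "g = (\<lambda>M\<in>\<S>. formula_value M v \<psi>)"
proof -
  obtain \<phi> v where 1: "is_formula L \<phi>" "v ` free_vars \<phi> \<subseteq> Q" "f = (\<lambda>M\<in>\<S>. formula_value M v \<phi>)"
    using assms(1) by (rule sentenceE)
  obtain \<psi> w where 2: "is_formula L \<psi>" "w ` free_vars \<psi> \<subseteq> Q" "g = (\<lambda>M\<in>\<S>. formula_value M w \<psi>)"
    using assms(2) by (rule sentenceE)
  define u where "u n = (if even n then v (n div 2) else w (n div 2))" for n
  have inj: "inj (\<lambda>n::nat. 2 * n)" "inj (\<lambda>n::nat. Suc (2 * n))"
    by (auto simp: inj_def)
  have u: "u \<circ> (\<lambda>n. 2 * n) = v" "u \<circ> (\<lambda>n. Suc (2 * n)) = w"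
    by (auto simp: u_def)
  show thesis
  proof (rule that[of "rename_vars (\<lambda>n. 2 * n) \<phi>" "rename_vars (\<lambda>n. Suc (2 * n)) \<psi>" u])
    show "u ` (free_vars (rename_vars (\<lambda>n. 2 * n) \<phi>) \<union> free_vars (rename_vars (\<lambda>n. Suc (2 * n)) \<psi>)) \<subseteq> Q"
      using 1 2 by (auto simp: free_vars_rename_vars[OF inj(1)] free_vars_rename_vars[OF inj(2)] u_def)
  qed (use 1 2 in \<open>simp_all add: is_formula_rename_vars formula_value_rename_vars[OF inj(1)]
      formula_value_rename_vars[OF inj(2)] u\<close>)
qed

lemma sentence_unary:
  assumes "f \<in> \<B>" and "\<And>\<phi>. is_formula L \<phi> \<Longrightarrow> is_formula L (c \<phi>)"
    and "\<And>\<phi>. free_vars (c \<phi>) = free_vars \<phi>"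
    and "\<And>(M :: ('r, 'u) structure_on) v \<phi>. formula_value M v (c \<phi>) = \<omega> (formula_value M v \<phi>)"
  shows "(\<lambda>M\<in>\<S>. \<omega> (f M)) \<in> \<B>"
proof -
  obtain \<phi> v where "is_formula L \<phi>" "v ` free_vars \<phi> \<subseteq> Q" "f = (\<lambda>M\<in>\<S>. formula_value M v \<phi>)"
    using assms(1) by (rule sentenceE)
  then show ?thesis
    using assms(2-4) by (intro sentenceI[of "c \<phi>" v]) auto
qed

lemma sentence_binary:
  assumes "f \<in> \<B>" "g \<in> \<B>"
    and "\<And>\<phi> \<psi>. is_formula L \<phi> \<Longrightarrow> is_formula L \<psi> \<Longrightarrow> is_formula L (c \<phi> \<psi>)"
    and "\<And>\<phi> \<psi>. free_vars (c \<phi> \<psi>) = free_vars \<phi> \<union> free_vars \<psi>"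
    and "\<And>(M :: ('r, 'u) structure_on) v \<phi> \<psi>. formula_value M v (c \<phi> \<psi>) = \<omega> (formula_value M v \<phi>) (formula_value M v \<psi>)"
  shows "(\<lambda>M\<in>\<S>. \<omega> (f M) (g M)) \<in> \<B>"
proof -
  obtain \<phi> \<psi> v where "is_formula L \<phi>" "is_formula L \<psi>" "v ` (free_vars \<phi> \<union> free_vars \<psi>) \<subseteq> Q"
    "f = (\<lambda>M\<in>\<S>. formula_value M v \<phi>)" "g = (\<lambda>M\<in>\<S>. formula_value M v \<psi>)"
    using assms(1,2) by (rule sentence_pairE)
  then show ?thesis
    using assms(3-5) by (intro sentenceI[of "c \<phi> \<psi>" v]) auto
qed

lemma sentence_range:
  assumes "f \<in> \<B>" "M \<in> \<S>"
  shows "0 \<le> f M \<and> f M \<le> 1"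
  using assms(1)
proof (rule sentenceE)
  fix \<phi> v assume "is_formula L \<phi>" "f = (\<lambda>M\<in>\<S>. formula_value M v \<phi>)"
  then show ?thesis
    using formula_value_range assms(2) by simp
qed

lemma sentence_graded:
  assumes "f \<in> \<B>"
  shows "f \<in> graded_subsets \<S>"
proof -
  have "f \<in> extensional \<S>"
    using assms by (rule sentenceE) simp
  then show ?thesis
    using sentence_range[OF assms] by (auto simp: graded_subsets_def PiE_iff)
qed

lemma sentence_borel:
  assumes "f \<in> \<B>"
  shows "borel_graded X f"
proof -
  obtain \<phi> v where \<phi>: "is_formula L \<phi>" "f = (\<lambda>M\<in>\<S>. formula_value M v \<phi>)"
    using assms by (rule sentenceE)
  have "f \<in> borel_measurable borel_X \<longleftrightarrow> (\<lambda>M. formula_value M v \<phi>) \<in> borel_measurable borel_X"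
    by (rule measurable_cong) (simp add: \<phi>(2) space_borel_X del: topspace_structure_topology)
  then show ?thesis
    unfolding borel_graded_def
    using sentence_graded[OF assms] borel_measurable_formula_value[OF \<phi>(1)] by simp
qed

lemma Q_nonempty: "Q \<noteq> {}"
  using dense by auto

lemma countable_sentences: "countable \<B>"
proof -
  let ?F = "{\<phi>. is_formula L \<phi>} \<times> lists Q"
  have "\<B> \<subseteq> (\<lambda>(\<phi>, xs). \<lambda>M\<in>\<S>. formula_value M (\<lambda>i. xs ! i) \<phi>) ` ?F"
  proof
    fix f assume "f \<in> \<B>"
    then obtain \<phi> v where \<phi>: "is_formula L \<phi>" "v ` free_vars \<phi> \<subseteq> Q" "f = (\<lambda>M\<in>\<S>. formula_value M v \<phi>)"
      by (rule sentenceE)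
    obtain q where q: "q \<in> Q" using Q_nonempty by blast
    obtain n where n: "\<And>x. x \<in> free_vars \<phi> \<Longrightarrow> x < n"
      using finite_nat_set_iff_bounded finite_free_vars by metis
    \<comment> \<open>An assignment is an infinite object; a finite list of parameters determines
      the value. Positions that are not free are filled with \<open>q\<close>, so that the whole
      list lies in \<open>Q\<close>.\<close>
    define xs where "xs = map (\<lambda>i. if i \<in> free_vars \<phi> then v i else q) [0..<n]"
    have "f = (\<lambda>M\<in>\<S>. formula_value M (\<lambda>i. xs ! i) \<phi>)"
      unfolding \<phi>(3) using \<phi>(1) n by (intro restrict_ext formula_value_cong) (auto simp: xs_def)
    moreover have "xs \<in> lists Q"
      using \<phi>(2) q by (auto simp: xs_def image_subset_iff)
    ultimately show "f \<in> (\<lambda>(\<phi>, xs). \<lambda>M\<in>\<S>. formula_value M (\<lambda>i. xs ! i) \<phi>) ` ?F"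
      using \<phi>(1) by (intro image_eqI[of _ _ "(\<phi>, xs)"]) auto
  qed
  moreover have "countable ?F"
    by (intro countable_SIGMA countable_formulas countable_symbols countable_lists countable_Q)
  ultimately show ?thesis
    by (meson countable_image countable_subset)
qed

lemma eval_sentence:
  assumes "(R, s) \<in> index_pairs L Q"
  shows "(\<lambda>M\<in>\<S>. M R s) \<in> \<B>"
proof (rule sentenceI[of "FRel R [0..<length s]" "\<lambda>i. s ! i"])
  show "M R s = formula_value M (\<lambda>i. s ! i) (FRel R [0..<length s])" for M
    by (simp add: map_nth)
qed (use assms in \<open>auto simp: index_pairs_def\<close>)

text \<open>The identity is continuous from the generated topology: atomic sentences make the sets
  where a coordinate is below a bound open, and their complements \<open>FCompl\<close> those where
  it is above.\<close>

lemma sentence_topology_finer: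
  assumes "openin X U"
  shows "openin (topology_generated_by {graded_lt (topspace X) \<phi> r | \<phi> r. \<phi> \<in> \<B>}) U"
proof -
  let ?Y = "topology_generated_by {graded_lt (topspace X) \<phi> r | \<phi> r. \<phi> \<in> \<B>}"
  have basic: "openin ?Y {M \<in> \<S>. f M < r}" if "f \<in> \<B>" for f r
    by (rule topology_generated_by_Basis) (use that in \<open>auto simp: graded_lt_def\<close>)
  \<comment> \<open>The sentence 0 puts every structure into the generated space, even when there
    are no index pairs.\<close>
  have "(\<lambda>M\<in>\<S>. 0) \<in> \<B>"
    by (rule sentenceI[of FZero]) simp_all
  from openin_subset[OF basic[OF this, of 1]] have "\<S> \<subseteq> topspace ?Y"
    by (simp add: subset_iff)
  moreover have "topspace ?Y \<subseteq> \<S>"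
    by (auto simp: topology_generated_by_topspace graded_lt_def)
  ultimately have top: "topspace ?Y = \<S>"
    by blast
  have "continuous_map ?Y X (\<lambda>M. M)"
  proof (rule continuous_map_into_structures)
    fix R s assume Rs: "(R, s) \<in> index_pairs L Q"
    have up: "openin ?Y {M \<in> \<S>. M R s < a}" for a
    proof -
      have "{M \<in> \<S>. M R s < a} = {M \<in> \<S>. (\<lambda>M\<in>\<S>. M R s) M < a}"
        by auto
      then show ?thesis
        using basic[OF eval_sentence[OF Rs], of a] by simp
    qed
    have lo: "openin ?Y {M \<in> \<S>. M R s > a}" for a
    proof -
      have "(\<lambda>M\<in>\<S>. 1 - (\<lambda>M\<in>\<S>. M R s) M) \<in> \<B>"
        by (rule sentence_unary[OF eval_sentence[OF Rs], of FCompl]) auto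
      from basic[OF this, of "1 - a"]
      have "openin ?Y {M \<in> \<S>. (\<lambda>M\<in>\<S>. 1 - (\<lambda>M\<in>\<S>. M R s) M) M < 1 - a}" .
      moreover have "{M \<in> \<S>. (\<lambda>M\<in>\<S>. 1 - (\<lambda>M\<in>\<S>. M R s) M) M < 1 - a} = {M \<in> \<S>. M R s > a}"
        by auto
      ultimately show ?thesis
        by simp
    qed
    show "continuous_map ?Y euclideanreal (\<lambda>M. M R s)"
      unfolding continuous_map_upper_lower_semicontinuous_lt top
      using up lo by blast
  qed (use top in blast)
  from openin_continuous_map_preimage[OF this assms]
  have "openin ?Y {M \<in> \<S>. M \<in> U}"
    unfolding top .
  moreover have "{M \<in> \<S>. M \<in> U} = U"
    using openin_subset[OF assms] by auto
  ultimately show ?thesis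
    by simp
qed

end

section \<open>Perturbing finite configurations in the Urysohn space\<close>

text \<open>Universality speaks of metrics on sets of reals, so the points of \<open>S\<close> are
  coded as natural numbers inside the reals. A finite metric space is compact, hence complete, and
  it is separable.\<close>

lemma urysohn_embed_finite_metric:
  fixes S :: "'a set"
  assumes U: "urysohn_space TYPE('u::polish_space)" and "finite S" and d: "Metric_space S d"
    and le: "\<And>x y. x \<in> S \<Longrightarrow> y \<in> S \<Longrightarrow> d x y \<le> 1"
  obtains f :: "'a \<Rightarrow> 'u::polish_space" where "\<And>x y. x \<in> S \<Longrightarrow> y \<in> S \<Longrightarrow> dist (f x) (f y) = d x y"
proof -
  interpret d: Metric_space S d by (rule d)
  define c where "c x = real (to_nat_on S x)" for x
  have inj: "inj_on c S"
    using inj_on_to_nat_on[OF countable_finite[OF \<open>finite S\<close>]] by (auto simp: c_def inj_on_def)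
  define i where "i = inv_into S c"
  have i: "i (c x) = x" if "x \<in> S" for x
    using inv_into_f_f[OF inj that] by (simp add: i_def)
  have "Metric_space (c ` S) (\<lambda>a b. d (i a) (i b))"
    by standard (auto simp: i d.commute intro: d.triangle dest: inj_onD[OF inj])
  then interpret c: Metric_space "c ` S" "\<lambda>a b. d (i a) (i b)" .
  let ?m = "metric (c ` S, \<lambda>a b. d (i a) (i b))"
  have "finite (c ` S)" using \<open>finite S\<close> by simp
  then have "compact_space c.mtopology"
    unfolding compact_space_def by (intro finite_imp_compactin) auto
  then have "mcomplete_of ?m"
    using c.compact_space_imp_mcomplete by (simp add: mcomplete_of_def)
  moreover have "separable_space (mtopology_of ?m)"
    unfolding separable_space_def
    using countable_finite[OF \<open>finite (c ` S)\<close>] closure_of_topspace[of c.mtopology]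
    by (intro exI[of _ "c ` S"]) simp
  moreover have "\<forall>x\<in>mspace ?m. \<forall>y\<in>mspace ?m. mdist ?m x y \<le> 1"
    using le i by auto
  ultimately have "\<exists>f :: real \<Rightarrow> 'u. \<forall>x\<in>mspace ?m. \<forall>y\<in>mspace ?m. dist (f x) (f y) = mdist ?m x y"
    using U unfolding urysohn_space_def by blast
  then obtain f :: "real \<Rightarrow> 'u" where "\<And>x y. x \<in> S \<Longrightarrow> y \<in> S \<Longrightarrow> dist (f (c x)) (f (c y)) = d x y"
    using i by auto
  then show thesis
    by (rule that[of "f \<circ> c", simplified])
qed

text \<open>The two configurations are amalgamated by putting \<open>u i\<close> at distance \<open>e\<close> from \<open>w i\<close>; inserting
  \<open>1\<close> both truncates the metric and covers the empty configuration.\<close>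

lemma amalgam_metric:
  fixes u w :: "nat \<Rightarrow> 'u::metric_space"
  assumes diam: "\<And>x y :: 'u. dist x y \<le> 1" and "e > 0"
    and close: "\<And>i j. i < m \<Longrightarrow> j < m \<Longrightarrow> \<bar>dist (u i) (u j) - dist (w i) (w j)\<bar> \<le> e"
  obtains d :: "'u + 'u \<Rightarrow> 'u + 'u \<Rightarrow> real"
  where "Metric_space UNIV d" "\<And>x y. d x y \<le> 1"
    "\<And>a b. d (Inl a) (Inl b) = dist a b" "\<And>a b. d (Inr a) (Inr b) = dist a b"
    "\<And>i. i < m \<Longrightarrow> d (Inr (u i)) (Inl (w i)) \<le> e"
proof -
  \<comment> \<open>The cross distance is the length of a shortest path that uses exactly one bridge
    of length \<open>e\<close>, truncated at 1.\<close>
  define c where "c a b = Min (insert 1 ((\<lambda>i. dist a (w i) + e + dist (u i) b) ` {..<m}))" for a b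
  have c1: "c a b \<le> 1" for a b
    by (simp add: c_def)
  have c_le: "c a b \<le> dist a (w i) + e + dist (u i) b" if "i < m" for a b i
    unfolding c_def using that by (intro Min_le) auto
  have c_cases: "c a b = 1 \<or> (\<exists>i<m. c a b = dist a (w i) + e + dist (u i) b)" for a b
  proof -
    have "c a b \<in> insert 1 ((\<lambda>i. dist a (w i) + e + dist (u i) b) ` {..<m})"
      unfolding c_def by (intro Min_in) auto
    then show ?thesis by auto
  qed
  \<comment> \<open>Positivity of \<open>e\<close> keeps the two copies disjoint, which makes
    \<open>d\<close> a metric and not just a pseudometric.\<close>
  have pos: "0 < c a b" for a b
    using c_cases[of a b] \<open>e > 0\<close> by (auto simp: add_nonneg_pos add_pos_nonneg)
  have tr1: "c a b \<le> dist a a' + c a' b" for a a' b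
  proof -
    consider "c a' b = 1" | i where "i < m" "c a' b = dist a' (w i) + e + dist (u i) b"
      using c_cases[of a' b] by blast
    then show ?thesis
    proof cases
      case 1
      then show ?thesis using c1[of a b] by (simp add: add_increasing)
    next
      case (2 i)
      then show ?thesis using c_le[OF 2(1), of a b] dist_triangle[of a "w i" a'] by linarith
    qed
  qed
  have tr2: "c a b \<le> c a b' + dist b' b" for a b b'
  proof -
    consider "c a b' = 1" | i where "i < m" "c a b' = dist a (w i) + e + dist (u i) b'"
      using c_cases[of a b'] by blast
    then show ?thesis
    proof cases
      case 1
      then show ?thesis using c1[of a b] by (simp add: add_increasing2)
    next
      case (2 i)
      then show ?thesis using c_le[OF 2(1), of a b] dist_triangle[of "u i" b b'] by linarith
    qed
  qed
  \<comment> \<open>Going across and back uses two bridges, so the right side contains 2e, which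
    absorbs the distortion, at most \<open>e\<close>, between the configurations. If a cross
    distance is truncated to 1, the diameter bound suffices.\<close>
  have tr3: "dist a a' \<le> c a b + c a' b \<and> dist b b' \<le> c a b + c a b'" for a a' b b'
  proof
    show "dist a a' \<le> c a b + c a' b"
    proof -
      consider "c a b = 1" | "c a' b = 1" | i j where "i < m" "c a b = dist a (w i) + e + dist (u i) b"
          "j < m" "c a' b = dist a' (w j) + e + dist (u j) b"
        using c_cases[of a b] c_cases[of a' b] by blast
      then show ?thesis
      proof cases
        case 1
        then show ?thesis using diam[of a a'] pos[of a' b] by linarith
      next
        case 2
        then show ?thesis using diam[of a a'] pos[of a b] by linarith
      next
        case (3 i j)
        have "dist a a' \<le> dist a (w i) + dist (w i) (w j) + dist a' (w j)" by metric
        moreover have "dist (u i) (u j) \<le> dist (u i) b + dist (u j) b" by metric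
        ultimately show ?thesis using 3 close[of i j] \<open>e > 0\<close> by linarith
      qed
    qed
    show "dist b b' \<le> c a b + c a b'"
    proof -
      consider "c a b = 1" | "c a b' = 1" | i j where "i < m" "c a b = dist a (w i) + e + dist (u i) b"
          "j < m" "c a b' = dist a (w j) + e + dist (u j) b'"
        using c_cases[of a b] c_cases[of a b'] by blast
      then show ?thesis
      proof cases
        case 1
        then show ?thesis using diam[of b b'] pos[of a b'] by linarith
      next
        case 2
        then show ?thesis using diam[of b b'] pos[of a b] by linarith
      next
        case (3 i j)
        have "dist b b' \<le> dist (u i) b + dist (u i) (u j) + dist (u j) b'" by metric
        moreover have "dist (w i) (w j) \<le> dist a (w i) + dist a (w j)" by metric
        ultimately show ?thesis using 3 close[of i j] \<open>e > 0\<close> by linarith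
      qed
    qed
  qed
  have tr1': "c a b \<le> c a' b + dist a' a" for a a' b
    using tr1[of a b a'] by (simp add: dist_commute)
  have tr2': "c a b \<le> dist b b' + c a b'" for a b b'
    using tr2[of a b b'] by (simp add: dist_commute)
  define d where "d x y = (case x of Inl a \<Rightarrow> (case y of Inl a' \<Rightarrow> dist a a' | Inr b \<Rightarrow> c a b)
    | Inr b \<Rightarrow> (case y of Inl a \<Rightarrow> c a b | Inr b' \<Rightarrow> dist b b'))" for x y
  have "Metric_space UNIV d"
  proof
    fix x y z
    show "0 \<le> d x y"
      using pos by (auto simp: d_def less_imp_le split: sum.split)
    show "d x y = d y x"
      by (auto simp: d_def dist_commute split: sum.split)
    have "c a b \<noteq> 0" for a b using pos[of a b] by simp
    then show "d x y = 0 \<longleftrightarrow> x = y"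
      by (auto simp: d_def split: sum.split)
    show "d x z \<le> d x y + d y z"
      using tr1 tr2 tr3 tr1' tr2'
      by (cases x; cases y; cases z) (simp_all add: d_def dist_triangle)
  qed
  moreover have "d (Inr (u i)) (Inl (w i)) \<le> e" if "i < m" for i
    using c_le[OF that, of "w i" "u i"] by (simp add: d_def)
  moreover have "d x y \<le> 1" for x y
    using diam c1 by (auto simp: d_def split: sum.split)
  ultimately show thesis
    by (intro that[of d]) (simp_all add: d_def)
qed

text \<open>Universality realises the amalgam somewhere in the space, and homogeneity moves this
  copy into place, so that its \<open>u\<close>-part becomes \<open>u\<close> itself and its
  \<open>w\<close>-part lands within \<open>e\<close> of it.\<close>

lemma urysohn_perturbation:
  fixes u w :: "nat \<Rightarrow> 'u::polish_space"
  assumes U: "urysohn_space TYPE('u)" and "e > 0"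
    and close: "\<And>i j. i < m \<Longrightarrow> j < m \<Longrightarrow> \<bar>dist (u i) (u j) - dist (w i) (w j)\<bar> \<le> e"
  obtains k where "k \<in> carrier isom_group" "\<And>i. i < m \<Longrightarrow> dist (u i) (k (w i)) \<le> e"
proof -
  have diam: "dist x y \<le> 1" for x y :: 'u
    using U by (simp add: urysohn_space_def)
  have homogeneous: "\<exists>g\<in>carrier isom_group. \<forall>x\<in>A. g x = f x" if "finite A" "isometric_on A f"
    for A and f :: "'u \<Rightarrow> 'u"
    using U that by (simp add: urysohn_space_def)
  obtain d :: "'u + 'u \<Rightarrow> 'u + 'u \<Rightarrow> real" where d: "Metric_space UNIV d" "\<And>x y. d x y \<le> 1"
    "\<And>a b. d (Inl a) (Inl b) = dist a b" "\<And>a b. d (Inr a) (Inr b) = dist a b"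
    "\<And>i. i < m \<Longrightarrow> d (Inr (u i)) (Inl (w i)) \<le> e"
    by (rule amalgam_metric[where u = u and w = w and e = e and m = m]) (use diam \<open>e > 0\<close> close in auto)
  define A where "A = w ` {..<m}"
  define B where "B = u ` {..<m}"
  let ?S = "Inl ` A \<union> Inr ` B"
  have fin: "finite A" "finite B"
    by (simp_all add: A_def B_def)
  then have finS: "finite ?S"
    by simp
  have ms: "Metric_space ?S d"
    by (rule Metric_space.subspace[OF d(1)]) simp
  obtain f :: "'u + 'u \<Rightarrow> 'u"
    where f: "\<And>x y. x \<in> ?S \<Longrightarrow> y \<in> ?S \<Longrightarrow> dist (f x) (f y) = d x y"
    using urysohn_embed_finite_metric[OF U finS ms d(2)] by blast
  define \<beta> where "\<beta> b = f (Inr b)" for b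
  have \<beta>: "dist (\<beta> b) (\<beta> b') = dist b b'" if "b \<in> B" "b' \<in> B" for b b'
    using f that d(4) by (simp add: \<beta>_def)
  then have "inj_on \<beta> B"
    by (metis dist_eq_0_iff inj_onI)
  then have inv: "inv_into B \<beta> (\<beta> b) = b" if "b \<in> B" for b
    using that by simp
  obtain g where g: "g \<in> carrier isom_group" "\<And>b. b \<in> B \<Longrightarrow> g (\<beta> b) = b"
  proof -
    have "isometric_on (\<beta> ` B) (inv_into B \<beta>)"
      unfolding isometric_on_def using inv \<beta> by auto
    then show thesis
      using homogeneous[of "\<beta> ` B"] fin inv that by (metis finite_imageI imageI)
  qed
  \<comment> \<open>The relocated copy of \<open>A\<close> is isometric to \<open>A\<close>; a
    second use of homogeneity extends this finite map to all of the space.\<close>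
  have "isometric_on A (\<lambda>a. g (f (Inl a)))"
    unfolding isometric_on_def using isom_dist[OF g(1)] f d(3) by simp
  then obtain k where k: "k \<in> carrier isom_group" "\<And>a. a \<in> A \<Longrightarrow> k a = g (f (Inl a))"
    using homogeneous fin by blast
  have "dist (u i) (k (w i)) \<le> e" if "i < m" for i
  proof -
    have "u i \<in> B" "w i \<in> A" using that by (auto simp: A_def B_def)
    then have "dist (u i) (k (w i)) = dist (g (\<beta> (u i))) (g (f (Inl (w i))))"
      using g k by simp
    also have "\<dots> = d (Inr (u i)) (Inl (w i))"
      using f \<open>u i \<in> B\<close> \<open>w i \<in> A\<close> isom_dist[OF g(1)] by (simp add: \<beta>_def)
    finally show ?thesis using d(5)[OF that] by simp
  qed
  with k(1) show thesis by (rule that)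
qed

section \<open>Vaught transforms over completely metrizable groups\<close>

text \<open>An open subspace of a completely metrizable space is again completely metrizable, so by
  Baire its nonempty open subsets are not meagre.\<close>

lemma meagre_in_openin_iff:
  assumes T: "completely_metrizable_space T" and A: "openin T A" and B: "openin T B"
  shows "meagre_in T B A \<longleftrightarrow> A \<inter> B = {}"
proof
  assume "A \<inter> B = {}"
  then show "meagre_in T B A"
    by (auto simp: meagre_in_def meagre_space_def intro!: exI[of _ "{}"])
next
  let ?Y = "subtopology T B"
  assume "meagre_in T B A"
  then obtain \<F> where \<F>: "countable \<F>" "\<And>S. S \<in> \<F> \<Longrightarrow> nowhere_dense_in ?Y S" "A \<inter> B \<subseteq> \<Union>\<F>"
    unfolding meagre_in_def meagre_space_def by blast
  let ?\<G> = "(\<lambda>S. ?Y closure_of S) ` \<F>"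
  have "?Y interior_of \<Union>?\<G> = {}"
  proof (rule Baire_category_alt)
    show "completely_metrizable_space ?Y \<or> locally_compact_space ?Y \<and> regular_space ?Y"
      using completely_metrizable_space_openin[OF T B] ..
    show "countable ?\<G>"
      using \<F>(1) by (rule countable_image)
    show "closedin ?Y S \<and> ?Y interior_of S = {}" if "S \<in> ?\<G>" for S
      using that \<F>(2) unfolding nowhere_dense_in_def by auto
  qed
  moreover have "A \<inter> B \<subseteq> \<Union>?\<G>"
  proof
    fix x assume "x \<in> A \<inter> B"
    then obtain S where S: "S \<in> \<F>" "x \<in> S" using \<F>(3) by blast
    then have "x \<in> ?Y closure_of S"
      using closure_of_subset[of S ?Y] \<F>(2)[OF S(1)] by (auto simp: nowhere_dense_in_def)
    with S show "x \<in> \<Union>?\<G>" by blast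
  qed
  moreover have "openin ?Y (A \<inter> B)"
    using A by (auto simp: openin_subtopology)
  ultimately show "A \<inter> B = {}"
    using interior_of_maximal[of "A \<inter> B" "\<Union>?\<G>" ?Y] by blast
qed

text \<open>All sets involved are open, so nonmeagreness of a pair (r, s) means that one
  \<open>h\<close> satisfies both strict bounds. Minimising over the pairs for fixed
  \<open>h\<close> then gives the truncated sum of its two values.\<close>

lemma vaught_delta_eq_INF:
  assumes T: "completely_metrizable_space T" and ne: "topspace T \<noteq> {}"
    and J: "open_graded T J" and x: "x \<in> topspace X"
    and op: "\<And>r. openin T {h \<in> topspace T. \<phi> (act h x) < r}"
    and range: "\<And>h. h \<in> topspace T \<Longrightarrow> 0 \<le> \<phi> (act h x)"
  shows "vaught_delta T X act J \<phi> x = (INF h\<in>topspace T. dplus (\<phi> (act h x)) (J h))"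
proof -
  let ?f = "\<lambda>h. \<phi> (act h x)"
  have J_range: "0 \<le> J h" if "h \<in> topspace T" for h
    using J that by (auto simp: open_graded_def graded_subsets_def)
  have nonneg: "0 \<le> dplus (?f h) (J h)" if "h \<in> topspace T" for h
    using range[OF that] J_range[OF that] by (simp add: dplus_def)
  define S where "S = {dplus r s | r s. r \<in> {0..1} \<and> s \<in> {0..1} \<and> (\<exists>h\<in>topspace T. ?f h < r \<and> J h < s)}"
  have meagre: "\<not> meagre_in T (graded_lt (topspace T) J s) {h \<in> topspace T. ?f h < r}
      \<longleftrightarrow> (\<exists>h\<in>topspace T. ?f h < r \<and> J h < s)" for r s
  proof -
    have "openin T (graded_lt (topspace T) J s)"
      using J by (simp add: open_graded_def)
    from meagre_in_openin_iff[OF T op this] show ?thesis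
      by (auto simp: graded_lt_def)
  qed
  have delta: "vaught_delta T X act J \<phi> x = Inf (insert 1 S)"
    using x by (simp add: vaught_delta_def meagre S_def)
  have bdd: "bdd_below (insert 1 S)"
    by (rule bdd_belowI[of _ 0]) (auto simp: S_def dplus_def)
  have bddI: "bdd_below ((\<lambda>h. dplus (?f h) (J h)) ` topspace T)"
    using nonneg by (intro bdd_belowI[of _ 0]) auto
  show ?thesis
    unfolding delta
  proof (rule antisym)
    show "Inf (insert 1 S) \<le> (INF h\<in>topspace T. dplus (?f h) (J h))"
    proof (rule cINF_greatest[OF ne])
      fix h assume h: "h \<in> topspace T"
      show "Inf (insert 1 S) \<le> dplus (?f h) (J h)"
      proof (cases "?f h + J h < 1")
        case True
        have "Inf (insert 1 S) \<le> ?f h + J h + e" if "e > 0" for e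
        proof -
          \<comment> \<open>Both values are below 1 in this case, hence have strict upper bounds
            within [0,1].\<close>
          let ?r = "min (?f h + e / 2) 1" and ?s = "min (J h + e / 2) 1"
          have "dplus ?r ?s \<in> S"
            unfolding S_def using h range[OF h] J_range[OF h] True that
            by (intro CollectI exI[of _ ?r] exI[of _ ?s] conjI bexI[of _ h]) auto
          then have "Inf (insert 1 S) \<le> dplus ?r ?s"
            by (intro cInf_lower bdd) simp
          also have "\<dots> \<le> ?f h + J h + e"
            unfolding dplus_def by linarith
          finally show ?thesis .
        qed
        then have "Inf (insert 1 S) \<le> ?f h + J h"
          by (rule field_le_epsilon)
        then show ?thesis
          using True by (simp add: dplus_def)
      next
        \<comment> \<open>A value equal to 1 has no strict upper bound in [0,1]; here the truncated
          sum is 1 and the inserted \<open>1\<close> takes over.\<close>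
        case False
        then have "dplus (?f h) (J h) = 1" by (simp add: dplus_def)
        then show ?thesis
          using cInf_lower[OF _ bdd, of 1] by simp
      qed
    qed
    show "(INF h\<in>topspace T. dplus (?f h) (J h)) \<le> Inf (insert 1 S)"
    proof (rule cInf_greatest)
      fix t assume "t \<in> insert 1 S"
      then consider "t = 1" | r s h where "t = dplus r s" "h \<in> topspace T" "?f h < r" "J h < s"
        unfolding S_def by blast
      then show "(INF h\<in>topspace T. dplus (?f h) (J h)) \<le> t"
      proof cases
        case 1
        obtain h where "h \<in> topspace T" using ne by blast
        from cINF_lower[OF bddI this] show ?thesis
          using 1 by (simp add: dplus_def)
      next
        case 2
        have "(INF h\<in>topspace T. dplus (?f h) (J h)) \<le> dplus (?f h) (J h)"
          by (rule cINF_lower[OF bddI 2(2)])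
        also have "\<dots> \<le> t"
          using 2 by (auto simp: dplus_def min_def)
        finally show ?thesis .
      qed
    qed simp
  qed
qed

lemma Sup_eq_one_minus_Inf:
  fixes A :: "real set"
  assumes "A \<noteq> {}" "bdd_above A"
  shows "Sup A = 1 - Inf ((\<lambda>t. 1 - t) ` A)"
proof -
  obtain b where b: "\<And>t. t \<in> A \<Longrightarrow> t \<le> b"
    using assms(2) by (auto simp: bdd_above_def)
  have bdd: "bdd_below ((\<lambda>t. 1 - t) ` A)"
    using b by (intro bdd_belowI[of _ "1 - b"]) auto
  have "Sup A \<le> 1 - Inf ((\<lambda>t. 1 - t) ` A)"
    using cINF_lower[OF bdd] by (intro cSup_least assms) (fastforce simp: algebra_simps)
  moreover have "1 - Sup A \<le> Inf ((\<lambda>t. 1 - t) ` A)"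
    using cSup_upper[OF _ assms(2)] by (intro cINF_greatest assms) simp
  ultimately show ?thesis by linarith
qed

text \<open>The bound \<phi> \<le> r fails exactly where 1 - \<phi> < 1 - r, and 1 minus the
  truncated difference of r and s is the truncated sum of 1 - r and s. The inserted values 0 and 1
  correspond as well.\<close>

lemma vaught_star_eq_delta:
  assumes J: "open_graded T J"
    and act: "\<And>h x. h \<in> topspace T \<Longrightarrow> x \<in> topspace X \<Longrightarrow> act h x \<in> topspace X"
  shows "vaught_star T X act J \<phi>
    = (\<lambda>x\<in>topspace X. 1 - vaught_delta T X act J (\<lambda>x\<in>topspace X. 1 - \<phi> x) x)"
proof (rule restrict_ext[of "topspace X", THEN trans[rotated], rotated])
  let ?S = "\<lambda>x. {dminus r s | r s. r \<in> {0..1} \<and> s \<in> {0..1} \<and>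
       \<not> comeagre_in T (graded_lt (topspace T) J s) {h \<in> topspace T. \<phi> (act h x) \<le> r}}"
  show "vaught_star T X act J \<phi> = (\<lambda>x\<in>topspace X. Sup (insert 0 (?S x)))"
    by (simp add: vaught_star_def)
  fix x assume x: "x \<in> topspace X"
  let ?D = "{dplus r s | r s. r \<in> {0..1} \<and> s \<in> {0..1} \<and>
       \<not> meagre_in T (graded_lt (topspace T) J s)
         {h \<in> topspace T. (\<lambda>x\<in>topspace X. 1 - \<phi> x) (act h x) < r}}"
  have iff: "comeagre_in T (graded_lt (topspace T) J s) {h \<in> topspace T. \<phi> (act h x) \<le> r} \<longleftrightarrow>
      meagre_in T (graded_lt (topspace T) J s)
        {h \<in> topspace T. (\<lambda>x\<in>topspace X. 1 - \<phi> x) (act h x) < 1 - r}" for r s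
  proof -
    have "graded_lt (topspace T) J s - {h \<in> topspace T. \<phi> (act h x) \<le> r}
      = {h \<in> topspace T. (\<lambda>x\<in>topspace X. 1 - \<phi> x) (act h x) < 1 - r} \<inter> graded_lt (topspace T) J s"
      using act[OF _ x] by (auto simp: graded_lt_def)
    then show ?thesis
      by (simp add: comeagre_in_def meagre_in_def)
  qed
  have dm: "1 - dminus r s = dplus (1 - r) s" for r s
    by (simp add: dminus_def dplus_def max_def min_def)
  have "?D = (\<lambda>t. 1 - t) ` ?S x"
  proof (intro equalityI subsetI)
    fix t assume "t \<in> ?D"
    then obtain r s where rs: "t = dplus r s" "r \<in> {0..1}" "s \<in> {0..1}"
      "\<not> meagre_in T (graded_lt (topspace T) J s)
         {h \<in> topspace T. (\<lambda>x\<in>topspace X. 1 - \<phi> x) (act h x) < r}"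
      by blast
    have "dminus (1 - r) s \<in> ?S x"
      using rs iff[of s "1 - r"] by (intro CollectI exI[of _ "1 - r"] exI[of _ s]) auto
    moreover have "t = 1 - dminus (1 - r) s"
      by (simp add: dm rs)
    ultimately show "t \<in> (\<lambda>t. 1 - t) ` ?S x" by blast
  next
    fix t assume "t \<in> (\<lambda>t. 1 - t) ` ?S x"
    then obtain r s where rs: "t = 1 - dminus r s" "r \<in> {0..1}" "s \<in> {0..1}"
      "\<not> comeagre_in T (graded_lt (topspace T) J s) {h \<in> topspace T. \<phi> (act h x) \<le> r}"
      by blast
    then show "t \<in> ?D"
      using iff[of s r] dm by (intro CollectI exI[of _ "1 - r"] exI[of _ s]) auto
  qed
  then have "insert 1 ?D = (\<lambda>t. 1 - t) ` insert 0 (?S x)"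
    by simp
  moreover have "bdd_above (insert 0 (?S x))"
    by (rule bdd_aboveI[of _ 1]) (auto simp: dminus_def)
  ultimately show "Sup (insert 0 (?S x)) = 1 - vaught_delta T X act J (\<lambda>x\<in>topspace X. 1 - \<phi> x) x"
    using x by (simp add: Sup_eq_one_minus_Inf vaught_delta_def)
qed

section \<open>Graded cosets as lists of penalties\<close>

lemma foldr_max_le_iff:
  "0 \<le> (e::real) \<Longrightarrow> foldr max xs 0 \<le> e \<longleftrightarrow> (\<forall>x\<in>set xs. x \<le> e)"
  by (induction xs) auto

lemma foldr_max_nonneg: "0 \<le> foldr max xs (0::real)"
  by (induction xs) auto

text \<open>Identifies two maxima that are formed over different index sets by comparing their upper
  bounds.\<close>

lemma nonneg_eq_iff_le:
  fixes x y :: real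
  assumes "0 \<le> x" "0 \<le> y" "\<And>e. 0 \<le> e \<Longrightarrow> x \<le> e \<longleftrightarrow> y \<le> e"
  shows "x = y"
  using assms(3)[of x] assms(3)[of y] assms(1,2) by simp

text \<open>A flat list of scaled points is the shape that a formula can express, position by
  position; each entry is truncated separately.\<close>

definition coset_penalty :: "(rat \<times> 'u::metric_space) list \<Rightarrow> ('u \<Rightarrow> 'u) \<Rightarrow> ('u \<Rightarrow> 'u) \<Rightarrow> real"
  where "coset_penalty P g\<^sub>0 h
    = foldr max (map (\<lambda>(q, a). dscale q (dist (h ((inv\<^bsub>isom_group\<^esub> g\<^sub>0) a)) a)) P) 0"

lemma basic_graded_subgroup_le_iff:
  assumes "g \<in> carrier isom_group" "q > 0" "0 \<le> e"
  shows "basic_graded_subgroup q s g \<le> e \<longleftrightarrow> (\<forall>a\<in>set s. dscale q (dist (g a) a) \<le> e)"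
proof -
  have q: "real_of_rat q > 0" using \<open>q > 0\<close> by simp
  have iff: "real_of_rat q * t \<le> e \<longleftrightarrow> t \<le> e / real_of_rat q" for t
    using q by (simp add: field_simps)
  have "tuple_dist (map g s) s \<le> e / real_of_rat q \<longleftrightarrow> (\<forall>a\<in>set s. dist (g a) a \<le> e / real_of_rat q)"
    using tuple_dist_map_le_iff[of "e / real_of_rat q" g s "\<lambda>x. x"] q \<open>0 \<le> e\<close> by simp
  then show ?thesis
    using assms(1,3) by (auto simp: basic_graded_subgroup_def dscale_def min_le_iff_disj iff)
qed

lemma basic_graded_subgroup_nonneg:
  "g \<in> carrier isom_group \<Longrightarrow> q > 0 \<Longrightarrow> 0 \<le> basic_graded_subgroup q s g"
  by (simp add: basic_graded_subgroup_def tuple_dist_nonneg)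

text \<open>Truncation at 1 commutes with the maxima over the family and over each tuple, so all
  entries fit into one list.\<close>

lemma graded_coset_eq_penalty:
  assumes "\<rho> \<in> urysohn_graded_cosets Q G\<^sub>0" "G\<^sub>0 \<subseteq> carrier isom_group"
  obtains g\<^sub>0 P where "g\<^sub>0 \<in> G\<^sub>0" "\<And>q a. (q, a) \<in> set P \<Longrightarrow> q > 0 \<and> a \<in> Q"
    "\<rho> = (\<lambda>h\<in>carrier isom_group. coset_penalty P g\<^sub>0 h)"
proof -
  obtain F g\<^sub>0 where F: "finite F" "F \<noteq> {}" "F \<subseteq> basic_graded_subgroups Q" and g\<^sub>0: "g\<^sub>0 \<in> G\<^sub>0"
    and \<rho>: "\<rho> = graded_coset isom_group (\<lambda>g\<in>carrier isom_group. Max ((\<lambda>H. H g) ` F)) g\<^sub>0"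
    using assms(1) unfolding urysohn_graded_cosets_def max_graded_subgroups_def by blast
  have "\<forall>H\<in>F. \<exists>q s. H = basic_graded_subgroup q s \<and> q > 0 \<and> set s \<subseteq> Q"
    using F(3) unfolding basic_graded_subgroups_def by blast
  then obtain q s where qs: "\<And>H. H \<in> F \<Longrightarrow> H = basic_graded_subgroup (q H) (s H) \<and> q H > 0 \<and> set (s H) \<subseteq> Q"
    by metis
  obtain Hs where Hs: "set Hs = F"
    using finite_list[OF F(1)] by blast
  define P where "P = concat (map (\<lambda>H. map (\<lambda>a. (q H, a)) (s H)) Hs)"
  have P: "set P = (\<Union>H\<in>F. Pair (q H) ` set (s H))"
    by (auto simp: P_def Hs)
  have "\<rho> h = coset_penalty P g\<^sub>0 h" if h: "h \<in> carrier isom_group" for h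
  proof -
    let ?g = "h \<circ> inv\<^bsub>isom_group\<^esub> g\<^sub>0"
    have g: "?g \<in> carrier isom_group"
      using h g\<^sub>0 assms(2) by (intro comp_isom inv_isom) auto
    have \<rho>h: "\<rho> h = Max ((\<lambda>H. H ?g) ` F)"
      using h g by (simp add: \<rho> graded_coset_def)
    have le: "\<rho> h \<le> e \<longleftrightarrow> coset_penalty P g\<^sub>0 h \<le> e" if "0 \<le> e" for e
    proof -
      have "\<rho> h \<le> e \<longleftrightarrow> (\<forall>H\<in>F. H ?g \<le> e)"
        using F by (simp add: \<rho>h)
      also have "\<dots> \<longleftrightarrow> (\<forall>H\<in>F. \<forall>a\<in>set (s H). dscale (q H) (dist (?g a) a) \<le> e)"
        using qs basic_graded_subgroup_le_iff[OF g _ that] by (intro ball_cong refl) metis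
      also have "\<dots> \<longleftrightarrow> coset_penalty P g\<^sub>0 h \<le> e"
        unfolding coset_penalty_def foldr_max_le_iff[OF that] by (auto simp: P)
      finally show ?thesis .
    qed
    obtain H where H: "H \<in> F" using F by blast
    have "0 \<le> H ?g"
      using qs[OF H] basic_graded_subgroup_nonneg[OF g] by metis
    also have "\<dots> \<le> \<rho> h"
      unfolding \<rho>h using F(1) H by (intro Max_ge) auto
    finally show ?thesis
      using le by (intro nonneg_eq_iff_le) (auto simp: coset_penalty_def foldr_max_nonneg)
  qed
  then have "\<rho> = (\<lambda>h\<in>carrier isom_group. coset_penalty P g\<^sub>0 h)"
    by (intro extensionalityI[of _ "carrier isom_group"]) (auto simp: \<rho> graded_coset_def)
  moreover have "q' > 0 \<and> a \<in> Q" if "(q', a) \<in> set P" for q' a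
    using that qs by (auto simp: P)
  ultimately show thesis
    using that[OF g\<^sub>0] by blast
qed

lemma tendsto_coset_penalty:
  assumes "limitin isom_topology f l F"
  shows "((\<lambda>a. coset_penalty P g\<^sub>0 (f a)) \<longlongrightarrow> coset_penalty P g\<^sub>0 l) F"
proof (induction P)
  case Nil
  show ?case by (simp add: coset_penalty_def)
next
  case (Cons p P)
  have "((\<lambda>a. f a x) \<longlongrightarrow> l x) F" for x
    using assms by (simp add: limitin_isom_topology)
  then have "((\<lambda>a. dscale (fst p) (dist (f a ((inv\<^bsub>isom_group\<^esub> g\<^sub>0) (snd p))) (snd p)))
      \<longlongrightarrow> dscale (fst p) (dist (l ((inv\<^bsub>isom_group\<^esub> g\<^sub>0) (snd p))) (snd p))) F"
    unfolding dscale_def by (intro tendsto_min tendsto_mult tendsto_const tendsto_dist)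
  from tendsto_max[OF this Cons] show ?case
    by (simp add: coset_penalty_def case_prod_unfold)
qed

lemma openin_isom_topology_less:
  fixes f :: "('u::metric_space \<Rightarrow> 'u) \<Rightarrow> real"
  assumes "\<And>g. g \<in> carrier isom_group \<Longrightarrow> limitin isom_topology (\<lambda>h. h) g (atin isom_topology g)
    \<Longrightarrow> (f \<longlongrightarrow> f g) (atin isom_topology g)"
  shows "openin isom_topology {h \<in> carrier isom_group. f h < r}"
proof -
  have "limitin isom_topology (\<lambda>h. h) g (atin isom_topology g)" if "g \<in> carrier isom_group" for g :: "'u \<Rightarrow> 'u"
    using limitin_continuous_map[OF continuous_map_id, of g isom_topology] that by (simp add: id_def)
  then have "continuous_map isom_topology euclideanreal f"
    unfolding continuous_map_atin using assms by simp
  then show ?thesis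
    unfolding continuous_map_upper_lower_semicontinuous_lt by simp
qed

lemma open_graded_coset:
  fixes Q :: "'u::metric_space set"
  assumes "\<rho> \<in> urysohn_graded_cosets Q G\<^sub>0" "G\<^sub>0 \<subseteq> carrier isom_group"
  shows "open_graded isom_topology \<rho>"
proof -
  obtain g\<^sub>0 P where "g\<^sub>0 \<in> G\<^sub>0" and P: "\<And>q a. (q, a) \<in> set P \<Longrightarrow> q > 0 \<and> a \<in> Q"
    and \<rho>: "\<rho> = (\<lambda>h\<in>carrier isom_group. coset_penalty P g\<^sub>0 h)"
    using graded_coset_eq_penalty[OF assms] by blast
  have "coset_penalty P g\<^sub>0 h \<le> 1" for h
    unfolding coset_penalty_def by (subst foldr_max_le_iff) (auto simp: dscale_def)
  then have "\<rho> \<in> graded_subsets (carrier isom_group)"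
    by (auto simp: \<rho> graded_subsets_def coset_penalty_def foldr_max_nonneg)
  moreover have "graded_lt (carrier isom_group) \<rho> r = {h \<in> carrier isom_group. coset_penalty P g\<^sub>0 h < r}" for r
    by (auto simp: graded_lt_def \<rho>)
  ultimately show ?thesis
    by (simp add: open_graded_def openin_isom_topology_less tendsto_coset_penalty)
qed

text \<open>Symmetry and subadditivity come from d(g^-1 a, a) = d(a, g a) and d(g g' a, g a) = d(g'
  a, a). Truncating nonnegative values preserves subadditivity.\<close>

lemma basic_graded_subgroup_graded_subgroup:
  fixes s :: "'u::metric_space list"
  assumes "q > 0"
  shows "graded_subgroup isom_group (basic_graded_subgroup q s)"
  unfolding graded_subgroup_def
proof (intro conjI ballI)
  let ?H = "basic_graded_subgroup q s" and ?d = "\<lambda>g. tuple_dist (map g s) s"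
  have q: "real_of_rat q > 0" using assms by simp
  have H: "?H g = min (of_rat q * ?d g) 1" if "g \<in> carrier isom_group" for g
    using that by (simp add: basic_graded_subgroup_def)
  have d_le: "?d g \<le> e \<longleftrightarrow> (\<forall>a\<in>set s. dist (g a) a \<le> e)" if "0 \<le> e" for g e
    using tuple_dist_map_le_iff[OF that, of g s "\<lambda>x. x"] by simp
  show "?H \<in> graded_subsets (carrier isom_group)"
    using q by (auto simp: graded_subsets_def basic_graded_subgroup_def tuple_dist_nonneg)
  have "?d id \<le> 0" by (subst d_le) auto
  then show "?H \<one>\<^bsub>isom_group\<^esub> = 0"
    using tuple_dist_nonneg[of "map id s" s] by (simp add: H id_isom)
  fix g :: "'u \<Rightarrow> 'u" assume g: "g \<in> carrier isom_group"
  have "?d (inv\<^bsub>isom_group\<^esub> g) = ?d g"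
    using dist_inv_isom[OF g] by (intro nonneg_eq_iff_le tuple_dist_nonneg) (simp add: d_le dist_commute)
  then show "?H (inv\<^bsub>isom_group\<^esub> g) = ?H g"
    using g by (simp add: H inv_isom)
  fix g' :: "'u \<Rightarrow> 'u" assume g': "g' \<in> carrier isom_group"
  have "?d (g \<circ> g') \<le> ?d g + ?d g'"
  proof (subst d_le, intro add_nonneg_nonneg tuple_dist_nonneg, intro ballI)
    fix a assume a: "a \<in> set s"
    have "dist (g (g' a)) a \<le> dist (g (g' a)) (g a) + dist (g a) a"
      by (rule dist_triangle)
    also have "\<dots> = dist (g' a) a + dist (g a) a"
      using g by (simp add: isom_dist)
    also have "\<dots> \<le> ?d g' + ?d g"
      using d_le[OF tuple_dist_nonneg, of g' "map g' s" s] d_le[OF tuple_dist_nonneg, of g "map g s" s] a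
      by (intro add_mono) auto
    finally show "dist ((g \<circ> g') a) a \<le> ?d g + ?d g'" by simp
  qed
  then have "of_rat q * ?d (g \<circ> g') \<le> of_rat q * ?d g + of_rat q * ?d g'"
    using q by (simp flip: distrib_left)
  moreover have "0 \<le> of_rat q * ?d g" "0 \<le> of_rat q * ?d g'"
    using q by (simp_all add: tuple_dist_nonneg)
  ultimately show "?H (g \<otimes>\<^bsub>isom_group\<^esub> g') \<le> ?H g + ?H g'"
    using g g' by (simp add: H comp_isom)
qed

lemma basic_graded_subgroup_coset:
  assumes "q > 0" "set s \<subseteq> Q" "id \<in> G\<^sub>0"
  shows "basic_graded_subgroup q s \<in> urysohn_graded_cosets Q G\<^sub>0"
proof -
  let ?H = "basic_graded_subgroup q s"
  have "?H \<in> basic_graded_subgroups Q"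
    using assms unfolding basic_graded_subgroups_def by blast
  then have "(\<lambda>g\<in>carrier isom_group. Max ((\<lambda>H. H g) ` {?H})) \<in> max_graded_subgroups Q"
    unfolding max_graded_subgroups_def by blast
  moreover have "?H = graded_coset isom_group (\<lambda>g\<in>carrier isom_group. Max ((\<lambda>H. H g) ` {?H})) id"
    by (rule extensionalityI[of _ "carrier isom_group"])
       (auto simp: graded_coset_def basic_graded_subgroup_def)
  ultimately show ?thesis
    using assms(3) unfolding urysohn_graded_cosets_def by blast
qed

section \<open>Vaught transforms of sentences\<close>

abbreviation max_formula :: "'r cformula list \<Rightarrow> 'r cformula"
  where "max_formula \<phi>s \<equiv> foldr FMax \<phi>s FZero"

lemma is_formula_max_formula: "is_formula L (max_formula \<phi>s) \<longleftrightarrow> (\<forall>\<phi>\<in>set \<phi>s. is_formula L \<phi>)"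
  by (induction \<phi>s) auto

lemma free_vars_max_formula: "free_vars (max_formula \<phi>s) = (\<Union>\<phi>\<in>set \<phi>s. free_vars \<phi>)"
  by (induction \<phi>s) auto

lemma formula_value_max_formula:
  "formula_value M v (max_formula \<phi>s) = foldr max (map (formula_value M v) \<phi>s) 0"
  by (induction \<phi>s) auto

primrec inf_formula :: "nat \<Rightarrow> 'r cformula \<Rightarrow> 'r cformula" where
  "inf_formula 0 \<phi> = \<phi>"
| "inf_formula (Suc m) \<phi> = FInf m (inf_formula m \<phi>)"

lemma is_formula_inf_formula: "is_formula L (inf_formula m \<phi>) \<longleftrightarrow> is_formula L \<phi>"
  by (induction m) auto

lemma free_vars_inf_formula: "free_vars (inf_formula m \<phi>) = free_vars \<phi> - {..<m}"
proof (induction m)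
  case (Suc m)
  have "{..<Suc m} = insert m {..<m}" by (rule lessThan_Suc)
  then show ?case unfolding inf_formula.simps free_vars.simps Suc by blast
qed simp

context lipschitz_structures
begin

text \<open>With the next lemma this characterises the block of quantifiers as a greatest lower
  bound over all \<open>u\<close>.\<close>

lemma inf_formula_lower:
  assumes "M \<in> \<S>" "is_formula L \<phi>"
  shows "formula_value M v (inf_formula m \<phi>) \<le> formula_value M (\<lambda>i. if i < m then u i else v i) \<phi>"
proof (induction m arbitrary: v)
  case (Suc m)
  have "formula_value M v (inf_formula (Suc m) \<phi>) \<le> formula_value M (v(m := u m)) (inf_formula m \<phi>)"
    using cINF_lower[OF formula_value_INF_bdd UNIV_I] assms by (simp add: is_formula_inf_formula)
  also have "\<dots> \<le> formula_value M (\<lambda>i. if i < m then u i else (v(m := u m)) i) \<phi>"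
    by (rule Suc)
  also have "(\<lambda>i. if i < m then u i else (v(m := u m)) i) = (\<lambda>i. if i < Suc m then u i else v i)"
    by (auto simp: fun_eq_iff less_Suc_eq)
  finally show ?case .
qed simp

lemma inf_formula_greatest:
  assumes "\<And>u. c \<le> formula_value M (\<lambda>i. if i < m then u i else v i) \<phi>"
  shows "c \<le> formula_value M v (inf_formula m \<phi>)"
  using assms
proof (induction m arbitrary: v)
  case (Suc m)
  have "c \<le> formula_value M (v(m := a)) (inf_formula m \<phi>)" for a
  proof (rule Suc.IH)
    fix u
    have "(\<lambda>i. if i < Suc m then (u(m := a)) i else v i) = (\<lambda>i. if i < m then u i else (v(m := a)) i)"
      by (auto simp: fun_eq_iff less_Suc_eq)
    with Suc.prems[of "u(m := a)"] show "c \<le> formula_value M (\<lambda>i. if i < m then u i else (v(m := a)) i) \<phi>"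
      by simp
  qed
  then show ?case
    by (auto intro: cINF_greatest)
qed simp

lemma tendsto_formula_value:
  assumes M: "M \<in> \<S>" and \<phi>: "is_formula L \<phi>"
    and lim: "\<And>x. x \<in> free_vars \<phi> \<Longrightarrow> ((\<lambda>a. f a x) \<longlongrightarrow> l x) F"
  shows "((\<lambda>a. formula_value M (f a) \<phi>) \<longlongrightarrow> formula_value M l \<phi>) F"
proof (rule tendstoI)
  fix e :: real assume "e > 0"
  obtain K where K: "0 \<le> K" "formula_lipschitz K \<phi>"
    using ex_formula_lipschitz[OF \<phi>] by blast
  \<comment> \<open>The summand 1 allows for \<open>K = 0\<close>.\<close>
  define e' where "e' = e / (K + 1)"
  have e': "e' > 0" "K * e' < e"
    using \<open>e > 0\<close> K(1) by (simp_all add: e'_def field_simps)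
  have "\<forall>\<^sub>F a in F. \<forall>x\<in>free_vars \<phi>. dist (f a x) (l x) < e'"
    using tendstoD[OF lim e'(1)] by (simp add: eventually_ball_finite finite_free_vars)
  then show "\<forall>\<^sub>F a in F. dist (formula_value M (f a) \<phi>) (formula_value M l \<phi>) < e"
  proof eventually_elim
    case (elim a)
    then have "\<bar>formula_value M (f a) \<phi> - formula_value M l \<phi>\<bar> \<le> K * e'"
      using e'(1) by (intro formula_lipschitzD[OF K(2) M]) (auto simp: less_imp_le)
    with e'(2) show ?case
      by (simp add: dist_real_def)
  qed
qed

end

section \<open>Vaught transforms and invariance of sentences over the Urysohn space\<close>

locale urysohn_structures = lipschitz_structures Q L \<nu>
  for Q :: "'u::polish_space set" and L :: "'r signature" and \<nu> +
  fixes G\<^sub>0 :: "('u \<Rightarrow> 'u) set"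
  assumes urysohn: "urysohn_space TYPE('u)"
    and subgroup_G\<^sub>0: "subgroup G\<^sub>0 isom_group"
    and G\<^sub>0_preserves: "G\<^sub>0 \<subseteq> isom_preserving Q"
begin

lemma G\<^sub>0_isom: "G\<^sub>0 \<subseteq> carrier isom_group"
  using G\<^sub>0_preserves by (auto simp: isom_preserving_def)

text \<open>Makes the fixed points g_0^-1 a of a coset admissible as parameters.\<close>

lemma G\<^sub>0_inv_mem:
  assumes "g \<in> G\<^sub>0" "a \<in> Q"
  shows "(inv\<^bsub>isom_group\<^esub> g) a \<in> Q"
proof -
  obtain b where "b \<in> Q" "a = g b"
    using assms G\<^sub>0_preserves by (auto simp: isom_preserving_def)
  then show ?thesis
    using assms(1) G\<^sub>0_isom by auto
qed

text \<open>The orbit of a configuration consists of the isometric copies of it. Hence quantifying over the orbit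
  amounts to quantifying over all tuples with a penalty for the distortion, which by perturbation is
  exact as soon as its slope dominates the Lipschitz constant of the formula.\<close>

lemma orbit_infimum_sentence:
  assumes \<theta>: "is_formula L \<theta>" and fv: "free_vars \<theta> \<subseteq> {..<N}" and "m \<le> N" and w: "w ` {..<N} \<subseteq> Q"
  shows "(\<lambda>M\<in>\<S>. INF k\<in>carrier isom_group. formula_value M (\<lambda>i. if i < m then k (w i) else w i) \<theta>) \<in> \<B>"
proof -
  obtain K where K: "0 \<le> K" "formula_lipschitz K \<theta>"
    using ex_formula_lipschitz[OF \<theta>] by blast
  \<comment> \<open>The slope has to be a positive rational that dominates \<open>K\<close>; a
    natural number above both \<open>K\<close> and 1 is one.\<close>
  obtain n :: nat where n: "max K 1 < real n"
    using reals_Archimedean2 by blast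
  define C :: rat where "C = of_nat n"
  have C: "0 < C" "0 < real_of_rat C" "K \<le> real_of_rat C"
    using n by (auto simp: C_def)
  \<comment> \<open>The distortion as a formula: variables below \<open>m\<close> carry the tuple
    under the quantifiers, and the variables \<open>N + i\<close> a fixed copy of the original
    tuple.\<close>
  define \<pi> :: "'r cformula"
    where "\<pi> = max_formula [FAbsDiff (FDist i j) (FDist (N + i) (N + j)). i \<leftarrow> [0..<m], j \<leftarrow> [0..<m]]"
  \<comment> \<open>The first \<open>m\<close> slots get bound, so the original points are stored a
    second time from slot \<open>N\<close> on.\<close>
  define w' where "w' i = (if i < N then w i else w (i - N))" for i
  let ?\<psi> = "FPlus \<theta> (FScale C \<pi>)"
  have form: "is_formula L ?\<psi>"
    using \<theta> C(1) by (auto simp: \<pi>_def is_formula_max_formula)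
  have fv\<pi>: "free_vars \<pi> \<subseteq> {..<m} \<union> {N..<N + m}"
    by (auto simp: \<pi>_def free_vars_max_formula)
  let ?u = "\<lambda>u i. if i < m then u i else w' i"
  define pen where "pen M u = formula_value M (?u u) \<pi>" for M u
  have pen_nonneg: "0 \<le> pen M u" for M u
    by (simp add: pen_def \<pi>_def formula_value_max_formula foldr_max_nonneg)
  have pen_le: "pen M u \<le> e \<longleftrightarrow> (\<forall>i<m. \<forall>j<m. \<bar>dist (u i) (u j) - dist (w i) (w j)\<bar> \<le> e)"
    if "0 \<le> e" for M :: "('r, 'u) structure_on" and u e
  proof -
    have "set [FAbsDiff (FDist i j) (FDist (N + i) (N + j)). i \<leftarrow> [0..<m], j \<leftarrow> [0..<m]]
      = (\<lambda>(i, j). FAbsDiff (FDist i j) (FDist (N + i) (N + j)) :: 'r cformula) ` ({..<m} \<times> {..<m})"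
      by auto
    then have "pen M u \<le> e \<longleftrightarrow> (\<forall>(i, j)\<in>{..<m} \<times> {..<m}.
        formula_value M (?u u) (FAbsDiff (FDist i j) (FDist (N + i) (N + j))) \<le> e)"
      unfolding pen_def \<pi>_def formula_value_max_formula foldr_max_le_iff[OF that] set_map
      by (simp only: ball_simps case_prod_unfold)
    also have "\<dots> \<longleftrightarrow> (\<forall>i<m. \<forall>j<m. \<bar>dist (u i) (u j) - dist (w i) (w j)\<bar> \<le> e)"
      using \<open>m \<le> N\<close> by (auto simp: w'_def)
    finally show ?thesis .
  qed
  have val: "formula_value M (?u u) ?\<psi>
      = dplus (formula_value M (\<lambda>i. if i < m then u i else w i) \<theta>) (dscale C (pen M u))"
    if M: "M \<in> \<S>" for M u
  proof -
    have "formula_value M (?u u) \<theta> = formula_value M (\<lambda>i. if i < m then u i else w i) \<theta>"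
      using fv by (intro formula_value_cong[OF M \<theta>]) (auto simp: w'_def)
    then show ?thesis
      by (simp add: pen_def)
  qed
  show ?thesis
  proof (rule sentenceI)
    show "is_formula L (inf_formula m ?\<psi>)"
      using form by (simp only: is_formula_inf_formula)
    show "w' ` free_vars (inf_formula m ?\<psi>) \<subseteq> Q"
    proof
      fix y assume "y \<in> w' ` free_vars (inf_formula m ?\<psi>)"
      then obtain x where "y = w' x" "x \<in> free_vars \<theta> \<or> x \<in> free_vars \<pi>" "\<not> x < m"
        by (auto simp: free_vars_inf_formula)
      then show "y \<in> Q"
        using fv fv\<pi> w \<open>m \<le> N\<close> by (auto simp: w'_def image_subset_iff subset_iff)
    qed
    fix M assume M: "M \<in> \<S>"
    let ?f = "\<lambda>k. formula_value M (\<lambda>i. if i < m then k (w i) else w i) \<theta>"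
    have range: "0 \<le> formula_value M v \<theta> \<and> formula_value M v \<theta> \<le> 1" for v
      by (rule formula_value_range[OF M \<theta>])
    have bdd: "bdd_below (?f ` carrier isom_group)"
      using range by (intro bdd_belowI[of _ 0]) auto
    show "(INF k\<in>carrier isom_group. ?f k) = formula_value M w' (inf_formula m ?\<psi>)"
    proof (rule antisym)
      show "(INF k\<in>carrier isom_group. ?f k) \<le> formula_value M w' (inf_formula m ?\<psi>)"
      proof (rule inf_formula_greatest)
        fix u
        let ?I = "INF k\<in>carrier isom_group. ?f k" and ?v = "formula_value M (\<lambda>i. if i < m then u i else w i) \<theta>"
        \<comment> \<open>Takes care of both truncations: where one is active, the formula has the
          value 1.\<close>
        have "?I \<le> 1"
          using cINF_lower[OF bdd id_isom] range by (meson order_trans)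
        have "?I \<le> ?v + of_rat C * pen M u + e" if "e > 0" for e
        proof -
          \<comment> \<open>The distortion may be 0, but perturbation needs a positive bound. The
            extra summand becomes exactly \<open>e\<close> after multiplication by the
            slope.\<close>
          define \<epsilon> where "\<epsilon> = pen M u + e / of_rat C"
          have \<epsilon>: "0 < \<epsilon>" "pen M u \<le> \<epsilon>"
            using pen_nonneg[of M u] that C(2) by (auto simp: \<epsilon>_def add_nonneg_pos)
          then have "\<bar>dist (u i) (u j) - dist (w i) (w j)\<bar> \<le> \<epsilon>" if "i < m" "j < m" for i j
            using pen_le[of \<epsilon> M u] that by simp
          then obtain k where k: "k \<in> carrier isom_group" "\<And>i. i < m \<Longrightarrow> dist (u i) (k (w i)) \<le> \<epsilon>"
            using urysohn_perturbation[OF urysohn \<epsilon>(1), of m u w] by blast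
          have "\<bar>?f k - ?v\<bar> \<le> K * \<epsilon>"
            using k(2) \<epsilon>(1) by (intro formula_lipschitzD[OF K(2) M]) (auto simp: dist_commute)
          also have "\<dots> \<le> of_rat C * \<epsilon>"
            using C(3) \<epsilon>(1) by (intro mult_right_mono) auto
          also have "\<dots> = of_rat C * pen M u + e"
            using C(2) by (simp add: \<epsilon>_def distrib_left)
          finally show ?thesis
            using cINF_lower[OF bdd k(1)] by linarith
        qed
        then have "?I \<le> ?v + of_rat C * pen M u"
          by (rule field_le_epsilon)
        with \<open>?I \<le> 1\<close> show "?I \<le> formula_value M (?u u) ?\<psi>"
          unfolding val[OF M] using range[of "\<lambda>i. if i < m then u i else w i"]
          by (simp add: dplus_def dscale_def min_def)
      qed
      show "formula_value M w' (inf_formula m ?\<psi>) \<le> (INF k\<in>carrier isom_group. ?f k)"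
      proof (rule cINF_greatest)
        fix k :: "'u \<Rightarrow> 'u" assume k: "k \<in> carrier isom_group"
        \<comment> \<open>An isometric copy has no distortion, so it competes in the formula without
          any penalty.\<close>
        have "pen M (\<lambda>i. k (w i)) \<le> 0"
          using isom_dist[OF k] by (simp add: pen_le)
        then have "pen M (\<lambda>i. k (w i)) = 0"
          using pen_nonneg by (simp add: antisym)
        then show "formula_value M w' (inf_formula m ?\<psi>) \<le> ?f k"
          using inf_formula_lower[OF M form, of w' m "\<lambda>i. k (w i)"] range
          unfolding val[OF M] by (simp add: dplus_def dscale_def)
      qed (use id_isom in auto)
    qed
  qed
qed

lemma tendsto_formula_value_transport:
  assumes M: "M \<in> \<S>" and \<phi>: "is_formula L \<phi>" and lim: "limitin isom_topology f l F"
  shows "((\<lambda>a. formula_value M (inv\<^bsub>isom_group\<^esub> (f a) \<circ> v) \<phi>)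
    \<longlongrightarrow> formula_value M (inv\<^bsub>isom_group\<^esub> l \<circ> v) \<phi>) F"
  using limitin_isom_inv[OF lim] by (intro tendsto_formula_value[OF M \<phi>]) (simp add: limitin_isom_topology)

text \<open>Substituting h = k^-1 in the infimum over the group moves the isometry from the
  structure to the parameters, where \<open>orbit_infimum_sentence\<close> applies.\<close>

lemma vaught_delta_sentence:
  assumes f: "f \<in> \<B>" and \<rho>: "\<rho> \<in> urysohn_graded_cosets Q G\<^sub>0"
  shows "vaught_delta isom_topology X (transport L) \<rho> f \<in> \<B>"
proof -
  obtain \<phi> v where \<phi>: "is_formula L \<phi>" "v ` free_vars \<phi> \<subseteq> Q" and f_eq: "f = (\<lambda>M\<in>\<S>. formula_value M v \<phi>)"
    using f by (rule sentenceE)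
  obtain g\<^sub>0 P where g\<^sub>0: "g\<^sub>0 \<in> G\<^sub>0" and P: "\<And>q a. (q, a) \<in> set P \<Longrightarrow> q > 0 \<and> a \<in> Q"
    and \<rho>_eq: "\<rho> = (\<lambda>h\<in>carrier isom_group. coset_penalty P g\<^sub>0 h)"
    using graded_coset_eq_penalty[OF \<rho> G\<^sub>0_isom] by blast
  obtain z where z: "z \<in> Q" using Q_nonempty by blast
  obtain n where n: "\<And>x. x \<in> free_vars \<phi> \<Longrightarrow> x < n"
    using finite_nat_set_iff_bounded finite_free_vars by metis
  let ?p = "length P"
  define w where "w i = (if i < n then (if i \<in> free_vars \<phi> then v i else z)
    else if i < n + ?p then snd (P ! (i - n)) else (inv\<^bsub>isom_group\<^esub> g\<^sub>0) (snd (P ! (i - n - ?p))))" for i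
  define \<theta> where "\<theta> = FPlus \<phi>
    (max_formula (map (\<lambda>i. FScale (fst (P ! i)) (FDist (n + i) (n + ?p + i))) [0..<?p]))"
  have PQ: "fst (P ! i) > 0" "snd (P ! i) \<in> Q" if "i < ?p" for i
    using P[of "fst (P ! i)" "snd (P ! i)"] that by auto
  have "is_formula L \<theta>"
    using \<phi>(1) PQ by (auto simp: \<theta>_def is_formula_max_formula)
  moreover have "free_vars \<theta> \<subseteq> {..<n + ?p + ?p}"
    using n by (fastforce simp: \<theta>_def free_vars_max_formula)
  moreover have "w ` {..<n + ?p + ?p} \<subseteq> Q"
    using \<phi>(2) z PQ G\<^sub>0_inv_mem[OF g\<^sub>0] by (auto simp: w_def image_subset_iff)
  ultimately have orbit: "(\<lambda>M\<in>\<S>. INF k\<in>carrier isom_group.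
      formula_value M (\<lambda>i. if i < n + ?p then k (w i) else w i) \<theta>) \<in> \<B>"
    by (intro orbit_infimum_sentence) auto
  have val: "formula_value M (\<lambda>i. if i < n + ?p then k (w i) else w i) \<theta>
      = dplus (f (transport L (inv\<^bsub>isom_group\<^esub> k) M)) (\<rho> (inv\<^bsub>isom_group\<^esub> k))"
    if M: "M \<in> \<S>" and k: "k \<in> carrier isom_group" for M k
  proof -
    have "formula_value M (\<lambda>i. if i < n + ?p then k (w i) else w i) \<phi> = formula_value M (k \<circ> v) \<phi>"
      using n by (intro formula_value_cong[OF M \<phi>(1)]) (auto simp: w_def less_imp_le trans_less_add1)
    also have "\<dots> = f (transport L (inv\<^bsub>isom_group\<^esub> k) M)"
      using M k inv_isom[OF k] by (simp add: f_eq transport_in formula_value_transport)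
    finally have 1: "formula_value M (\<lambda>i. if i < n + ?p then k (w i) else w i) \<phi>
      = f (transport L (inv\<^bsub>isom_group\<^esub> k) M)" .
    \<comment> \<open>Entry by entry this is d(k a, g_0^-1 a) = d(k^-1 g_0^-1 a, a), the isometry
      changing sides.\<close>
    have "map (\<lambda>i. dscale (fst (P ! i)) (dist (k (w (n + i))) (w (n + ?p + i)))) [0..<?p]
      = map (\<lambda>(q, a). dscale q (dist ((inv\<^bsub>isom_group\<^esub> k) ((inv\<^bsub>isom_group\<^esub> g\<^sub>0) a)) a)) P"
      by (rule nth_equalityI)
        (auto simp: w_def case_prod_unfold dist_inv_isom[OF k] dist_commute[of "k _"])
    then have "foldr max (map (\<lambda>i. dscale (fst (P ! i)) (dist (k (w (n + i))) (w (n + ?p + i)))) [0..<?p]) 0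
      = coset_penalty P g\<^sub>0 (inv\<^bsub>isom_group\<^esub> k)"
      by (simp add: coset_penalty_def)
    also have "\<dots> = \<rho> (inv\<^bsub>isom_group\<^esub> k)"
      using inv_isom[OF k] by (simp add: \<rho>_eq)
    finally have 2: "foldr max (map (\<lambda>i. dscale (fst (P ! i)) (dist (k (w (n + i))) (w (n + ?p + i)))) [0..<?p]) 0
      = \<rho> (inv\<^bsub>isom_group\<^esub> k)" .
    have "map (formula_value M (\<lambda>i. if i < n + ?p then k (w i) else w i))
        (map (\<lambda>i. FScale (fst (P ! i)) (FDist (n + i) (n + ?p + i))) [0..<?p])
      = map (\<lambda>i. dscale (fst (P ! i)) (dist (k (w (n + i))) (w (n + ?p + i)))) [0..<?p]"
      by simp
    then show ?thesis
      unfolding \<theta>_def formula_value.simps formula_value_max_formula by (simp only: 1 2)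
  qed
  have "vaught_delta isom_topology X (transport L) \<rho> f M
      = (INF k\<in>carrier isom_group. formula_value M (\<lambda>i. if i < n + ?p then k (w i) else w i) \<theta>)"
    if M: "M \<in> \<S>" for M
  proof -
    let ?F = "\<lambda>h. dplus (f (transport L h M)) (\<rho> h)"
    have "vaught_delta isom_topology X (transport L) \<rho> f M = (INF h\<in>topspace isom_topology. ?F h)"
    proof (rule vaught_delta_eq_INF)
      show "completely_metrizable_space (isom_topology :: ('u \<Rightarrow> 'u) topology)"
        using polish_isom_topology[where 'u = 'u] by (simp add: polish_topology_def)
      show "topspace isom_topology \<noteq> ({} :: ('u \<Rightarrow> 'u) set)"
        using id_isom by auto
      show "open_graded isom_topology \<rho>"
        using \<rho> G\<^sub>0_isom by (rule open_graded_coset)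
      show "M \<in> topspace X"
        using M by simp
      have "f (transport L h M) = formula_value M (inv\<^bsub>isom_group\<^esub> h \<circ> v) \<phi>" if "h \<in> carrier isom_group" for h
        using that M by (simp add: f_eq transport_in formula_value_transport)
      then have "{h \<in> topspace isom_topology. f (transport L h M) < r}
        = {h \<in> carrier isom_group. formula_value M (inv\<^bsub>isom_group\<^esub> h \<circ> v) \<phi> < r}" for r
        by auto
      then show "openin isom_topology {h \<in> topspace isom_topology. f (transport L h M) < r}" for r
        using openin_isom_topology_less[OF tendsto_formula_value_transport[OF M \<phi>(1)]] by simp
      show "0 \<le> f (transport L h M)" if "h \<in> topspace isom_topology" for h
        using sentence_range[OF f transport_in] that M by simp
    qed
    also have "topspace isom_topology = (\<lambda>k. inv\<^bsub>isom_group\<^esub> k) ` (carrier isom_group :: ('u \<Rightarrow> 'u) set)"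
      using inv_isom isom_inv_inv by (force simp: image_iff)
    also have "(INF h\<in>(\<lambda>k. inv\<^bsub>isom_group\<^esub> k) ` carrier isom_group. ?F h)
      = (INF k\<in>carrier isom_group. ?F (inv\<^bsub>isom_group\<^esub> k))"
      by (simp add: image_image)
    also have "\<dots> = (INF k\<in>carrier isom_group. formula_value M (\<lambda>i. if i < n + ?p then k (w i) else w i) \<theta>)"
      by (intro INF_cong refl val[OF M, symmetric])
    finally show ?thesis .
  qed
  then have "vaught_delta isom_topology X (transport L) \<rho> f = (\<lambda>M\<in>\<S>. INF k\<in>carrier isom_group.
      formula_value M (\<lambda>i. if i < n + ?p then k (w i) else w i) \<theta>)"
    by (intro extensionalityI[of _ \<S>]) (auto simp: vaught_delta_def)
  with orbit show ?thesis by simp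
qed

lemma compl_sentence: "f \<in> \<B> \<Longrightarrow> (\<lambda>M\<in>\<S>. 1 - f M) \<in> \<B>"
  by (rule sentence_unary[of _ FCompl]) auto

lemma vaught_star_sentence:
  assumes f: "f \<in> \<B>" and \<rho>: "\<rho> \<in> urysohn_graded_cosets Q G\<^sub>0"
  shows "vaught_star isom_topology X (transport L) \<rho> f \<in> \<B>"
proof -
  have "vaught_star isom_topology X (transport L) \<rho> f
    = (\<lambda>M\<in>\<S>. 1 - vaught_delta isom_topology X (transport L) \<rho> (\<lambda>M\<in>\<S>. 1 - f M) M)"
    using vaught_star_eq_delta[OF open_graded_coset[OF \<rho> G\<^sub>0_isom], of X "transport L" f] transport_in
    by simp
  then show ?thesis
    using compl_sentence[OF vaught_delta_sentence[OF compl_sentence[OF f] \<rho>]] by simp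
qed

text \<open>Transport by \<open>g\<close> replaces the parameters by their images under g^-1, which
  are as far from the originals as the images under \<open>g\<close>. Scaling this distance by a
  rational above the Lipschitz constant bounds the change of the sentence; the coset representative
  is the identity.\<close>

lemma sentence_invariant:
  assumes f: "f \<in> \<B>"
  shows "\<exists>H\<in>urysohn_graded_cosets Q G\<^sub>0. open_graded isom_topology H \<and> graded_subgroup isom_group H \<and>
    graded_invariant isom_group \<S> (transport L) H f"
proof -
  obtain \<phi> v where \<phi>: "is_formula L \<phi>" "v ` free_vars \<phi> \<subseteq> Q" and f_eq: "f = (\<lambda>M\<in>\<S>. formula_value M v \<phi>)"
    using f by (rule sentenceE)
  obtain K where K: "0 \<le> K" "formula_lipschitz K \<phi>"
    using ex_formula_lipschitz[OF \<phi>(1)] by blast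
  obtain n :: nat where n: "max K 1 < real n"
    using reals_Archimedean2 by blast
  define q :: rat where "q = of_nat n"
  have q: "q > 0" "K \<le> of_rat q"
    using n by (auto simp: q_def)
  define s where "s = map v (sorted_list_of_set (free_vars \<phi>))"
  have s: "set s = v ` free_vars \<phi>"
    using finite_free_vars[of \<phi>] by (simp add: s_def)
  let ?H = "basic_graded_subgroup q s"
  have H: "?H \<in> urysohn_graded_cosets Q G\<^sub>0"
    using q s \<phi>(2) subgroup.one_closed[OF subgroup_G\<^sub>0] by (intro basic_graded_subgroup_coset) auto
  have "graded_invariant isom_group \<S> (transport L) ?H f"
    unfolding graded_invariant_def
  proof (intro ballI)
    fix g :: "'u \<Rightarrow> 'u" and M assume g: "g \<in> carrier isom_group" and M: "M \<in> \<S>"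
    let ?e = "tuple_dist (map g s) s" and ?v = "inv\<^bsub>isom_group\<^esub> g \<circ> v"
    have e: "dist (g a) a \<le> ?e" if "a \<in> set s" for a
      using tuple_dist_map_le_iff[OF tuple_dist_nonneg, of g s "\<lambda>x. x" "map g s" s] that by simp
    have "\<bar>formula_value M ?v \<phi> - formula_value M v \<phi>\<bar> \<le> K * ?e"
    proof (rule formula_lipschitzD[OF K(2) M tuple_dist_nonneg])
      fix x assume "x \<in> free_vars \<phi>"
      then show "dist (?v x) (v x) \<le> ?e"
        using e[of "v x"] s dist_inv_isom[OF g, of "v x" "v x"] by (simp add: dist_commute)
    qed
    also have "\<dots> \<le> of_rat q * ?e"
      using q(2) by (intro mult_right_mono tuple_dist_nonneg)
    finally have "formula_value M ?v \<phi> \<le> formula_value M v \<phi> + of_rat q * ?e"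
      by linarith
    then have "formula_value M ?v \<phi> \<le> dplus (formula_value M v \<phi>) (min (of_rat q * ?e) 1)"
      using formula_value_range[OF M \<phi>(1), of ?v] formula_value_range[OF M \<phi>(1), of v]
      by (auto simp: dplus_def min_def)
    then show "f (transport L g M) \<le> dplus (f M) (?H g)"
      using g M by (simp add: f_eq transport_in formula_value_transport basic_graded_subgroup_def)
  qed
  then show ?thesis
    using H open_graded_coset[OF H G\<^sub>0_isom] basic_graded_subgroup_graded_subgroup[OF q(1)] by blast
qed

lemma polish_gspace_structures: "polish_gspace isom_group isom_topology X (transport L)"
  unfolding polish_gspace_def
  using polish_group_isom_group polish_structure_topology group_action_transport continuous_map_transport
  by simp

lemma nice_basis_sentences:
  "nice_basis isom_group isom_topology X (transport L) (urysohn_graded_cosets Q G\<^sub>0) \<B>"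
  unfolding nice_basis_def
proof (intro conjI ballI allI impI polish_gspace_structures countable_sentences)
  fix f g assume f: "f \<in> \<B>" and g: "g \<in> \<B>"
  show "(\<lambda>M\<in>topspace X. min (f M) (g M)) \<in> \<B>"
    using sentence_binary[OF f g, of FMin min] by simp
  show "(\<lambda>M\<in>topspace X. max (f M) (g M)) \<in> \<B>"
    using sentence_binary[OF f g, of FMax max] by simp
  show "(\<lambda>M\<in>topspace X. \<bar>f M - g M\<bar>) \<in> \<B>"
    using sentence_binary[OF f g, of FAbsDiff "\<lambda>a b. \<bar>a - b\<bar>"] by simp
  show "(\<lambda>M\<in>topspace X. dminus (f M) (g M)) \<in> \<B>"
    using sentence_binary[OF f g, of FMinus dminus] by simp
  show "(\<lambda>M\<in>topspace X. dplus (f M) (g M)) \<in> \<B>"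
    using sentence_binary[OF f g, of FPlus dplus] by simp
next
  fix f and q :: rat assume "f \<in> \<B>" "0 < q"
  then show "(\<lambda>M\<in>topspace X. dscale q (f M)) \<in> \<B>"
    using sentence_unary[of f "FScale q" "dscale q"] by simp
next
  fix f assume "f \<in> \<B>"
  then show "\<exists>H\<in>urysohn_graded_cosets Q G\<^sub>0. open_graded isom_topology H \<and>
      graded_subgroup isom_group H \<and> graded_invariant isom_group (topspace X) (transport L) H f"
    unfolding topspace_structure_topology by (rule sentence_invariant)
qed (auto simp: compl_sentence sentence_borel open_graded_coset[OF _ G\<^sub>0_isom]
    vaught_delta_sentence vaught_star_sentence intro: sentence_topology_finer[simplified])

end

theorem mainTheorem4:
  fixes QU :: "'u::polish_space set"
    and G\<^sub>0 :: "('u \<Rightarrow> 'u) set"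
    and L :: "'r signature"
    and \<nu> :: "'r \<times> 'u list \<Rightarrow> nat"
  assumes "urysohn_space TYPE('u)"
    and "rational_urysohn_space QU"
    and "well_embedded QU"
    and "dense_countable_subgroup QU G\<^sub>0"
    and "continuous_signature L"
    and "countable (symbols L)"
    and "\<And>R t. R \<in> symbols L \<Longrightarrow> t \<in> {0..1} \<Longrightarrow> modulus L R t \<le> real (arity L R) * t"
    and "inj_on \<nu> (index_pairs L QU)"
  shows "nice_basis isom_group isom_topology (structure_topology L QU \<nu>) (transport L)
           (urysohn_graded_cosets QU G\<^sub>0) (sentence_graded_subsets L QU)"
proof -
  interpret urysohn_structures QU L \<nu> G\<^sub>0
    using assms
    by (intro urysohn_structures.intro urysohn_structures_axioms.intro lipschitz_structures.intro)
      (simp_all add: urysohn_space_def rational_urysohn_space_def well_embedded_def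
        dense_countable_subgroup_def)
  show ?thesis
    by (rule nice_basis_sentences)
qed

end
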